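(* Let $A$ be a separable $\mathrm{C}^*$-algebra, $H$ a countable, discrete group and $\alpha: H \curvearrowright A$ an action. The following are equivalent: (i) $\alpha$ is approximately representable. (ii) There is a unitary representation $w: H \to \mathcal{U}(\mathcal{M}(D_{\infty,A}))$ satisfying $$\alpha_h(a) = w_h a w_h^*\quad \text{and}\quad \tilde{\alpha}_{\infty,h}(w_g) = w_{hgh^{-1}}$$ for all $a \in A$ and $g,h \in H$. (iii) The canonical inclusion $\iota_A: (A,\alpha)\hookrightarrow (A\rtimes_\alpha H,\mathrm{Ad}(\lambda^\alpha))$ is equivariantly sequentially split.
   Context: $A_\infty=\ell^\infty(\mathbb{N},A)/c_0(\mathbb{N},A)$; $A$ embeds canonically as constant sequences. $D_{\infty,A}=\overline{A\cdot A_\infty\cdot A}\subset A_\infty$, which contains $A$ as a non-degenerate subalgebra; $\mathcal{M}(\cdot)$ is the multiplier algebra and $\mathcal{U}(\cdot)$ the unitary group. Componentwise application of $\alpha$ induces an action $\alpha_\infty$ of $H$ on $A_\infty$, hence an action $\tilde\alpha_\infty$ on $\mathcal{M}(D_{\infty,A})$. $\lambda^\alpha:H\to\mathcal{U}(\mathcal{M}(A\rtimes_\alpha H))$ is the canonical unitary representation, and $\mathrm{Ad}(\lambda^\alpha)$ the $H$-action $h\mapsto\mathrm{Ad}(\lambda^\alpha_h)$ on the (full) crossed product $A\rtimes_\alpha H$. For discrete $H$, an equivariant $*$-homomorphism $\varphi:(A,\alpha)\to(B,\beta)$ is equivariantly sequentially split if there is an equivariant $*$-homomorphism $\psi:(B,\beta)\to(A_\infty,\alpha_\infty)$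 with $\psi\circ\varphi$ the canonical inclusion $A\hookrightarrow A_\infty$. $\alpha$ is approximately representable if there exist contractions $x_{n,h}\in A$, $n\in\mathbb{N}$, $h\in H$, such that (1) for $h\in H$, $(x_{n,h}x_{n,h}^* )_n$ and $(x_{n,h}^*x_{n,h})_n$ are approximate units for $A$; (2) for all $g,h\in H$, $a\in A$: $\lim_{n\to\infty}\|a(x_{n,g}x_{n,h}-x_{n,gh})\|+\|(x_{n,g}x_{n,h}-x_{n,gh})a\|=0$; (3) for all $a\in A$, $h\in H$: $\lim_{n\to\infty}\|\alpha_h(a)-x_{n,h}ax_{n,h}^*\|=0$; (4) for all $g,h\in H$, $a\in A$: $\lim_{n\to\infty}\|a(x_{n,ghg^{-1}}-\alpha_g(x_{n,h}))\|+\|(x_{n,ghg^{-1}}-\alpha_g(x_{n,h}))a\|=0$. *)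

theory Defs
  imports
    "HOL-Analysis.Analysis"
    "HOL-Algebra.Module"
    "HOL-Algebra.QuotRing"
    "HOL-Algebra.Group_Action"
begin

section \<open>C*-algebras with explicit carriers\<close>

text \<open>
  The crossed product depends on the action, which is a term, so all algebras are records with a
  carrier, over the module record of HOL-Algebra. Algebras need not be unital: the inherited field
  \<open>one\<close> is ignored by the axioms below and carries information only in \<open>multiplier_algebra\<close>.
\<close>

definition complex_ring :: "complex ring" where
  "complex_ring = \<lparr>carrier = UNIV, mult = (*), one = 1, zero = 0, add = (+)\<rparr>"

record 'a cstar_struct = "(complex, 'a) module" +
  adj :: "'a \<Rightarrow> 'a"  ("_\<^sup>\<star>\<index>" [1000] 999)
  nrm :: "'a \<Rightarrow> real"  ("\<parallel>_\<parallel>\<index>")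

locale star_algebra = module complex_ring A for A :: "'a cstar_struct" (structure) +
  assumes mult_closed: "\<lbrakk>x \<in> carrier A; y \<in> carrier A\<rbrakk> \<Longrightarrow> x \<otimes>\<^bsub>A\<^esub> y \<in> carrier A"
    and mult_assoc: "\<lbrakk>x \<in> carrier A; y \<in> carrier A; z \<in> carrier A\<rbrakk>
      \<Longrightarrow> (x \<otimes>\<^bsub>A\<^esub> y) \<otimes>\<^bsub>A\<^esub> z = x \<otimes>\<^bsub>A\<^esub> (y \<otimes>\<^bsub>A\<^esub> z)"
    and distrib_right: "\<lbrakk>x \<in> carrier A; y \<in> carrier A; z \<in> carrier A\<rbrakk>
      \<Longrightarrow> (x \<oplus>\<^bsub>A\<^esub> y) \<otimes>\<^bsub>A\<^esub> z = x \<otimes>\<^bsub>A\<^esub> z \<oplus>\<^bsub>A\<^esub> y \<otimes>\<^bsub>A\<^esub> z"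
    and distrib_left: "\<lbrakk>x \<in> carrier A; y \<in> carrier A; z \<in> carrier A\<rbrakk>
      \<Longrightarrow> z \<otimes>\<^bsub>A\<^esub> (x \<oplus>\<^bsub>A\<^esub> y) = z \<otimes>\<^bsub>A\<^esub> x \<oplus>\<^bsub>A\<^esub> z \<otimes>\<^bsub>A\<^esub> y"
    and smult_mult_left: "\<lbrakk>x \<in> carrier A; y \<in> carrier A\<rbrakk>
      \<Longrightarrow> (c \<odot>\<^bsub>A\<^esub> x) \<otimes>\<^bsub>A\<^esub> y = c \<odot>\<^bsub>A\<^esub> (x \<otimes>\<^bsub>A\<^esub> y)"
    and smult_mult_right: "\<lbrakk>x \<in> carrier A; y \<in> carrier A\<rbrakk>
      \<Longrightarrow> x \<otimes>\<^bsub>A\<^esub> (c \<odot>\<^bsub>A\<^esub> y) = c \<odot>\<^bsub>A\<^esub> (x \<otimes>\<^bsub>A\<^esub> y)"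
    and adj_closed: "x \<in> carrier A \<Longrightarrow> x\<^sup>\<star>\<^bsub>A\<^esub> \<in> carrier A"
    and adj_adj: "x \<in> carrier A \<Longrightarrow> (x\<^sup>\<star>\<^bsub>A\<^esub>)\<^sup>\<star>\<^bsub>A\<^esub> = x"
    and adj_add: "\<lbrakk>x \<in> carrier A; y \<in> carrier A\<rbrakk>
      \<Longrightarrow> (x \<oplus>\<^bsub>A\<^esub> y)\<^sup>\<star>\<^bsub>A\<^esub> = x\<^sup>\<star>\<^bsub>A\<^esub> \<oplus>\<^bsub>A\<^esub> y\<^sup>\<star>\<^bsub>A\<^esub>"
    and adj_smult: "x \<in> carrier A \<Longrightarrow> (c \<odot>\<^bsub>A\<^esub> x)\<^sup>\<star>\<^bsub>A\<^esub> = cnj c \<odot>\<^bsub>A\<^esub> x\<^sup>\<star>\<^bsub>A\<^esub>"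
    and adj_mult: "\<lbrakk>x \<in> carrier A; y \<in> carrier A\<rbrakk>
      \<Longrightarrow> (x \<otimes>\<^bsub>A\<^esub> y)\<^sup>\<star>\<^bsub>A\<^esub> = y\<^sup>\<star>\<^bsub>A\<^esub> \<otimes>\<^bsub>A\<^esub> x\<^sup>\<star>\<^bsub>A\<^esub>"

definition cstar_seminorm :: "'a cstar_struct \<Rightarrow> ('a \<Rightarrow> real) \<Rightarrow> bool" where
  "cstar_seminorm A p \<longleftrightarrow>
    (\<forall>x\<in>carrier A. 0 \<le> p x) \<and>
    (\<forall>c. \<forall>x\<in>carrier A. p (c \<odot>\<^bsub>A\<^esub> x) = cmod c * p x) \<and>
    (\<forall>x\<in>carrier A. \<forall>y\<in>carrier A. p (x \<oplus>\<^bsub>A\<^esub> y) \<le> p x + p y) \<and>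
    (\<forall>x\<in>carrier A. \<forall>y\<in>carrier A. p (x \<otimes>\<^bsub>A\<^esub> y) \<le> p x * p y) \<and>
    (\<forall>x\<in>carrier A. p (x\<^sup>\<star>\<^bsub>A\<^esub> \<otimes>\<^bsub>A\<^esub> x) = (p x)\<^sup>2)"

text \<open>Set to 0 off the carrier, because \<open>Metric_space\<close> demands symmetry and nonnegativity there too.\<close>

definition cstar_dist :: "'a cstar_struct \<Rightarrow> 'a \<Rightarrow> 'a \<Rightarrow> real" where
  "cstar_dist A x y = (if x \<in> carrier A \<and> y \<in> carrier A then \<parallel>x \<ominus>\<^bsub>A\<^esub> y\<parallel>\<^bsub>A\<^esub> else 0)"

definition cstar_topology :: "'a cstar_struct \<Rightarrow> 'a topology" where
  "cstar_topology A = Metric_space.mtopology (carrier A) (cstar_dist A)"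

locale cstar_algebra = star_algebra +
  assumes nrm_cstar_seminorm: "cstar_seminorm A (nrm A)"
    and nrm_definite: "\<lbrakk>x \<in> carrier A; \<parallel>x\<parallel>\<^bsub>A\<^esub> = 0\<rbrakk> \<Longrightarrow> x = \<zero>\<^bsub>A\<^esub>"
    and complete: "Metric_space.mcomplete (carrier A) (cstar_dist A)"

definition star_hom :: "'a cstar_struct \<Rightarrow> 'b cstar_struct \<Rightarrow> ('a \<Rightarrow> 'b) \<Rightarrow> bool" where
  "star_hom A B \<phi> \<longleftrightarrow>
    \<phi> \<in> carrier A \<rightarrow> carrier B \<and>
    (\<forall>x\<in>carrier A. \<forall>y\<in>carrier A. \<phi> (x \<oplus>\<^bsub>A\<^esub> y) = \<phi> x \<oplus>\<^bsub>B\<^esub> \<phi> y) \<and>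
    (\<forall>c. \<forall>x\<in>carrier A. \<phi> (c \<odot>\<^bsub>A\<^esub> x) = c \<odot>\<^bsub>B\<^esub> \<phi> x) \<and>
    (\<forall>x\<in>carrier A. \<forall>y\<in>carrier A. \<phi> (x \<otimes>\<^bsub>A\<^esub> y) = \<phi> x \<otimes>\<^bsub>B\<^esub> \<phi> y) \<and>
    (\<forall>x\<in>carrier A. \<phi> (x\<^sup>\<star>\<^bsub>A\<^esub>) = (\<phi> x)\<^sup>\<star>\<^bsub>B\<^esub>)"

text \<open>\<open>group_action\<close> says that \<open>\<alpha>\<close> is a homomorphism into the bijections of the carrier; the
  elements of \<open>BijGroup\<close> are \<open>undefined\<close> off the carrier.\<close>

definition cstar_action ::
  "('h, 'm) monoid_scheme \<Rightarrow> 'a cstar_struct \<Rightarrow> ('h \<Rightarrow> 'a \<Rightarrow> 'a) \<Rightarrow> bool" where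
  "cstar_action H A \<alpha> \<longleftrightarrow>
    group_action H (carrier A) \<alpha> \<and> (\<forall>h\<in>carrier H. star_hom A A (\<alpha> h))"

definition equivariant_star_hom ::
  "('h, 'm) monoid_scheme \<Rightarrow> 'a cstar_struct \<Rightarrow> ('h \<Rightarrow> 'a \<Rightarrow> 'a) \<Rightarrow>
    'b cstar_struct \<Rightarrow> ('h \<Rightarrow> 'b \<Rightarrow> 'b) \<Rightarrow> ('a \<Rightarrow> 'b) \<Rightarrow> bool" where
  "equivariant_star_hom H A \<alpha> B \<beta> \<phi> \<longleftrightarrow>
    star_hom A B \<phi> \<and> (\<forall>h\<in>carrier H. \<forall>a\<in>carrier A. \<phi> (\<alpha> h a) = \<beta> h (\<phi> a))"


section \<open>Sequence algebras\<close>

definition linf :: "'a cstar_struct \<Rightarrow> (nat \<Rightarrow> 'a) cstar_struct" where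
  "linf B = \<lparr>
    carrier = {x. (\<forall>n. x n \<in> carrier B) \<and> (\<exists>C. \<forall>n. \<parallel>x n\<parallel>\<^bsub>B\<^esub> \<le> C)},
    mult = (\<lambda>x y n. x n \<otimes>\<^bsub>B\<^esub> y n),
    one = (\<lambda>_. \<one>\<^bsub>B\<^esub>),
    zero = (\<lambda>_. \<zero>\<^bsub>B\<^esub>),
    add = (\<lambda>x y n. x n \<oplus>\<^bsub>B\<^esub> y n),
    smult = (\<lambda>c x n. c \<odot>\<^bsub>B\<^esub> x n),
    adj = (\<lambda>x n. (x n)\<^sup>\<star>\<^bsub>B\<^esub>),
    nrm = (\<lambda>x. SUP n. \<parallel>x n\<parallel>\<^bsub>B\<^esub>)\<rparr>"

definition null_seqs :: "'a cstar_struct \<Rightarrow> (nat \<Rightarrow> 'a) set" where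
  "null_seqs B = {x \<in> carrier (linf B). (\<lambda>n. \<parallel>x n\<parallel>\<^bsub>B\<^esub>) \<longlonglongrightarrow> 0}"

definition cauchy_seqs :: "'a cstar_struct \<Rightarrow> (nat \<Rightarrow> 'a) set" where
  "cauchy_seqs B = {x \<in> carrier (linf B).
    \<forall>\<epsilon>>0. \<exists>N. \<forall>m\<ge>N. \<forall>n\<ge>N. \<parallel>x m \<ominus>\<^bsub>B\<^esub> x n\<parallel>\<^bsub>B\<^esub> < \<epsilon>}"

definition coset_map :: "'a cstar_struct \<Rightarrow> 'a set \<Rightarrow> ('a \<Rightarrow> 'a) \<Rightarrow> 'a set \<Rightarrow> 'a set" where
  "coset_map B I F X = (\<Union>x\<in>X. I +>\<^bsub>B\<^esub> F x)"

definition cstar_quotient :: "'a cstar_struct \<Rightarrow> 'a set \<Rightarrow> 'a set cstar_struct" where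
  "cstar_quotient B I = \<lparr>
    carrier = carrier (B Quot I),
    mult = mult (B Quot I),
    one = one (B Quot I),
    zero = zero (B Quot I),
    add = add (B Quot I),
    smult = (\<lambda>c. coset_map B I (\<lambda>x. c \<odot>\<^bsub>B\<^esub> x)),
    adj = coset_map B I (\<lambda>x. x\<^sup>\<star>\<^bsub>B\<^esub>),
    nrm = (\<lambda>X. INF x\<in>X. \<parallel>x\<parallel>\<^bsub>B\<^esub>)\<rparr>"

definition seq_algebra :: "'a cstar_struct \<Rightarrow> (nat \<Rightarrow> 'a) set cstar_struct" where
  "seq_algebra A = cstar_quotient (linf A) (null_seqs A)"

text \<open>The Hausdorff completion of a *-algebra whose \<open>nrm\<close> is a C*-seminorm. The quotient norm of a
  class of Cauchy sequences is the limit of the norms.\<close>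

definition cstar_completion :: "'a cstar_struct \<Rightarrow> (nat \<Rightarrow> 'a) set cstar_struct" where
  "cstar_completion B = cstar_quotient (linf B\<lparr>carrier := cauchy_seqs B\<rparr>) (null_seqs B)"

text \<open>The canonical map into \<open>seq_algebra B\<close> and, with the same underlying coset, into
  \<open>cstar_completion B\<close>.\<close>

definition const_seq :: "'a cstar_struct \<Rightarrow> 'a \<Rightarrow> (nat \<Rightarrow> 'a) set" where
  "const_seq B b = null_seqs B +>\<^bsub>linf B\<^esub> (\<lambda>_. b)"

definition seq_action ::
  "'a cstar_struct \<Rightarrow> ('h \<Rightarrow> 'a \<Rightarrow> 'a) \<Rightarrow> 'h \<Rightarrow> (nat \<Rightarrow> 'a) set \<Rightarrow> (nat \<Rightarrow> 'a) set" where
  "seq_action A \<alpha> h =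
    restrict (coset_map (linf A) (null_seqs A) (\<lambda>x n. \<alpha> h (x n))) (carrier (seq_algebra A))"

text \<open>\<open>D\<^sub>\<infinity>\<^sub>,\<^sub>A\<close>, where \<open>A \<cdot> A\<^sub>\<infinity> \<cdot> A\<close> is read as the linear span of the products; scalars are
  absorbed by the factors, so that finite sums of products suffice.\<close>

definition seq_hereditary :: "'a cstar_struct \<Rightarrow> (nat \<Rightarrow> 'a) set cstar_struct" where
  "seq_hereditary A = seq_algebra A\<lparr>carrier := cstar_topology (seq_algebra A) closure_of
    {\<Oplus>\<^bsub>seq_algebra A\<^esub>i\<in>{..<n}.
        const_seq A (a i) \<otimes>\<^bsub>seq_algebra A\<^esub> X i \<otimes>\<^bsub>seq_algebra A\<^esub> const_seq A (b i) | n a X b.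
      (\<forall>i<n::nat. a i \<in> carrier A \<and> X i \<in> carrier (seq_algebra A) \<and> b i \<in> carrier A)}\<rparr>"


section \<open>Multiplier algebras via double centralizers\<close>

definition bounded_op :: "'b cstar_struct \<Rightarrow> ('b \<Rightarrow> 'b) \<Rightarrow> bool" where
  "bounded_op B T \<longleftrightarrow>
    T \<in> carrier B \<rightarrow>\<^sub>E carrier B \<and>
    (\<forall>x\<in>carrier B. \<forall>y\<in>carrier B. T (x \<oplus>\<^bsub>B\<^esub> y) = T x \<oplus>\<^bsub>B\<^esub> T y) \<and>
    (\<forall>c. \<forall>x\<in>carrier B. T (c \<odot>\<^bsub>B\<^esub> x) = c \<odot>\<^bsub>B\<^esub> T x) \<and>
    (\<exists>C. \<forall>x\<in>carrier B. \<parallel>T x\<parallel>\<^bsub>B\<^esub> \<le> C * \<parallel>x\<parallel>\<^bsub>B\<^esub>)"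

text \<open>\<open>(L, R)\<close> is thought of as a multiplier \<open>m\<close> with \<open>L x = m x\<close> and \<open>R x = x m\<close>.\<close>

definition double_centralizers :: "'b cstar_struct \<Rightarrow> (('b \<Rightarrow> 'b) \<times> ('b \<Rightarrow> 'b)) set" where
  "double_centralizers B = {(L, R). bounded_op B L \<and> bounded_op B R \<and>
    (\<forall>x\<in>carrier B. \<forall>y\<in>carrier B.
      L (x \<otimes>\<^bsub>B\<^esub> y) = L x \<otimes>\<^bsub>B\<^esub> y \<and>
      R (x \<otimes>\<^bsub>B\<^esub> y) = x \<otimes>\<^bsub>B\<^esub> R y \<and>
      R x \<otimes>\<^bsub>B\<^esub> y = x \<otimes>\<^bsub>B\<^esub> L y)}"

definition multiplier_algebra :: "'b cstar_struct \<Rightarrow> (('b \<Rightarrow> 'b) \<times> ('b \<Rightarrow> 'b)) cstar_struct" where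
  "multiplier_algebra B = \<lparr>
    carrier = double_centralizers B,
    mult = (\<lambda>(L, R) (L', R'). (compose (carrier B) L L', compose (carrier B) R' R)),
    one = (\<lambda>x\<in>carrier B. x, \<lambda>x\<in>carrier B. x),
    zero = (\<lambda>x\<in>carrier B. \<zero>\<^bsub>B\<^esub>, \<lambda>x\<in>carrier B. \<zero>\<^bsub>B\<^esub>),
    add = (\<lambda>(L, R) (L', R').
      (\<lambda>x\<in>carrier B. L x \<oplus>\<^bsub>B\<^esub> L' x, \<lambda>x\<in>carrier B. R x \<oplus>\<^bsub>B\<^esub> R' x)),
    smult = (\<lambda>c (L, R). (\<lambda>x\<in>carrier B. c \<odot>\<^bsub>B\<^esub> L x, \<lambda>x\<in>carrier B. c \<odot>\<^bsub>B\<^esub> R x)),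
    adj = (\<lambda>(L, R).
      (\<lambda>x\<in>carrier B. (R (x\<^sup>\<star>\<^bsub>B\<^esub>))\<^sup>\<star>\<^bsub>B\<^esub>, \<lambda>x\<in>carrier B. (L (x\<^sup>\<star>\<^bsub>B\<^esub>))\<^sup>\<star>\<^bsub>B\<^esub>)),
    nrm = (\<lambda>(L, R). SUP x\<in>{x \<in> carrier B. \<parallel>x\<parallel>\<^bsub>B\<^esub> \<le> 1}. \<parallel>L x\<parallel>\<^bsub>B\<^esub>)\<rparr>"

definition multiplier_incl :: "'b cstar_struct \<Rightarrow> 'b \<Rightarrow> ('b \<Rightarrow> 'b) \<times> ('b \<Rightarrow> 'b)" where
  "multiplier_incl B b = (\<lambda>x\<in>carrier B. b \<otimes>\<^bsub>B\<^esub> x, \<lambda>x\<in>carrier B. x \<otimes>\<^bsub>B\<^esub> b)"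

text \<open>The extension to the multiplier algebra of an automorphism \<open>\<sigma>\<close> of \<open>B\<close>, determined by
  \<open>\<sigma>(m) x = \<sigma>(m \<sigma>\<^sup>-\<^sup>1(x))\<close>.\<close>

definition multiplier_extend ::
  "'b cstar_struct \<Rightarrow> ('b \<Rightarrow> 'b) \<Rightarrow> ('b \<Rightarrow> 'b) \<times> ('b \<Rightarrow> 'b) \<Rightarrow> ('b \<Rightarrow> 'b) \<times> ('b \<Rightarrow> 'b)" where
  "multiplier_extend B \<sigma> = (\<lambda>(L, R).
    (\<lambda>x\<in>carrier B. \<sigma> (L (inv_into (carrier B) \<sigma> x)),
     \<lambda>x\<in>carrier B. \<sigma> (R (inv_into (carrier B) \<sigma> x))))"

definition unitary_group :: "'b cstar_struct \<Rightarrow> 'b monoid" where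
  "unitary_group B = \<lparr>
    carrier = {u \<in> carrier B. u\<^sup>\<star>\<^bsub>B\<^esub> \<otimes>\<^bsub>B\<^esub> u = \<one>\<^bsub>B\<^esub> \<and> u \<otimes>\<^bsub>B\<^esub> u\<^sup>\<star>\<^bsub>B\<^esub> = \<one>\<^bsub>B\<^esub>},
    mult = mult B,
    one = one B\<rparr>"

text \<open>The element \<open>u (x u*)\<close> of \<open>B\<close>, for a multiplier \<open>u\<close> of \<open>B\<close>.\<close>

definition multiplier_Ad :: "'b cstar_struct \<Rightarrow> ('b \<Rightarrow> 'b) \<times> ('b \<Rightarrow> 'b) \<Rightarrow> 'b \<Rightarrow> 'b" where
  "multiplier_Ad B u = (\<lambda>x\<in>carrier B. fst u (snd (u\<^sup>\<star>\<^bsub>multiplier_algebra B\<^esub>) x))"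


section \<open>The full crossed product by a discrete group\<close>

text \<open>
  \<open>C\<^sub>c(H, A)\<close> as a *-algebra; \<open>f\<close> stands for the sum of the \<open>f(t) \<delta>\<^sub>t\<close>, and
  \<open>\<delta>\<^sub>t a = \<alpha>\<^sub>t(a) \<delta>\<^sub>t\<close>. The norm is a parameter.
\<close>

definition delta_one :: "('h, 'm) monoid_scheme \<Rightarrow> 'a cstar_struct \<Rightarrow> 'a \<Rightarrow> 'h \<Rightarrow> 'a" where
  "delta_one H A a = (\<lambda>s\<in>carrier H. if s = \<one>\<^bsub>H\<^esub> then a else \<zero>\<^bsub>A\<^esub>)"

definition conv_algebra ::
  "('h, 'm) monoid_scheme \<Rightarrow> 'a cstar_struct \<Rightarrow> ('h \<Rightarrow> 'a \<Rightarrow> 'a) \<Rightarrow> (('h \<Rightarrow> 'a) \<Rightarrow> real) \<Rightarrow>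
    ('h \<Rightarrow> 'a) cstar_struct" where
  "conv_algebra H A \<alpha> p = \<lparr>
    carrier = {f \<in> carrier H \<rightarrow>\<^sub>E carrier A. finite {t \<in> carrier H. f t \<noteq> \<zero>\<^bsub>A\<^esub>}},
    mult = (\<lambda>f g. \<lambda>s\<in>carrier H.
      \<Oplus>\<^bsub>A\<^esub>t\<in>{t \<in> carrier H. f t \<noteq> \<zero>\<^bsub>A\<^esub>}. f t \<otimes>\<^bsub>A\<^esub> \<alpha> t (g (inv\<^bsub>H\<^esub> t \<otimes>\<^bsub>H\<^esub> s))),
    one = delta_one H A \<one>\<^bsub>A\<^esub>,
    zero = (\<lambda>s\<in>carrier H. \<zero>\<^bsub>A\<^esub>),
    add = (\<lambda>f g. \<lambda>s\<in>carrier H. f s \<oplus>\<^bsub>A\<^esub> g s),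
    smult = (\<lambda>c f. \<lambda>s\<in>carrier H. c \<odot>\<^bsub>A\<^esub> f s),
    adj = (\<lambda>f. \<lambda>s\<in>carrier H. \<alpha> s ((f (inv\<^bsub>H\<^esub> s))\<^sup>\<star>\<^bsub>A\<^esub>)),
    nrm = p\<rparr>"

definition l1_norm :: "('h, 'm) monoid_scheme \<Rightarrow> 'a cstar_struct \<Rightarrow> ('h \<Rightarrow> 'a) \<Rightarrow> real" where
  "l1_norm H A f = (\<Sum>t\<in>{t \<in> carrier H. f t \<noteq> \<zero>\<^bsub>A\<^esub>}. \<parallel>f t\<parallel>\<^bsub>A\<^esub>)"

text \<open>
  The norm of the enveloping C*-algebra of \<open>\<ell>\<^sup>1(H, A)\<close>. The \<open>\<ell>\<^sup>1\<close>-contractive C*-seminorms on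
  \<open>C\<^sub>c(H, A)\<close> are exactly the functions \<open>f \<mapsto> \<parallel>\<pi> f\<parallel>\<close> for \<open>\<ell>\<^sup>1\<close>-contractive *-homomorphisms \<open>\<pi>\<close>
  into C*-algebras, hence the supremum is the usual one over all representations; it is phrased
  with seminorms because HOL cannot quantify over the types of all target algebras. Contractivity
  is in fact automatic; it makes the supremum visibly one of a bounded set.
\<close>

definition full_norm ::
  "('h, 'm) monoid_scheme \<Rightarrow> 'a cstar_struct \<Rightarrow> ('h \<Rightarrow> 'a \<Rightarrow> 'a) \<Rightarrow> ('h \<Rightarrow> 'a) \<Rightarrow> real" where
  "full_norm H A \<alpha> f = Sup {p f | p.
    cstar_seminorm (conv_algebra H A \<alpha> (l1_norm H A)) p \<and>
    (\<forall>g\<in>carrier (conv_algebra H A \<alpha> (l1_norm H A)). p g \<le> l1_norm H A g)}"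

definition full_conv_algebra ::
  "('h, 'm) monoid_scheme \<Rightarrow> 'a cstar_struct \<Rightarrow> ('h \<Rightarrow> 'a \<Rightarrow> 'a) \<Rightarrow> ('h \<Rightarrow> 'a) cstar_struct" where
  "full_conv_algebra H A \<alpha> = conv_algebra H A \<alpha> (full_norm H A \<alpha>)"

definition crossed_product ::
  "('h, 'm) monoid_scheme \<Rightarrow> 'a cstar_struct \<Rightarrow> ('h \<Rightarrow> 'a \<Rightarrow> 'a) \<Rightarrow>
    (nat \<Rightarrow> 'h \<Rightarrow> 'a) set cstar_struct" where
  "crossed_product H A \<alpha> = cstar_completion (full_conv_algebra H A \<alpha>)"

definition crossed_incl ::
  "('h, 'm) monoid_scheme \<Rightarrow> 'a cstar_struct \<Rightarrow> ('h \<Rightarrow> 'a \<Rightarrow> 'a) \<Rightarrow> 'a \<Rightarrow>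
    (nat \<Rightarrow> 'h \<Rightarrow> 'a) set" where
  "crossed_incl H A \<alpha> a = const_seq (full_conv_algebra H A \<alpha>) (delta_one H A a)"

text \<open>\<open>\<lambda>\<^sup>\<alpha>\<^sub>h\<close>, the extension to the completion of \<open>f \<mapsto> \<delta>\<^sub>h f\<close> and \<open>f \<mapsto> f \<delta>\<^sub>h\<close>.\<close>

definition crossed_unitary ::
  "('h, 'm) monoid_scheme \<Rightarrow> 'a cstar_struct \<Rightarrow> ('h \<Rightarrow> 'a \<Rightarrow> 'a) \<Rightarrow> 'h \<Rightarrow>
    ((nat \<Rightarrow> 'h \<Rightarrow> 'a) set \<Rightarrow> (nat \<Rightarrow> 'h \<Rightarrow> 'a) set) \<times>
    ((nat \<Rightarrow> 'h \<Rightarrow> 'a) set \<Rightarrow> (nat \<Rightarrow> 'h \<Rightarrow> 'a) set)" where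
  "crossed_unitary H A \<alpha> h = (let C = full_conv_algebra H A \<alpha> in
    (restrict (coset_map (linf C) (null_seqs C)
        (\<lambda>f n. \<lambda>s\<in>carrier H. \<alpha> h (f n (inv\<^bsub>H\<^esub> h \<otimes>\<^bsub>H\<^esub> s)))) (carrier (crossed_product H A \<alpha>)),
     restrict (coset_map (linf C) (null_seqs C)
        (\<lambda>f n. \<lambda>s\<in>carrier H. f n (s \<otimes>\<^bsub>H\<^esub> inv\<^bsub>H\<^esub> h))) (carrier (crossed_product H A \<alpha>))))"


section \<open>Approximate representability and sequentially split homomorphisms\<close>

text \<open>Approximate units are not required to be increasing. They are only used for sequences
  \<open>x\<^sub>n x\<^sub>n*\<close> and \<open>x\<^sub>n* x\<^sub>n\<close> of contractions, for which positivity and contractivity are automatic.\<close>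

definition approximate_unit :: "'a cstar_struct \<Rightarrow> (nat \<Rightarrow> 'a) \<Rightarrow> bool" where
  "approximate_unit A e \<longleftrightarrow> (\<forall>a\<in>carrier A.
    (\<lambda>n. \<parallel>e n \<otimes>\<^bsub>A\<^esub> a \<ominus>\<^bsub>A\<^esub> a\<parallel>\<^bsub>A\<^esub>) \<longlonglongrightarrow> 0 \<and> (\<lambda>n. \<parallel>a \<otimes>\<^bsub>A\<^esub> e n \<ominus>\<^bsub>A\<^esub> a\<parallel>\<^bsub>A\<^esub>) \<longlonglongrightarrow> 0)"

definition approximately_representable ::
  "('h, 'm) monoid_scheme \<Rightarrow> 'a cstar_struct \<Rightarrow> ('h \<Rightarrow> 'a \<Rightarrow> 'a) \<Rightarrow> bool" where
  "approximately_representable H A \<alpha> \<longleftrightarrow> (\<exists>x :: nat \<Rightarrow> 'h \<Rightarrow> 'a.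
    (\<forall>n. \<forall>h\<in>carrier H. x n h \<in> carrier A \<and> \<parallel>x n h\<parallel>\<^bsub>A\<^esub> \<le> 1) \<and>
    (\<forall>h\<in>carrier H.
      approximate_unit A (\<lambda>n. x n h \<otimes>\<^bsub>A\<^esub> (x n h)\<^sup>\<star>\<^bsub>A\<^esub>) \<and>
      approximate_unit A (\<lambda>n. (x n h)\<^sup>\<star>\<^bsub>A\<^esub> \<otimes>\<^bsub>A\<^esub> x n h)) \<and>
    (\<forall>g\<in>carrier H. \<forall>h\<in>carrier H. \<forall>a\<in>carrier A.
      (\<lambda>n. \<parallel>a \<otimes>\<^bsub>A\<^esub> (x n g \<otimes>\<^bsub>A\<^esub> x n h \<ominus>\<^bsub>A\<^esub> x n (g \<otimes>\<^bsub>H\<^esub> h))\<parallel>\<^bsub>A\<^esub>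
         + \<parallel>(x n g \<otimes>\<^bsub>A\<^esub> x n h \<ominus>\<^bsub>A\<^esub> x n (g \<otimes>\<^bsub>H\<^esub> h)) \<otimes>\<^bsub>A\<^esub> a\<parallel>\<^bsub>A\<^esub>) \<longlonglongrightarrow> 0) \<and>
    (\<forall>a\<in>carrier A. \<forall>h\<in>carrier H.
      (\<lambda>n. \<parallel>\<alpha> h a \<ominus>\<^bsub>A\<^esub> x n h \<otimes>\<^bsub>A\<^esub> a \<otimes>\<^bsub>A\<^esub> (x n h)\<^sup>\<star>\<^bsub>A\<^esub>\<parallel>\<^bsub>A\<^esub>) \<longlonglongrightarrow> 0) \<and>
    (\<forall>g\<in>carrier H. \<forall>h\<in>carrier H. \<forall>a\<in>carrier A.
      (\<lambda>n. \<parallel>a \<otimes>\<^bsub>A\<^esub> (x n (g \<otimes>\<^bsub>H\<^esub> h \<otimes>\<^bsub>H\<^esub> inv\<^bsub>H\<^esub> g) \<ominus>\<^bsub>A\<^esub> \<alpha> g (x n h))\<parallel>\<^bsub>A\<^esub>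
         + \<parallel>(x n (g \<otimes>\<^bsub>H\<^esub> h \<otimes>\<^bsub>H\<^esub> inv\<^bsub>H\<^esub> g) \<ominus>\<^bsub>A\<^esub> \<alpha> g (x n h)) \<otimes>\<^bsub>A\<^esub> a\<parallel>\<^bsub>A\<^esub>) \<longlonglongrightarrow> 0))"

definition equivariantly_sequentially_split ::
  "('h, 'm) monoid_scheme \<Rightarrow> 'a cstar_struct \<Rightarrow> ('h \<Rightarrow> 'a \<Rightarrow> 'a) \<Rightarrow>
    'b cstar_struct \<Rightarrow> ('h \<Rightarrow> 'b \<Rightarrow> 'b) \<Rightarrow> ('a \<Rightarrow> 'b) \<Rightarrow> bool" where
  "equivariantly_sequentially_split H A \<alpha> B \<beta> \<phi> \<longleftrightarrow>
    equivariant_star_hom H A \<alpha> B \<beta> \<phi> \<and>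
    (\<exists>\<psi>. equivariant_star_hom H B \<beta> (seq_algebra A) (seq_action A \<alpha>) \<psi> \<and>
      (\<forall>a\<in>carrier A. \<psi> (\<phi> a) = const_seq A a))"

end

theory Submission
  imports Defs
begin

text \<open>
  Each of the three conditions amounts to the existence of maps \<open>Y\<^sub>h : A \<rightarrow> A\<^sub>\<infinity>\<close> that behave like
  \<open>a \<mapsto> a w\<^sub>h\<close> for unitaries \<open>w\<^sub>h\<close> implementing \<open>\<alpha>\<^sub>h\<close>: they multiply and take adjoints like the
  elements \<open>a \<delta>\<^sub>h\<close> of \<open>C\<^sub>c(H, A)\<close>, \<open>Y\<^sub>1\<close> is the canonical inclusion, and \<open>\<alpha>\<^sub>\<infinity>\<close> permutes the
  \<open>Y\<^sub>h\<close> by conjugation in \<open>H\<close>. This notion, \<open>covariant_family\<close>, involves neither multipliers nor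
  completions, and the three conditions are compared with it rather than with each other.

  If \<open>\<alpha>\<close> is approximately representable, the limit relations for the \<open>x\<^sub>n\<^sub>,\<^sub>h\<close> become identities
  between the class \<open>X\<^sub>h\<close> of \<open>(x\<^sub>n\<^sub>,\<^sub>h)\<^sub>n\<close> in \<open>A\<^sub>\<infinity>\<close> and the constant sequences. Such an \<open>X\<^sub>h\<close> satisfies
  \<open>X\<^sub>h a = \<alpha>\<^sub>h(a) X\<^sub>h\<close>; hence it multiplies the hereditary subalgebra into itself and defines a unitary
  multiplier, which is the required representation, and \<open>Y\<^sub>h(a) = a X\<^sub>h\<close> is a covariant family.
  A multiplier representation \<open>w\<close> yields the covariant family \<open>Y\<^sub>h(a) = a w\<^sub>h\<close>, and a map \<open>\<psi>\<close> that
  splits the inclusion into the crossed product yields \<open>Y\<^sub>h(a) = \<psi>(a \<delta>\<^sub>h)\<close>.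

  Conversely, a covariant family integrates to the *-homomorphism that sends \<open>f\<close> in \<open>C\<^sub>c(H, A)\<close> to
  the sum of the \<open>Y\<^sub>t(f(t))\<close>. It is contractive for the \<open>\<ell>\<^sup>1\<close>-norm, so the full norm dominates it
  and it extends to the crossed product, because \<open>A\<^sub>\<infinity>\<close> is complete. To recover the \<open>x\<^sub>n\<^sub>,\<^sub>h\<close>,
  take a selfadjoint contraction \<open>e\<close> in \<open>A\<close> that is almost a unit for finitely many elements. Then
  \<open>Y\<^sub>h(e)\<close> is a contraction, and all errors in the relations between the \<open>Y\<^sub>h(e)\<close> are of the form
  \<open>Y\<^sub>k(b)\<close>, whose norm is the norm of \<open>b\<close> in \<open>A\<close>, where \<open>b\<close> measures how far \<open>e\<close> is from being a unit
  (\<open>covariant_family_defects\<close>). Late terms of representing sequences, chosen along an enumeration of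
  \<open>Q \<times> H \<times> H\<close> with \<open>Q\<close> countable and dense in \<open>A\<close>, are the required \<open>x\<^sub>n\<^sub>,\<^sub>h\<close>.

  The argument rests on three facts about C*-algebras: *-homomorphisms are contractive (so that
  \<open>\<alpha>\<^sub>h\<close> is isometric and acts on \<open>A\<^sub>\<infinity>\<close>), approximate units of contractions exist, and \<open>A\<^sub>\<infinity>\<close> is
  a C*-algebra. The first two are derived from one observation: if
  \<open>p* q = q* p\<close> and \<open>p* p + q* q = b* b\<close>, then \<open>p \<plusminus> i q\<close> have the norm of \<open>b\<close>, and so \<open>p\<close> and
  \<open>q\<close> have at most that norm (\<open>circle_norm_le\<close>). The pairs \<open>p\<close>, \<open>q\<close> come from
  \<open>x\<^sup>2 + (1 - x\<^sup>2) = 1\<close>, with a square root of \<open>1 - x\<^sup>2\<close> found by iteration, and from the real and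
  imaginary parts of a Cayley transform.
\<close>

section \<open>Star-algebras without unit\<close>

lemma complex_ring_simps [simp]:
  "carrier complex_ring = UNIV" "x \<otimes>\<^bsub>complex_ring\<^esub> y = x * y" "x \<oplus>\<^bsub>complex_ring\<^esub> y = x + y"
  "\<one>\<^bsub>complex_ring\<^esub> = 1" "\<zero>\<^bsub>complex_ring\<^esub> = 0"
  by (auto simp: complex_ring_def)

context star_algebra
begin

lemma smult_in_carrier [simp, intro]: "x \<in> carrier A \<Longrightarrow> c \<odot> x \<in> carrier A"
  using smult_closed[of c x] by simp

declare mult_closed [simp, intro] adj_closed [simp, intro]

lemma smult_add_left: "x \<in> carrier A \<Longrightarrow> (c + d) \<odot> x = c \<odot> x \<oplus> d \<odot> x"
  using smult_l_distr[of c d x] by simp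

lemma smult_add_right:
  "\<lbrakk>x \<in> carrier A; y \<in> carrier A\<rbrakk> \<Longrightarrow> c \<odot> (x \<oplus> y) = c \<odot> x \<oplus> c \<odot> y"
  using smult_r_distr[of c x y] by simp

lemma smult_smult: "x \<in> carrier A \<Longrightarrow> c \<odot> (d \<odot> x) = (c * d) \<odot> x"
  using smult_assoc1[of c d x] by simp

lemma smult_1 [simp]: "x \<in> carrier A \<Longrightarrow> 1 \<odot> x = x"
  using smult_one[of x] by simp

lemma smult_0 [simp]: "x \<in> carrier A \<Longrightarrow> 0 \<odot> x = \<zero>"
  using smult_l_null[of x] by simp

lemma smult_zero [simp]: "c \<odot> \<zero> = \<zero>"
  using smult_r_null[of c] by simp

lemma minus_smult: "x \<in> carrier A \<Longrightarrow> \<ominus> x = (- 1) \<odot> x"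
proof -
  assume x: "x \<in> carrier A"
  have "(-1) \<odot> x \<oplus> x = ((-1) + 1) \<odot> x" using x smult_add_left[of x "-1" 1] by simp
  also have "\<dots> = \<zero>" using x by simp
  finally show ?thesis using x minus_equality[of "(-1) \<odot> x" x] by simp
qed

lemma smult_minus [simp]: "x \<in> carrier A \<Longrightarrow> c \<odot> (\<ominus> x) = \<ominus> (c \<odot> x)"
  by (simp add: minus_smult smult_smult)

lemma mult_minus_left [simp]: "\<lbrakk>x \<in> carrier A; y \<in> carrier A\<rbrakk> \<Longrightarrow> (\<ominus> x) \<otimes> y = \<ominus> (x \<otimes> y)"
  by (simp add: minus_smult smult_mult_left)

lemma mult_minus_right [simp]: "\<lbrakk>x \<in> carrier A; y \<in> carrier A\<rbrakk> \<Longrightarrow> x \<otimes> (\<ominus> y) = \<ominus> (x \<otimes> y)"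
  by (simp add: minus_smult smult_mult_right)

lemma adj_minus [simp]: "x \<in> carrier A \<Longrightarrow> (\<ominus> x)\<^sup>\<star> = \<ominus> (x\<^sup>\<star>)"
  by (simp add: minus_smult adj_smult)

lemma mult_zero_left [simp]: "x \<in> carrier A \<Longrightarrow> \<zero> \<otimes> x = \<zero>"
  using smult_mult_left[of \<zero> x 0] by simp

lemma mult_zero_right [simp]: "x \<in> carrier A \<Longrightarrow> x \<otimes> \<zero> = \<zero>"
  using smult_mult_right[of x \<zero> 0] by simp

lemma adj_zero [simp]: "\<zero>\<^sup>\<star> = \<zero>"
  using adj_smult[of \<zero> 0] by simp

lemma minus_zero_nu [simp]: "\<ominus> \<zero> = \<zero>"
  using minus_smult[of \<zero>] by simp

lemma diff_in_carrier [simp, intro]: "\<lbrakk>x \<in> carrier A; y \<in> carrier A\<rbrakk> \<Longrightarrow> x \<ominus> y \<in> carrier A"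
  by simp

lemma minus_self [simp]: "x \<in> carrier A \<Longrightarrow> x \<ominus> x = \<zero>"
  by (simp add: minus_eq r_neg)

lemma eq_if_minus_zero:
  assumes "x \<in> carrier A" "y \<in> carrier A" "x \<ominus> y = \<zero>" shows "x = y"
proof -
  have "x = (x \<ominus> y) \<oplus> y" using assms(1,2) by (simp add: minus_eq a_assoc l_neg)
  then show ?thesis using assms by simp
qed

text \<open>
  Rewrite rules for the \<open>algebra\<close> method, which otherwise normalizes in unital rings:
  the rules that mention the unit are left out, those for scalars and the involution are added. They
  decide identities in which like terms carry integer coefficients.
\<close>

lemmas nu_simprules [algebra nuring "\<zero>\<^bsub>A\<^esub>" "add A" "a_inv A" "a_minus A" "mult A"] =
  a_closed zero_closed a_inv_closed minus_closed mult_closed adj_closed smult_in_carrier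
  a_assoc l_zero l_neg a_comm mult_assoc distrib_right distrib_left mult_zero_left mult_zero_right
  minus_eq r_zero r_neg r_neg2 r_neg1 minus_add minus_minus minus_zero_nu a_lcomm
  mult_minus_left mult_minus_right smult_add_right smult_minus smult_zero smult_mult_left smult_mult_right
  adj_add adj_mult adj_adj adj_minus adj_zero adj_smult

lemma circle_identity:
  assumes [simp]: "p \<in> carrier A" "q \<in> carrier A" "b \<in> carrier A" and "p\<^sup>\<star> \<otimes> q = q\<^sup>\<star> \<otimes> p" "p\<^sup>\<star> \<otimes> p \<oplus> q\<^sup>\<star> \<otimes> q = b\<^sup>\<star> \<otimes> b"
  shows "(p \<oplus> \<i> \<odot> q)\<^sup>\<star> \<otimes> (p \<oplus> \<i> \<odot> q) = b\<^sup>\<star> \<otimes> b"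
proof -
  have "(p \<oplus> \<i> \<odot> q)\<^sup>\<star> \<otimes> (p \<oplus> \<i> \<odot> q)
      = p\<^sup>\<star> \<otimes> p \<oplus> q\<^sup>\<star> \<otimes> q \<oplus> (\<i> \<odot> (p\<^sup>\<star> \<otimes> q) \<oplus> (-\<i>) \<odot> (q\<^sup>\<star> \<otimes> p))"
    by (simp add: distrib_left distrib_right adj_add adj_smult smult_mult_left smult_mult_right
        smult_add_right smult_smult a_ac)
  also have "\<dots> = b\<^sup>\<star> \<otimes> b" by (simp add: assms(4,5) smult_add_left[symmetric])
  finally show ?thesis .
qed

end

locale cstar_seminormed_algebra = star_algebra +
  assumes nrm_cstar_seminorm: "cstar_seminorm A (nrm A)"

sublocale cstar_algebra \<subseteq> cstar_seminormed_algebra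
  using nrm_cstar_seminorm by unfold_locales

context cstar_seminormed_algebra
begin

lemma nrm_ge0 [simp, intro]: "x \<in> carrier A \<Longrightarrow> 0 \<le> \<parallel>x\<parallel>"
  and nrm_smult: "x \<in> carrier A \<Longrightarrow> \<parallel>c \<odot> x\<parallel> = cmod c * \<parallel>x\<parallel>"
  and nrm_triangle: "\<lbrakk>x \<in> carrier A; y \<in> carrier A\<rbrakk> \<Longrightarrow> \<parallel>x \<oplus> y\<parallel> \<le> \<parallel>x\<parallel> + \<parallel>y\<parallel>"
  and nrm_mult: "\<lbrakk>x \<in> carrier A; y \<in> carrier A\<rbrakk> \<Longrightarrow> \<parallel>x \<otimes> y\<parallel> \<le> \<parallel>x\<parallel> * \<parallel>y\<parallel>"
  and nrm_cstar: "x \<in> carrier A \<Longrightarrow> \<parallel>x\<^sup>\<star> \<otimes> x\<parallel> = \<parallel>x\<parallel>\<^sup>2"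
  using nrm_cstar_seminorm unfolding cstar_seminorm_def by auto

lemma nrm_zero [simp]: "\<parallel>\<zero>\<parallel> = 0"
  using nrm_smult[of \<zero> 0] by simp

lemma nrm_minus [simp]: "x \<in> carrier A \<Longrightarrow> \<parallel>\<ominus> x\<parallel> = \<parallel>x\<parallel>"
  by (simp add: minus_smult nrm_smult)

lemma nrm_adj [simp]:
  assumes "x \<in> carrier A" shows "\<parallel>x\<^sup>\<star>\<parallel> = \<parallel>x\<parallel>"
proof -
  have le: "\<parallel>y\<parallel> \<le> \<parallel>y\<^sup>\<star>\<parallel>" if "y \<in> carrier A" for y
  proof -
    have "\<parallel>y\<parallel> * \<parallel>y\<parallel> \<le> \<parallel>y\<^sup>\<star>\<parallel> * \<parallel>y\<parallel>"
      using nrm_mult[of "y\<^sup>\<star>" y] nrm_cstar[of y] that by (simp add: power2_eq_square)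
    then show ?thesis
      by (metis adj_closed mult_right_le_imp_le nrm_ge0 order_le_less that)
  qed
  show ?thesis using le[of x] le[of "x\<^sup>\<star>"] assms by (simp add: adj_adj)
qed

lemma nrm_cstar': "x \<in> carrier A \<Longrightarrow> \<parallel>x \<otimes> x\<^sup>\<star>\<parallel> = \<parallel>x\<parallel>\<^sup>2"
  using nrm_cstar[of "x\<^sup>\<star>"] by (simp add: adj_adj)

lemma nrm_diff_commute: "\<lbrakk>x \<in> carrier A; y \<in> carrier A\<rbrakk> \<Longrightarrow> \<parallel>x \<ominus> y\<parallel> = \<parallel>y \<ominus> x\<parallel>"
proof -
  assume x: "x \<in> carrier A" "y \<in> carrier A"
  then have "x \<ominus> y = \<ominus> (y \<ominus> x)" by algebra
  then show ?thesis using x by simp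
qed

lemma nrm_diff_le: "\<lbrakk>x \<in> carrier A; y \<in> carrier A\<rbrakk> \<Longrightarrow> \<parallel>x \<ominus> y\<parallel> \<le> \<parallel>x\<parallel> + \<parallel>y\<parallel>"
  using nrm_triangle[of x "\<ominus> y"] by (simp add: minus_eq)

lemma nrm_diff_triangle:
  assumes "x \<in> carrier A" "y \<in> carrier A" "z \<in> carrier A"
  shows "\<parallel>x \<ominus> z\<parallel> \<le> \<parallel>x \<ominus> y\<parallel> + \<parallel>y \<ominus> z\<parallel>"
proof -
  have "x \<ominus> z = (x \<ominus> y) \<oplus> (y \<ominus> z)" using assms by algebra
  then show ?thesis using nrm_triangle[of "x \<ominus> y" "y \<ominus> z"] assms by simp
qed

lemma nrm_le_diff:
  assumes "x \<in> carrier A" "y \<in> carrier A"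
  shows "\<parallel>x\<parallel> \<le> \<parallel>x \<ominus> y\<parallel> + \<parallel>y\<parallel>"
proof -
  have "x = (x \<ominus> y) \<oplus> y" using assms by algebra
  then show ?thesis using nrm_triangle[of "x \<ominus> y" y] assms by simp
qed

lemma nrm_add_diff_le:
  assumes "x \<in> carrier A" "y \<in> carrier A" "x' \<in> carrier A" "y' \<in> carrier A"
  shows "\<parallel>(x \<oplus> y) \<ominus> (x' \<oplus> y')\<parallel> \<le> \<parallel>x \<ominus> x'\<parallel> + \<parallel>y \<ominus> y'\<parallel>"
proof -
  have "(x \<oplus> y) \<ominus> (x' \<oplus> y') = (x \<ominus> x') \<oplus> (y \<ominus> y')" using assms by algebra
  then show ?thesis using nrm_triangle[of "x \<ominus> x'" "y \<ominus> y'"] assms by simp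
qed

lemma nrm_smult_diff:
  assumes "x \<in> carrier A" "y \<in> carrier A"
  shows "\<parallel>c \<odot> x \<ominus> c \<odot> y\<parallel> = cmod c * \<parallel>x \<ominus> y\<parallel>"
proof -
  have "c \<odot> x \<ominus> c \<odot> y = c \<odot> (x \<ominus> y)" using assms by (simp add: minus_eq smult_add_right)
  then show ?thesis using assms by (simp add: nrm_smult)
qed

lemma nrm_adj_diff:
  assumes "x \<in> carrier A" "y \<in> carrier A"
  shows "\<parallel>x\<^sup>\<star> \<ominus> y\<^sup>\<star>\<parallel> = \<parallel>x \<ominus> y\<parallel>"
proof -
  have "x\<^sup>\<star> \<ominus> y\<^sup>\<star> = (x \<ominus> y)\<^sup>\<star>" using assms by (simp add: minus_eq adj_add)
  then show ?thesis using assms by simp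
qed

lemma nrm_mult_diff_le:
  assumes "x \<in> carrier A" "y \<in> carrier A" "x' \<in> carrier A" "y' \<in> carrier A"
  shows "\<parallel>x \<otimes> y \<ominus> x' \<otimes> y'\<parallel> \<le> \<parallel>x \<ominus> x'\<parallel> * \<parallel>y\<parallel> + \<parallel>x'\<parallel> * \<parallel>y \<ominus> y'\<parallel>"
proof -
  have "x \<otimes> y \<ominus> x' \<otimes> y' = (x \<ominus> x') \<otimes> y \<oplus> x' \<otimes> (y \<ominus> y')" using assms by algebra
  then have "\<parallel>x \<otimes> y \<ominus> x' \<otimes> y'\<parallel> \<le> \<parallel>(x \<ominus> x') \<otimes> y\<parallel> + \<parallel>x' \<otimes> (y \<ominus> y')\<parallel>"
    using nrm_triangle[of "(x \<ominus> x') \<otimes> y" "x' \<otimes> (y \<ominus> y')"] assms by simp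
  also have "\<dots> \<le> \<parallel>x \<ominus> x'\<parallel> * \<parallel>y\<parallel> + \<parallel>x'\<parallel> * \<parallel>y \<ominus> y'\<parallel>"
    using assms by (intro add_mono nrm_mult) auto
  finally show ?thesis .
qed

definition tends :: "(nat \<Rightarrow> 'a) \<Rightarrow> 'a \<Rightarrow> bool" where
  "tends s l \<longleftrightarrow> (\<forall>n. s n \<in> carrier A) \<and> l \<in> carrier A \<and> (\<lambda>n. \<parallel>s n \<ominus> l\<parallel>) \<longlonglongrightarrow> 0"

lemma tendsD:
  "tends s l \<Longrightarrow> s n \<in> carrier A" "tends s l \<Longrightarrow> l \<in> carrier A"
  "tends s l \<Longrightarrow> (\<lambda>n. \<parallel>s n \<ominus> l\<parallel>) \<longlonglongrightarrow> 0"
  by (auto simp: tends_def)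

lemma tendsI:
  assumes "\<And>n. s n \<in> carrier A" "l \<in> carrier A" "\<And>n. \<parallel>s n \<ominus> l\<parallel> \<le> f n" "f \<longlonglongrightarrow> 0"
  shows "tends s l"
  unfolding tends_def using assms(1,2)
  by (auto intro!: tendsto_sandwich[OF _ _ tendsto_const assms(4)] always_eventually assms(3))

lemma tends_const: "l \<in> carrier A \<Longrightarrow> tends (\<lambda>_. l) l"
  by (rule tendsI[where f = "\<lambda>_. 0"]) (auto simp: minus_eq r_neg)

lemma tends_add: "\<lbrakk>tends s l; tends t m\<rbrakk> \<Longrightarrow> tends (\<lambda>n. s n \<oplus> t n) (l \<oplus> m)"
  by (rule tendsI[where f = "\<lambda>n. \<parallel>s n \<ominus> l\<parallel> + \<parallel>t n \<ominus> m\<parallel>"])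
     (auto simp: tends_def intro!: nrm_add_diff_le tendsto_add_zero)

lemma tends_smult: "tends s l \<Longrightarrow> tends (\<lambda>n. c \<odot> s n) (c \<odot> l)"
  by (rule tendsI[where f = "\<lambda>n. cmod c * \<parallel>s n \<ominus> l\<parallel>"])
     (auto intro!: tendsD tendsto_mult_right_zero simp: nrm_smult_diff tendsD)

lemma tends_adj: "tends s l \<Longrightarrow> tends (\<lambda>n. (s n)\<^sup>\<star>) (l\<^sup>\<star>)"
  by (rule tendsI[where f = "\<lambda>n. \<parallel>s n \<ominus> l\<parallel>"]) (auto intro!: tendsD simp: nrm_adj_diff tendsD)

lemma tends_diff: "\<lbrakk>tends s l; tends t m\<rbrakk> \<Longrightarrow> tends (\<lambda>n. s n \<ominus> t n) (l \<ominus> m)"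
  using tends_add[of s l "\<lambda>n. (-1) \<odot> t n" "(-1) \<odot> m"] tends_smult[of t m "-1"]
  by (simp add: minus_eq minus_smult tendsD)

lemma tends_nrm: assumes "tends s l" shows "(\<lambda>n. \<parallel>s n\<parallel>) \<longlonglongrightarrow> \<parallel>l\<parallel>"
proof -
  have "\<bar>\<parallel>s n\<parallel> - \<parallel>l\<parallel>\<bar> \<le> \<parallel>s n \<ominus> l\<parallel>" for n
    using nrm_le_diff[of "s n" l] nrm_le_diff[of l "s n"] nrm_diff_commute[of "s n" l] tendsD[OF assms]
    by auto
  then have "(\<lambda>n. \<parallel>s n\<parallel> - \<parallel>l\<parallel>) \<longlonglongrightarrow> 0"
    by (intro tendsto_rabs_zero_cancel[OF tendsto_sandwich[OF _ _ tendsto_const tendsD(3)[OF assms]]])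
       (auto intro: always_eventually)
  then show ?thesis by (simp add: LIM_zero_iff)
qed

lemma tends_mult: assumes "tends s l" "tends t m" shows "tends (\<lambda>n. s n \<otimes> t n) (l \<otimes> m)"
proof (rule tendsI[where f = "\<lambda>n. \<parallel>s n \<ominus> l\<parallel> * \<parallel>t n\<parallel> + \<parallel>l\<parallel> * \<parallel>t n \<ominus> m\<parallel>"])
  show "(\<lambda>n. \<parallel>s n \<ominus> l\<parallel> * \<parallel>t n\<parallel> + \<parallel>l\<parallel> * \<parallel>t n \<ominus> m\<parallel>) \<longlonglongrightarrow> 0"
    using tendsto_add[OF tendsto_mult[OF tendsD(3)[OF assms(1)] tends_nrm[OF assms(2)]]
        tendsto_mult[OF tendsto_const[of "\<parallel>l\<parallel>"] tendsD(3)[OF assms(2)]]] by simp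
qed (use assms in \<open>auto simp: tends_def intro!: nrm_mult_diff_le\<close>)

lemma nrm_eq_if_same_square:
  "\<lbrakk>u \<in> carrier A; b \<in> carrier A; u\<^sup>\<star> \<otimes> u = b\<^sup>\<star> \<otimes> b\<rbrakk> \<Longrightarrow> \<parallel>u\<parallel> = \<parallel>b\<parallel>"
  using nrm_cstar[of u] nrm_cstar[of b] by (simp add: power2_eq_iff_nonneg)

text \<open>
  Here \<open>p\<close> and \<open>q\<close> are thought of as \<open>cos\<close> and
  \<open>sin\<close> of a selfadjoint element, applied to \<open>b\<close>:
  \<open>p \<plusminus> i q\<close> are isometric images of \<open>b\<close>, and \<open>2 p\<close>
  is their sum. The vector \<open>b\<close> stands in for the unit, which \<open>A\<close> may lack.
\<close>

lemma circle_norm_le: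
  assumes pqb [simp]: "p \<in> carrier A" "q \<in> carrier A" "b \<in> carrier A"
    and pq: "p\<^sup>\<star> \<otimes> q = q\<^sup>\<star> \<otimes> p" and sq: "p\<^sup>\<star> \<otimes> p \<oplus> q\<^sup>\<star> \<otimes> q = b\<^sup>\<star> \<otimes> b"
  shows "\<parallel>p\<parallel> \<le> \<parallel>b\<parallel>"
proof -
  let ?u = "p \<oplus> \<i> \<odot> q" and ?v = "p \<oplus> \<i> \<odot> (\<ominus> q)"
  have u: "\<parallel>?u\<parallel> = \<parallel>b\<parallel>"
    by (rule nrm_eq_if_same_square) (simp_all add: circle_identity[OF pqb pq sq])
  have v: "\<parallel>?v\<parallel> = \<parallel>b\<parallel>"
    by (rule nrm_eq_if_same_square, simp, simp, rule circle_identity) (simp_all add: pq sq)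
  have "p \<oplus> p = ?u \<oplus> ?v" by (simp add: a_ac r_neg r_neg1 r_neg2)
  then have "\<parallel>2 \<odot> p\<parallel> \<le> \<parallel>b\<parallel> + \<parallel>b\<parallel>"
    using nrm_triangle[of ?u ?v] u v smult_add_left[of p 1 1] by simp
  then show ?thesis by (simp add: nrm_smult)
qed

end

section \<open>Completeness, square roots and contractivity\<close>

lemma le_one_if_square_le: "a\<^sup>2 \<le> a \<Longrightarrow> a \<le> 1" for a :: real
  by (metis mult.right_neutral mult_strict_left_mono not_le power2_eq_square zero_less_one order.strict_trans)

lemma (in cstar_seminormed_algebra) metric_if_definite:
  assumes definite: "\<And>x. \<lbrakk>x \<in> carrier A; \<parallel>x\<parallel> = 0\<rbrakk> \<Longrightarrow> x = \<zero>"
  shows "Metric_space (carrier A) (cstar_dist A)"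
proof
  fix x y assume xy: "x \<in> carrier A" "y \<in> carrier A"
  show "cstar_dist A x y = 0 \<longleftrightarrow> x = y"
  proof
    assume "cstar_dist A x y = 0"
    then have "x \<ominus> y = \<zero>" using xy by (intro definite) (simp_all add: cstar_dist_def)
    then show "x = y" by (rule eq_if_minus_zero[OF xy])
  qed (use xy in \<open>simp add: cstar_dist_def\<close>)
next
  fix x y z assume xy: "x \<in> carrier A" "y \<in> carrier A" "z \<in> carrier A"
  then show "cstar_dist A x z \<le> cstar_dist A x y + cstar_dist A y z"
    by (simp add: cstar_dist_def nrm_diff_triangle)
qed (use nrm_diff_commute in \<open>force simp: cstar_dist_def\<close>)+

lemma (in cstar_algebra) cstar_dist_metric: "Metric_space (carrier A) (cstar_dist A)"
  using nrm_definite by (rule metric_if_definite)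

context cstar_algebra
begin

lemma eq_if_diff_zero: "\<lbrakk>x \<in> carrier A; y \<in> carrier A; \<parallel>x \<ominus> y\<parallel> = 0\<rbrakk> \<Longrightarrow> x = y"
  by (rule eq_if_minus_zero[OF _ _ nrm_definite]) simp_all

lemma tends_unique: assumes "tends s l" "tends s m" shows "l = m"
proof -
  have "tends (\<lambda>n. s n \<ominus> s n) (l \<ominus> m)" by (rule tends_diff assms)+
  then have "(\<lambda>n. \<parallel>s n \<ominus> s n\<parallel>) \<longlonglongrightarrow> \<parallel>l \<ominus> m\<parallel>" by (rule tends_nrm)
  moreover have "\<parallel>s n \<ominus> s n\<parallel> = 0" for n using tendsD(1)[OF assms(1)] by (simp add: minus_eq r_neg)
  ultimately have "\<parallel>l \<ominus> m\<parallel> = 0" using LIMSEQ_unique[OF _ tendsto_const[of 0]] by simp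
  then show ?thesis using assms by (simp add: eq_if_diff_zero[OF tendsD(2) tendsD(2)])
qed

lemma cauchy_converges:
  assumes s: "\<And>n. s n \<in> carrier A"
    and cauchy: "\<And>\<epsilon>. \<epsilon> > 0 \<Longrightarrow> \<exists>N. \<forall>m\<ge>N. \<forall>n\<ge>N. \<parallel>s m \<ominus> s n\<parallel> < \<epsilon>"
  obtains l where "tends s l"
proof -
  interpret M: Metric_space "carrier A" "cstar_dist A"
    by (rule cstar_dist_metric)
  have "M.MCauchy s"
    unfolding M.MCauchy_def using s cauchy by (auto simp: cstar_dist_def)
  then obtain l where "limitin M.mtopology s l sequentially"
    using complete unfolding M.mcomplete_def by blast
  then have "l \<in> carrier A" "(\<lambda>n. cstar_dist A (s n) l) \<longlonglongrightarrow> 0"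
    unfolding M.limitin_metric_dist_null by auto
  then have "tends s l" using s by (simp add: tends_def cstar_dist_def)
  then show ?thesis by (rule that)
qed

lemma geometric_converges:
  assumes s: "\<And>n. s n \<in> carrier A" and r: "0 \<le> r" "r < 1"
    and step: "\<And>n. \<parallel>s (Suc (Suc n)) \<ominus> s (Suc n)\<parallel> \<le> r * \<parallel>s (Suc n) \<ominus> s n\<parallel>"
  obtains l where "tends s l"
proof (rule cauchy_converges[OF s])
  define C where "C = \<parallel>s 1 \<ominus> s 0\<parallel>"
  have C: "C \<ge> 0" unfolding C_def using s by auto
  have one: "\<parallel>s (Suc n) \<ominus> s n\<parallel> \<le> C * r ^ n" for n
  proof (induction n)
    case (Suc n)
    have "\<parallel>s (Suc (Suc n)) \<ominus> s (Suc n)\<parallel> \<le> r * \<parallel>s (Suc n) \<ominus> s n\<parallel>" by (rule step)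
    also have "\<dots> \<le> r * (C * r ^ n)" using Suc r by (intro mult_left_mono) auto
    finally show ?case by (simp add: mult_ac)
  qed (simp add: C_def)
  have many: "\<parallel>s (m + k) \<ominus> s m\<parallel> \<le> C * r ^ m / (1 - r)" for m k
  proof -
    have "\<parallel>s (m + k) \<ominus> s m\<parallel> \<le> (\<Sum>i<k. C * r ^ (m + i))"
    proof (induction k)
      case 0 show ?case using s by (simp add: minus_eq r_neg)
    next
      case (Suc k)
      have "\<parallel>s (m + Suc k) \<ominus> s m\<parallel> \<le> \<parallel>s (Suc (m + k)) \<ominus> s (m + k)\<parallel> + \<parallel>s (m + k) \<ominus> s m\<parallel>"
        using nrm_diff_triangle[OF s s s] by simp
      also have "\<dots> \<le> C * r ^ (m + k) + (\<Sum>i<k. C * r ^ (m + i))" by (intro add_mono one Suc)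
      finally show ?case by simp
    qed
    also have "\<dots> = C * r ^ m * (\<Sum>i<k. r ^ i)" by (simp add: sum_distrib_left power_add mult_ac)
    also have "(\<Sum>i<k. r ^ i) \<le> 1 / (1 - r)"
      using r by (simp add: sum_gp_strict divide_simps)
    then have "C * r ^ m * (\<Sum>i<k. r ^ i) \<le> C * r ^ m * (1 / (1 - r))"
      using C r by (intro mult_left_mono) auto
    finally show ?thesis by simp
  qed
  have "(\<lambda>m. C * r ^ m / (1 - r)) \<longlonglongrightarrow> C * 0 / (1 - r)"
    using r by (intro tendsto_intros LIMSEQ_realpow_zero) auto
  then have small: "\<exists>N. \<forall>m\<ge>N. C * r ^ m / (1 - r) < \<epsilon>" if "\<epsilon> > 0" for \<epsilon>
    using order_tendstoD(2)[of _ 0 sequentially \<epsilon>] that by (auto simp: eventually_sequentially)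
  fix \<epsilon> :: real assume e: "\<epsilon> > 0"
  obtain N where N: "\<And>m. m \<ge> N \<Longrightarrow> C * r ^ m / (1 - r) < \<epsilon>" using small[OF e] by blast
  show "\<exists>N. \<forall>m\<ge>N. \<forall>n\<ge>N. \<parallel>s m \<ominus> s n\<parallel> < \<epsilon>"
  proof (intro exI[of _ N] allI impI)
    fix m n assume mn: "m \<ge> N" "n \<ge> N"
    have "\<parallel>s (max m n) \<ominus> s (min m n)\<parallel> < \<epsilon>"
      using many[of "min m n" "max m n - min m n"] N[of "min m n"] mn by (simp add: max_def min_def split: if_splits)
    then show "\<parallel>s m \<ominus> s n\<parallel> < \<epsilon>"
      using nrm_diff_commute[OF s[of m] s[of n]] by (cases "m \<le> n") (auto simp: max_def min_def)
  qed
qed (rule that)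

text \<open>
  Here \<open>1 + y\<close> is a square root of \<open>1 - x\<^sup>2\<close>. The map
  \<open>y \<mapsto> - (x\<^sup>2 + y\<^sup>2) / 2\<close> preserves the ball of radius
  \<open>\<parallel>x\<parallel>\<close> and contracts distances there by the factor
  \<open>\<parallel>x\<parallel> < 1\<close>; \<open>y\<close> is the limit of its iterates from
  \<open>0\<close>, which are selfadjoint and commute with \<open>x\<close>.
\<close>

lemma sqrt_one_minus_square:
  assumes x [simp]: "x \<in> carrier A" and sa: "x\<^sup>\<star> = x" and lt: "\<parallel>x\<parallel> < 1"
  obtains y where "y \<in> carrier A" "y\<^sup>\<star> = y" "x \<otimes> y = y \<otimes> x" "(y \<oplus> y) \<oplus> (y \<otimes> y \<oplus> x \<otimes> x) = \<zero>"
proof -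
  define k :: complex where "k = -1/2"
  have k: "cmod k = 1/2" "cnj k = k" "2 * k = -1" by (auto simp: k_def norm_divide)
  let ?F = "\<lambda>y. k \<odot> (x \<otimes> x \<oplus> y \<otimes> y)"
  define s where "s = rec_nat \<zero> (\<lambda>_. ?F)"
  have s0: "s 0 = \<zero>" and sS: "s (Suc n) = ?F (s n)" for n by (auto simp: s_def)
  have s [simp]: "s n \<in> carrier A" for n by (induction n) (auto simp: s0 sS)
  have ssa: "(s n)\<^sup>\<star> = s n" for n
    by (induction n) (auto simp: s0 sS adj_smult adj_add adj_mult sa k)
  have com: "x \<otimes> s n = s n \<otimes> x" for n
  proof (induction n)
    case (Suc n)
    have "x \<otimes> (s n \<otimes> s n) = s n \<otimes> s n \<otimes> x"
      by (simp add: mult_assoc[symmetric] Suc) (simp add: mult_assoc Suc)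
    then show ?case by (simp add: sS smult_mult_left smult_mult_right distrib_left distrib_right mult_assoc)
  qed (simp add: s0)
  have half: "\<parallel>k \<odot> z\<parallel> = \<parallel>z\<parallel> / 2" if "z \<in> carrier A" for z
    using that by (simp add: nrm_smult k)
  let ?r = "\<parallel>x\<parallel>"
  have bd: "\<parallel>s n\<parallel> \<le> ?r" for n
  proof (induction n)
    case (Suc n)
    have "\<parallel>x \<otimes> x \<oplus> s n \<otimes> s n\<parallel> \<le> ?r * ?r + \<parallel>s n\<parallel> * \<parallel>s n\<parallel>"
      by (rule order_trans[OF nrm_triangle]) (auto intro!: add_mono nrm_mult)
    also have "\<dots> \<le> ?r * 1 + ?r * 1" using lt Suc by (intro add_mono mult_mono) auto
    finally show ?case by (simp add: sS half)
  qed (simp add: s0)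
  obtain l where l: "tends s l"
  proof (rule geometric_converges[of s ?r])
    fix n
    have "s (Suc (Suc n)) \<ominus> s (Suc n)
        = k \<odot> ((s (Suc n) \<otimes> (s (Suc n) \<ominus> s n)) \<oplus> ((s (Suc n) \<ominus> s n) \<otimes> s n))"
    proof -
      have "?F u \<ominus> ?F v = k \<odot> ((u \<otimes> (u \<ominus> v)) \<oplus> ((u \<ominus> v) \<otimes> v))"
        if [simp]: "u \<in> carrier A" "v \<in> carrier A" for u v
      proof -
        have "(x \<otimes> x \<oplus> u \<otimes> u) \<ominus> (x \<otimes> x \<oplus> v \<otimes> v) = (u \<otimes> (u \<ominus> v)) \<oplus> ((u \<ominus> v) \<otimes> v)"
          using that x by algebra
        then show ?thesis by (metis (no_types, lifting) a_closed a_inv_closed minus_eq mult_closed smult_add_right smult_in_carrier smult_minus that x)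
      qed
      then show ?thesis using sS[of "Suc n"] sS[of n] s by metis
    qed
    then have "\<parallel>s (Suc (Suc n)) \<ominus> s (Suc n)\<parallel>
        = \<parallel>s (Suc n) \<otimes> (s (Suc n) \<ominus> s n) \<oplus> (s (Suc n) \<ominus> s n) \<otimes> s n\<parallel> / 2"
      by (simp add: half)
    also have "\<parallel>s (Suc n) \<otimes> (s (Suc n) \<ominus> s n) \<oplus> (s (Suc n) \<ominus> s n) \<otimes> s n\<parallel>
        \<le> ?r * \<parallel>s (Suc n) \<ominus> s n\<parallel> + \<parallel>s (Suc n) \<ominus> s n\<parallel> * ?r"
    proof (rule order_trans[OF nrm_triangle add_mono])
      show "\<parallel>s (Suc n) \<otimes> (s (Suc n) \<ominus> s n)\<parallel> \<le> ?r * \<parallel>s (Suc n) \<ominus> s n\<parallel>"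
        by (rule order_trans[OF nrm_mult]) (auto intro!: mult_right_mono bd)
      show "\<parallel>(s (Suc n) \<ominus> s n) \<otimes> s n\<parallel> \<le> \<parallel>s (Suc n) \<ominus> s n\<parallel> * ?r"
        by (rule order_trans[OF nrm_mult]) (auto intro!: mult_left_mono bd)
    qed simp_all
    finally show "\<parallel>s (Suc (Suc n)) \<ominus> s (Suc n)\<parallel> \<le> ?r * \<parallel>s (Suc n) \<ominus> s n\<parallel>" by simp
  qed (use lt in auto)
  note lc [simp] = tendsD(2)[OF l]
  have "tends (\<lambda>n. ?F (s n)) (?F l)"
    by (intro tends_smult tends_add tends_mult tends_const l) simp
  then have "tends (\<lambda>n. s (Suc n)) (?F l)" by (simp add: sS)
  moreover have "tends (\<lambda>n. s (Suc n)) l"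
    using l LIMSEQ_Suc[OF tendsD(3)[OF l]] by (auto simp: tends_def)
  ultimately have lfix: "l = ?F l" by (rule tends_unique[rotated])
  show ?thesis
  proof (rule that[of l])
    have "tends s (l\<^sup>\<star>)" using tends_adj[OF l] by (simp add: ssa)
    then show "l\<^sup>\<star> = l" using l by (rule tends_unique)
    have "tends (\<lambda>n. s n \<otimes> x) (x \<otimes> l)"
      using tends_mult[OF tends_const[OF x] l] by (simp add: com)
    then show "x \<otimes> l = l \<otimes> x" using tends_mult[OF l tends_const[OF x]] by (rule tends_unique)
    have "l \<oplus> l = 2 \<odot> l" using smult_add_left[of l 1 1] by simp
    also have "2 \<odot> l = 2 \<odot> ?F l" by (rule arg_cong[OF lfix])
    also have "\<dots> = \<ominus> (x \<otimes> x \<oplus> l \<otimes> l)"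
      by (simp add: smult_smult minus_smult k)
    finally have "l \<oplus> l = \<ominus> (l \<otimes> l \<oplus> x \<otimes> x)" using a_comm[of "x \<otimes> x" "l \<otimes> l"] by simp
    then show "(l \<oplus> l) \<oplus> (l \<otimes> l \<oplus> x \<otimes> x) = \<zero>" using l_neg[of "l \<otimes> l \<oplus> x \<otimes> x"] by simp
  qed simp
qed

end

context cstar_seminormed_algebra
begin

text \<open>
  The hypothesis says \<open>x\<^sup>2 + (1 + y)\<^sup>2 = 1\<close>, so
  \<open>circle_norm_le\<close> applies to \<open>x b\<close> and \<open>(1 + y) b\<close>.
\<close>

lemma sqrt_pair_contractive:
  assumes [simp]: "x \<in> carrier A" "y \<in> carrier A" "b \<in> carrier A" and sa: "x\<^sup>\<star> = x" "y\<^sup>\<star> = y"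
    and com: "x \<otimes> y = y \<otimes> x" and eq: "(y \<oplus> y) \<oplus> (y \<otimes> y \<oplus> x \<otimes> x) = \<zero>"
  shows "\<parallel>x \<otimes> b\<parallel> \<le> \<parallel>b\<parallel>" "\<parallel>b \<oplus> y \<otimes> b\<parallel> \<le> \<parallel>b\<parallel>"
proof -
  let ?p = "x \<otimes> b" and ?q = "b \<oplus> y \<otimes> b"
  have "x \<otimes> (y \<otimes> b) = y \<otimes> (x \<otimes> b)" by (simp add: mult_assoc[symmetric] com)
  then have 1: "?p\<^sup>\<star> \<otimes> ?q = ?q\<^sup>\<star> \<otimes> ?p"
    by (simp add: distrib_left distrib_right adj_add adj_mult sa mult_assoc)
  have "?p\<^sup>\<star> \<otimes> ?p \<oplus> ?q\<^sup>\<star> \<otimes> ?q = b\<^sup>\<star> \<otimes> b \<oplus> b\<^sup>\<star> \<otimes> (((y \<oplus> y) \<oplus> (y \<otimes> y \<oplus> x \<otimes> x)) \<otimes> b)"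
    by (simp add: distrib_left distrib_right adj_add adj_mult sa mult_assoc a_ac)
  then have 2: "?p\<^sup>\<star> \<otimes> ?p \<oplus> ?q\<^sup>\<star> \<otimes> ?q = b\<^sup>\<star> \<otimes> b" by (simp add: eq)
  show "\<parallel>?p\<parallel> \<le> \<parallel>b\<parallel>" by (rule circle_norm_le[OF _ _ _ 1 2]) simp_all
  show "\<parallel>?q\<parallel> \<le> \<parallel>b\<parallel>"
    by (rule circle_norm_le[where q = ?p]) (simp_all add: 1 2[symmetric] a_comm)
qed

end

lemma star_homD:
  assumes "star_hom A B \<phi>"
  shows "x \<in> carrier A \<Longrightarrow> \<phi> x \<in> carrier B"
    "\<lbrakk>x \<in> carrier A; y \<in> carrier A\<rbrakk> \<Longrightarrow> \<phi> (x \<oplus>\<^bsub>A\<^esub> y) = \<phi> x \<oplus>\<^bsub>B\<^esub> \<phi> y"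
    "x \<in> carrier A \<Longrightarrow> \<phi> (c \<odot>\<^bsub>A\<^esub> x) = c \<odot>\<^bsub>B\<^esub> \<phi> x"
    "\<lbrakk>x \<in> carrier A; y \<in> carrier A\<rbrakk> \<Longrightarrow> \<phi> (x \<otimes>\<^bsub>A\<^esub> y) = \<phi> x \<otimes>\<^bsub>B\<^esub> \<phi> y"
    "x \<in> carrier A \<Longrightarrow> \<phi> (x\<^sup>\<star>\<^bsub>A\<^esub>) = (\<phi> x)\<^sup>\<star>\<^bsub>B\<^esub>"
  using assms unfolding star_hom_def by auto

lemma star_hom_zero:
  assumes "star_algebra A" "star_algebra B" "star_hom A B \<phi>"
  shows "\<phi> \<zero>\<^bsub>A\<^esub> = \<zero>\<^bsub>B\<^esub>"
proof -
  interpret A: star_algebra A by fact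
  interpret B: star_algebra B by fact
  show ?thesis
    using star_homD(3)[OF assms(3), of "\<zero>\<^bsub>A\<^esub>" 0] star_homD(1)[OF assms(3), of "\<zero>\<^bsub>A\<^esub>"] by simp
qed

lemma star_hom_minus:
  assumes "star_algebra A" "star_algebra B" "star_hom A B \<phi>" "x \<in> carrier A" "y \<in> carrier A"
  shows "\<phi> (x \<ominus>\<^bsub>A\<^esub> y) = \<phi> x \<ominus>\<^bsub>B\<^esub> \<phi> y"
proof -
  interpret A: star_algebra A by fact
  interpret B: star_algebra B by fact
  show ?thesis using assms(4,5)
    by (simp add: A.minus_eq B.minus_eq A.minus_smult B.minus_smult star_homD[OF assms(3)])
qed

text \<open>
  A *-homomorphism preserves the algebraic relation between \<open>x\<close> and the square root
  \<open>1 + y\<close>. Hence for selfadjoint \<open>x\<close> of norm less than 1, multiplication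
  by \<open>\<phi>(x)\<close> is contractive; applying it to \<open>\<phi>(x)\<close> itself gives
  \<open>\<parallel>\<phi>(x)\<parallel>\<^sup>2 \<le> \<parallel>\<phi>(x)\<parallel>\<close>. The
  general case is reduced to \<open>x* x\<close>.
\<close>

lemma star_hom_contractive:
  assumes A: "cstar_algebra A" and B: "cstar_seminormed_algebra B" and hom: "star_hom A B \<phi>"
    and x: "x \<in> carrier A"
  shows "\<parallel>\<phi> x\<parallel>\<^bsub>B\<^esub> \<le> \<parallel>x\<parallel>\<^bsub>A\<^esub>"
proof -
  interpret A: cstar_algebra A by fact
  interpret B: cstar_seminormed_algebra B by fact
  note h = star_homD[OF hom]
  have sa1: "\<parallel>\<phi> z\<parallel>\<^bsub>B\<^esub> \<le> 1" if z: "z \<in> carrier A" "z\<^sup>\<star>\<^bsub>A\<^esub> = z" "\<parallel>z\<parallel>\<^bsub>A\<^esub> < 1" for z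
  proof -
    obtain y where y: "y \<in> carrier A" "y\<^sup>\<star>\<^bsub>A\<^esub> = y" "z \<otimes>\<^bsub>A\<^esub> y = y \<otimes>\<^bsub>A\<^esub> z"
      "(y \<oplus>\<^bsub>A\<^esub> y) \<oplus>\<^bsub>A\<^esub> (y \<otimes>\<^bsub>A\<^esub> y \<oplus>\<^bsub>A\<^esub> z \<otimes>\<^bsub>A\<^esub> z) = \<zero>\<^bsub>A\<^esub>"
      by (rule A.sqrt_one_minus_square[OF z])
    note zy = z(1) y(1)
    have "\<parallel>\<phi> z \<otimes>\<^bsub>B\<^esub> \<phi> z\<parallel>\<^bsub>B\<^esub> \<le> \<parallel>\<phi> z\<parallel>\<^bsub>B\<^esub>"
    proof (rule B.sqrt_pair_contractive(1))
      show "(\<phi> z)\<^sup>\<star>\<^bsub>B\<^esub> = \<phi> z" "(\<phi> y)\<^sup>\<star>\<^bsub>B\<^esub> = \<phi> y"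
        using h(5)[of z] h(5)[of y] zy z(2) y(2) by simp_all
      show "\<phi> z \<otimes>\<^bsub>B\<^esub> \<phi> y = \<phi> y \<otimes>\<^bsub>B\<^esub> \<phi> z"
        using h(4)[of z y] h(4)[of y z] zy y(3) by simp
      have "(\<phi> y \<oplus>\<^bsub>B\<^esub> \<phi> y) \<oplus>\<^bsub>B\<^esub> (\<phi> y \<otimes>\<^bsub>B\<^esub> \<phi> y \<oplus>\<^bsub>B\<^esub> \<phi> z \<otimes>\<^bsub>B\<^esub> \<phi> z)
          = \<phi> ((y \<oplus>\<^bsub>A\<^esub> y) \<oplus>\<^bsub>A\<^esub> (y \<otimes>\<^bsub>A\<^esub> y \<oplus>\<^bsub>A\<^esub> z \<otimes>\<^bsub>A\<^esub> z))"
        using zy by (simp add: h)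
      also have "\<dots> = \<zero>\<^bsub>B\<^esub>"
        unfolding y(4) using star_hom_zero[OF A.star_algebra_axioms B.star_algebra_axioms hom] .
      finally show "(\<phi> y \<oplus>\<^bsub>B\<^esub> \<phi> y) \<oplus>\<^bsub>B\<^esub> (\<phi> y \<otimes>\<^bsub>B\<^esub> \<phi> y \<oplus>\<^bsub>B\<^esub> \<phi> z \<otimes>\<^bsub>B\<^esub> \<phi> z) = \<zero>\<^bsub>B\<^esub>" .
    qed (use zy h(1) in auto)
    moreover have "\<parallel>\<phi> z \<otimes>\<^bsub>B\<^esub> \<phi> z\<parallel>\<^bsub>B\<^esub> = \<parallel>\<phi> z\<parallel>\<^bsub>B\<^esub>\<^sup>2"
      using B.nrm_cstar[of "\<phi> z"] h(5)[of z] h(1)[of z] z by simp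
    ultimately show ?thesis by (intro le_one_if_square_le) simp
  qed
  let ?z = "x\<^sup>\<star>\<^bsub>A\<^esub> \<otimes>\<^bsub>A\<^esub> x"
  have "\<parallel>\<phi> x\<parallel>\<^bsub>B\<^esub>\<^sup>2 \<le> \<parallel>x\<parallel>\<^bsub>A\<^esub>\<^sup>2"
  proof (rule dense_ge)
    fix c assume c: "\<parallel>x\<parallel>\<^bsub>A\<^esub>\<^sup>2 < c"
    then have c0: "c > 0" by (meson le_less_trans zero_le_power2)
    define k where "k = complex_of_real (1 / c)"
    have k: "cnj k = k" "cmod k = 1 / c" using c0 by (auto simp: k_def norm_divide)
    have zc: "?z \<in> carrier A" "?z\<^sup>\<star>\<^bsub>A\<^esub> = ?z" using x by (auto simp: A.adj_mult A.adj_adj)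
    have "\<parallel>k \<odot>\<^bsub>A\<^esub> ?z\<parallel>\<^bsub>A\<^esub> < 1" using c c0 by (simp add: A.nrm_smult[OF zc(1)] A.nrm_cstar[OF x] k)
    then have "\<parallel>\<phi> (k \<odot>\<^bsub>A\<^esub> ?z)\<parallel>\<^bsub>B\<^esub> \<le> 1"
      by (intro sa1) (simp_all add: zc A.adj_smult[OF zc(1)] k)
    moreover have "\<parallel>\<phi> (k \<odot>\<^bsub>A\<^esub> ?z)\<parallel>\<^bsub>B\<^esub> = \<parallel>\<phi> x\<parallel>\<^bsub>B\<^esub>\<^sup>2 / c"
      using x by (simp add: h(3)[OF zc(1)] B.nrm_smult h(1)[OF zc(1)] k)
        (simp add: h B.nrm_cstar)
    ultimately show "\<parallel>\<phi> x\<parallel>\<^bsub>B\<^esub>\<^sup>2 \<le> c" using c0 by (simp add: divide_le_eq)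
  qed
  then show ?thesis using x using power2_le_imp_le[of "\<parallel>\<phi> x\<parallel>\<^bsub>B\<^esub>" "\<parallel>x\<parallel>\<^bsub>A\<^esub>"] x by simp
qed

section \<open>Approximate units\<close>

context cstar_algebra
begin

text \<open>
  The operator \<open>1 - x\<^sup>2\<close> is the square of the contraction \<open>1 + y\<close>
  from \<open>sqrt_one_minus_square\<close>.
\<close>

lemma one_minus_square_contractive:
  assumes [simp]: "x \<in> carrier A" "b \<in> carrier A" and sa: "x\<^sup>\<star> = x" and lt: "\<parallel>x\<parallel> < 1"
  shows "\<parallel>b \<ominus> x \<otimes> x \<otimes> b\<parallel> \<le> \<parallel>b\<parallel>"
proof -
  obtain y where y [simp]: "y \<in> carrier A" and y': "y\<^sup>\<star> = y" "x \<otimes> y = y \<otimes> x"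
    "(y \<oplus> y) \<oplus> (y \<otimes> y \<oplus> x \<otimes> x) = \<zero>"
    by (rule sqrt_one_minus_square[OF assms(1) sa lt])
  note contr = sqrt_pair_contractive(2)[OF assms(1) y _ sa y']
  let ?q = "b \<oplus> y \<otimes> b"
  have "b \<ominus> x \<otimes> x \<otimes> b \<oplus> ((y \<oplus> y) \<oplus> (y \<otimes> y \<oplus> x \<otimes> x)) \<otimes> b = ?q \<oplus> y \<otimes> ?q"
    using assms(1,2) y by algebra
  then have "b \<ominus> x \<otimes> x \<otimes> b = ?q \<oplus> y \<otimes> ?q" by (simp add: y'(3))
  then have "\<parallel>b \<ominus> x \<otimes> x \<otimes> b\<parallel> \<le> \<parallel>?q\<parallel>" using contr[of ?q] by simp
  also have "\<dots> \<le> \<parallel>b\<parallel>" by (rule contr) simp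
  finally show ?thesis .
qed

text \<open>
  Here \<open>q = h\<^sup>2 (1 + h\<^sup>2)\<^sup>-\<^sup>1\<close>. With \<open>x = c h\<close> of
  norm less than 1, \<open>q\<close> is the fixed point of
  \<open>q \<mapsto> (x\<^sup>2 + (1 - x\<^sup>2) q) / (1 + c\<^sup>2)\<close>, which contracts
  distances because \<open>1 - x\<^sup>2\<close> does not expand them.
\<close>

lemma resolvent:
  assumes h [simp]: "h \<in> carrier A" and sa: "h\<^sup>\<star> = h"
  obtains q where "q \<in> carrier A" "q\<^sup>\<star> = q" "h \<otimes> q = q \<otimes> h" "q \<oplus> h \<otimes> h \<otimes> q = h \<otimes> h"
proof -
  define c where "c = 1 / (\<parallel>h\<parallel> + 1)"
  define x where "x = complex_of_real c \<odot> h"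
  define r where "r = 1 / (1 + c\<^sup>2)"
  have h1: "\<parallel>h\<parallel> + 1 > 0" using nrm_ge0[OF h] by linarith
  then have c: "c > 0" by (simp add: c_def)
  have r: "0 < r" "r < 1" using c by (auto simp: r_def add_pos_pos)
  have x [simp]: "x \<in> carrier A" and xsa: "x\<^sup>\<star> = x"
    by (simp_all add: x_def adj_smult sa)
  have "\<parallel>x\<parallel> = c * \<parallel>h\<parallel>" using c by (simp add: x_def nrm_smult)
  also have "\<dots> < 1" using h1 by (simp add: c_def)
  finally have "\<parallel>x\<parallel> < 1" .
  note T = one_minus_square_contractive[OF x _ xsa this]
  let ?F = "\<lambda>q. complex_of_real r \<odot> (x \<otimes> x \<oplus> (q \<ominus> x \<otimes> x \<otimes> q))"
  define s where "s = rec_nat \<zero> (\<lambda>_. ?F)"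
  have s0: "s 0 = \<zero>" and sS: "s (Suc n) = ?F (s n)" for n by (auto simp: s_def)
  have s [simp]: "s n \<in> carrier A" for n by (induction n) (auto simp: s0 sS)
  have com: "x \<otimes> s n = s n \<otimes> x" for n
  proof (induction n)
    case (Suc n)
    have 1: "x \<otimes> (s n \<otimes> z) = s n \<otimes> (x \<otimes> z)" if "z \<in> carrier A" for z
      using that by (simp add: mult_assoc[symmetric] Suc)
    show ?case
      by (simp add: sS smult_mult_left smult_mult_right distrib_left distrib_right mult_assoc minus_eq Suc 1)
  qed (simp add: s0)
  have ssa: "(s n)\<^sup>\<star> = s n" for n
  proof (induction n)
    case (Suc n)
    have "s n \<otimes> (x \<otimes> x) = x \<otimes> x \<otimes> s n"
      using mult_assoc[OF s x x, of n] by (simp add: com[symmetric] mult_assoc)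
    then show ?case by (simp add: sS adj_smult adj_add adj_mult minus_eq xsa Suc)
  qed (simp add: s0)
  obtain l where l: "tends s l"
  proof (rule geometric_converges[of s r])
    fix n
    have F: "\<parallel>?F u \<ominus> ?F v\<parallel> \<le> r * \<parallel>u \<ominus> v\<parallel>" if [simp]: "u \<in> carrier A" "v \<in> carrier A" for u v
    proof -
      have "(x \<otimes> x \<oplus> (u \<ominus> x \<otimes> x \<otimes> u)) \<ominus> (x \<otimes> x \<oplus> (v \<ominus> x \<otimes> x \<otimes> v))
          = (u \<ominus> v) \<ominus> x \<otimes> x \<otimes> (u \<ominus> v)"
        using that x by algebra
      then show ?thesis using T[of "u \<ominus> v"] r by (simp add: nrm_smult_diff)
    qed
    show "\<parallel>s (Suc (Suc n)) \<ominus> s (Suc n)\<parallel> \<le> r * \<parallel>s (Suc n) \<ominus> s n\<parallel>"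
      using F[of "s (Suc n)" "s n"] by (simp flip: sS)
  qed (use r in auto)
  note lc [simp] = tendsD(2)[OF l]
  have "tends (\<lambda>n. ?F (s n)) (?F l)"
    by (intro tends_smult tends_add tends_diff tends_mult tends_const l) simp_all
  then have "tends (\<lambda>n. s (Suc n)) (?F l)" by (simp add: sS)
  moreover have "tends (\<lambda>n. s (Suc n)) l"
    using l LIMSEQ_Suc[OF tendsD(3)[OF l]] by (auto simp: tends_def)
  ultimately have lfix: "l = ?F l" by (rule tends_unique[rotated])
  show ?thesis
  proof (rule that[of l])
    have "tends s (l\<^sup>\<star>)" using tends_adj[OF l] by (simp add: ssa)
    then show "l\<^sup>\<star> = l" using l by (rule tends_unique)
    have "tends (\<lambda>n. s n \<otimes> x) (x \<otimes> l)"
      using tends_mult[OF tends_const[OF x] l] by (simp add: com)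
    then have "x \<otimes> l = l \<otimes> x" using tends_mult[OF l tends_const[OF x]] by (rule tends_unique)
    then have "complex_of_real (1 / c) \<odot> (x \<otimes> l) = complex_of_real (1 / c) \<odot> (l \<otimes> x)" by simp
    then show "h \<otimes> l = l \<otimes> h"
      using c by (simp add: x_def smult_mult_left smult_mult_right smult_smult flip: of_real_mult)
    define z where "z = complex_of_real (c\<^sup>2)"
    have "c\<^sup>2 \<noteq> 0" "1 + c\<^sup>2 \<noteq> 0" using c by (auto simp: add_nonneg_eq_0_iff)
    then have "1 / c\<^sup>2 * c\<^sup>2 = 1" "(1 + c\<^sup>2) * r = 1" by (auto simp: r_def)
    then have z: "complex_of_real (1 / c\<^sup>2) * z = 1" "(1 + z) * complex_of_real r = 1"
      unfolding z_def by (metis of_real_1 of_real_mult, metis of_real_1 of_real_add of_real_mult)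
    have xx: "x \<otimes> x = z \<odot> (h \<otimes> h)"
      by (simp add: x_def z_def smult_mult_left smult_mult_right smult_smult power2_eq_square)
    have "(1 + z) \<odot> l = (1 + z) \<odot> ?F l"
      by (rule arg_cong[OF lfix])
    also have "\<dots> = x \<otimes> x \<oplus> (l \<ominus> x \<otimes> x \<otimes> l)"
      by (simp add: smult_smult z(2))
    finally have 1: "l \<oplus> z \<odot> l = x \<otimes> x \<oplus> (l \<ominus> x \<otimes> x \<otimes> l)"
      by (simp add: smult_add_left)
    have "z \<odot> l \<oplus> x \<otimes> x \<otimes> l = \<ominus> l \<oplus> ((l \<oplus> z \<odot> l) \<oplus> x \<otimes> x \<otimes> l)"
      by (simp add: a_assoc r_neg1)
    also have "\<dots> = \<ominus> l \<oplus> (x \<otimes> x \<oplus> (l \<ominus> x \<otimes> x \<otimes> l) \<oplus> x \<otimes> x \<otimes> l)" by (simp add: 1)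
    also have "\<dots> = x \<otimes> x" using x lc by algebra
    finally have "z \<odot> (l \<oplus> h \<otimes> h \<otimes> l) = z \<odot> (h \<otimes> h)"
      by (simp add: xx smult_add_right smult_mult_left)
    then have "complex_of_real (1 / c\<^sup>2) \<odot> (z \<odot> (l \<oplus> h \<otimes> h \<otimes> l)) = complex_of_real (1 / c\<^sup>2) \<odot> (z \<odot> (h \<otimes> h))"
      by (rule arg_cong)
    then show "l \<oplus> h \<otimes> h \<otimes> l = h \<otimes> h"
      by (simp add: smult_smult[of _ "complex_of_real (1 / c\<^sup>2)" z] z(1) del: of_real_divide of_real_power)
  qed simp
qed

text \<open>
  The Cayley transform \<open>(1 + i h) (1 - i h)\<^sup>-\<^sup>1\<close> is unitary with real part
  \<open>1 - 2 q\<close> and imaginary part \<open>2 h (1 - q)\<close>, where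
  \<open>q = h\<^sup>2 (1 + h\<^sup>2)\<^sup>-\<^sup>1\<close>; both are contractions by
  \<open>circle_norm_le\<close>.
\<close>

lemma cayley:
  assumes h [simp]: "h \<in> carrier A" and sa: "h\<^sup>\<star> = h"
  obtains q where "q \<in> carrier A" "q\<^sup>\<star> = q" "h \<otimes> q = q \<otimes> h" "q \<oplus> h \<otimes> h \<otimes> q = h \<otimes> h"
    "\<forall>b\<in>carrier A. \<parallel>b \<ominus> q \<otimes> b\<parallel> \<le> \<parallel>b\<parallel>"
    "\<parallel>(h \<ominus> h \<otimes> q) \<oplus> (h \<ominus> h \<otimes> q)\<parallel> \<le> 1"
proof -
  obtain q where q [simp]: "q \<in> carrier A" and q': "q\<^sup>\<star> = q" "h \<otimes> q = q \<otimes> h" "q \<oplus> h \<otimes> h \<otimes> q = h \<otimes> h"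
    by (rule resolvent[OF h sa])
  define m where "m = h \<ominus> h \<otimes> q"
  have m [simp]: "m \<in> carrier A" by (simp add: m_def)
  have msa: "m\<^sup>\<star> = m" by (simp add: m_def adj_add adj_mult minus_eq sa q'(1) q'(2))
  have mq: "m \<otimes> q = q \<otimes> m"
    by (simp add: m_def minus_eq distrib_left distrib_right mult_assoc q'(2))
  have "h \<otimes> m = h \<otimes> h \<ominus> h \<otimes> h \<otimes> q"
    unfolding m_def using h q by algebra
  also have "\<dots> = (q \<oplus> h \<otimes> h \<otimes> q) \<ominus> h \<otimes> h \<otimes> q" by (simp add: q'(3))
  also have "\<dots> = q" using h q by algebra
  finally have hm: "h \<otimes> m = q" .
  have "m = h \<ominus> q \<otimes> h" by (simp add: m_def q'(2))
  then have "m \<otimes> m = h \<otimes> m \<ominus> q \<otimes> (h \<otimes> m)"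
    by (simp add: minus_eq distrib_right mult_assoc)
  then have mm: "m \<otimes> m = q \<ominus> q \<otimes> q" by (simp add: hm)
  have circ: "\<parallel>b \<ominus> (q \<otimes> b \<oplus> q \<otimes> b)\<parallel> \<le> \<parallel>b\<parallel>" "\<parallel>(m \<oplus> m) \<otimes> b\<parallel> \<le> \<parallel>b\<parallel>" if [simp]: "b \<in> carrier A" for b
  proof -
    let ?p = "b \<ominus> (q \<otimes> b \<oplus> q \<otimes> b)" and ?p' = "(m \<oplus> m) \<otimes> b"
    have mq': "m \<otimes> (q \<otimes> z) = q \<otimes> (m \<otimes> z)" if "z \<in> carrier A" for z
      using that by (simp add: mult_assoc[symmetric] mq)
    have mm': "m \<otimes> (m \<otimes> z) = q \<otimes> z \<ominus> q \<otimes> (q \<otimes> z)" if "z \<in> carrier A" for z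
      using that by (simp add: mult_assoc[symmetric] mm minus_eq distrib_right)
    have 1: "?p\<^sup>\<star> \<otimes> ?p' = ?p'\<^sup>\<star> \<otimes> ?p"
      by (simp add: minus_eq distrib_left distrib_right adj_add adj_mult msa q'(1) mult_assoc mq' minus_add a_ac)
    have ps: "?p\<^sup>\<star> = b\<^sup>\<star> \<ominus> (b\<^sup>\<star> \<otimes> q \<oplus> b\<^sup>\<star> \<otimes> q)" "?p'\<^sup>\<star> = b\<^sup>\<star> \<otimes> m \<oplus> b\<^sup>\<star> \<otimes> m"
      by (simp_all add: minus_eq adj_add adj_mult msa q'(1) distrib_left)
    have pp': "?p'\<^sup>\<star> \<otimes> ?p' = (b\<^sup>\<star> \<otimes> (m \<otimes> (m \<otimes> b)) \<oplus> b\<^sup>\<star> \<otimes> (m \<otimes> (m \<otimes> b))) \<oplus> (b\<^sup>\<star> \<otimes> (m \<otimes> (m \<otimes> b)) \<oplus> b\<^sup>\<star> \<otimes> (m \<otimes> (m \<otimes> b)))"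
      unfolding ps(2) by (simp add: distrib_left distrib_right mult_assoc)
    have 2: "?p\<^sup>\<star> \<otimes> ?p \<oplus> ?p'\<^sup>\<star> \<otimes> ?p' = b\<^sup>\<star> \<otimes> b"
    proof -
      define s t u where "s = b\<^sup>\<star> \<otimes> b" and "t = b\<^sup>\<star> \<otimes> (q \<otimes> b)" and "u = b\<^sup>\<star> \<otimes> (q \<otimes> (q \<otimes> b))"
      have stu: "s \<in> carrier A" "t \<in> carrier A" "u \<in> carrier A" by (simp_all add: s_def t_def u_def)
      have "?p\<^sup>\<star> \<otimes> ?p = (s \<ominus> (t \<oplus> t)) \<ominus> ((t \<ominus> (u \<oplus> u)) \<oplus> (t \<ominus> (u \<oplus> u)))"
        unfolding ps(1) s_def t_def u_def by (simp add: minus_eq distrib_left distrib_right mult_assoc minus_add a_ac)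
      moreover have "?p'\<^sup>\<star> \<otimes> ?p' = ((t \<ominus> u) \<oplus> (t \<ominus> u)) \<oplus> ((t \<ominus> u) \<oplus> (t \<ominus> u))"
        unfolding pp' mm'[OF that] t_def u_def by (simp add: minus_eq distrib_left)
      moreover have "((s \<ominus> (t \<oplus> t)) \<ominus> ((t \<ominus> (u \<oplus> u)) \<oplus> (t \<ominus> (u \<oplus> u)))) \<oplus> (((t \<ominus> u) \<oplus> (t \<ominus> u)) \<oplus> ((t \<ominus> u) \<oplus> (t \<ominus> u))) = s"
        using stu by algebra
      ultimately show ?thesis by (simp add: s_def)
    qed
    show "\<parallel>?p\<parallel> \<le> \<parallel>b\<parallel>" by (rule circle_norm_le[OF _ _ _ 1 2]) simp_all
    show "\<parallel>?p'\<parallel> \<le> \<parallel>b\<parallel>"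
      by (rule circle_norm_le[where q = ?p]) (simp_all add: 1 2[symmetric] a_comm)
  qed
  show ?thesis
  proof (rule that[OF q q'], rule ballI)
    fix b assume [simp]: "b \<in> carrier A"
    have "(b \<ominus> q \<otimes> b) \<oplus> (b \<ominus> q \<otimes> b) = b \<oplus> (b \<ominus> (q \<otimes> b \<oplus> q \<otimes> b))"
      by (simp add: minus_eq minus_add a_ac)
    then have "\<parallel>2 \<odot> (b \<ominus> q \<otimes> b)\<parallel> \<le> \<parallel>b\<parallel> + \<parallel>b \<ominus> (q \<otimes> b \<oplus> q \<otimes> b)\<parallel>"
      using smult_add_left[of "b \<ominus> q \<otimes> b" 1 1] nrm_triangle[of b "b \<ominus> (q \<otimes> b \<oplus> q \<otimes> b)"] by simp
    then show "\<parallel>b \<ominus> q \<otimes> b\<parallel> \<le> \<parallel>b\<parallel>"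
      using circ(1)[of b] by (simp add: nrm_smult)
  next
    have "\<parallel>m \<oplus> m\<parallel>\<^sup>2 \<le> \<parallel>m \<oplus> m\<parallel>"
      using nrm_cstar[of "m \<oplus> m"] circ(2)[of "m \<oplus> m"] by (simp add: adj_add msa)
    then show "\<parallel>(h \<ominus> h \<otimes> q) \<oplus> (h \<ominus> h \<otimes> q)\<parallel> \<le> 1"
      by (simp add: m_def[symmetric] le_one_if_square_le)
  qed
qed

text \<open>
  The elements of \<open>F\<close> are treated one at a time. Given \<open>h\<close> for
  \<open>F\<close> and a further \<open>a\<close>, put \<open>v = (1 - h) a\<close> and let
  \<open>q\<close> belong to a large multiple of \<open>v v*\<close> as in \<open>cayley\<close>.
  Then \<open>(1 - q) v\<close> is small, because its square is \<open>(1 - q) v v* (1 - q)\<close>,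
  and \<open>(1 - h) (1 - q) (1 - h)\<close> is again a selfadjoint contraction, small on
  \<open>a\<close> and on \<open>F\<close>.
\<close>

lemma approx_unit_complement:
  assumes "finite F" "F \<subseteq> carrier A" "\<epsilon> > 0"
  shows "\<exists>h\<in>carrier A. h\<^sup>\<star> = h \<and> (\<forall>b\<in>carrier A. \<parallel>b \<ominus> h \<otimes> b\<parallel> \<le> \<parallel>b\<parallel>) \<and> (\<forall>a\<in>F. \<parallel>a \<ominus> h \<otimes> a\<parallel> \<le> \<epsilon>)"
  using assms(1,2)
proof (induction F)
  case empty
  show ?case by (intro bexI[of _ \<zero>]) (auto simp: minus_eq)
next
  case (insert a F)
  then have a [simp]: "a \<in> carrier A" and F: "F \<subseteq> carrier A" by auto
  from insert.IH[OF F] obtain h where h [simp]: "h \<in> carrier A" and hsa: "h\<^sup>\<star> = h"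
    and hc: "\<And>b. b \<in> carrier A \<Longrightarrow> \<parallel>b \<ominus> h \<otimes> b\<parallel> \<le> \<parallel>b\<parallel>" and hF: "\<And>a. a \<in> F \<Longrightarrow> \<parallel>a \<ominus> h \<otimes> a\<parallel> \<le> \<epsilon>"
    by blast
  define P where "P b = b \<ominus> h \<otimes> b" for b
  define v where "v = P a"
  \<comment> \<open>with this factor, \<open>\<parallel>k - k q\<parallel> \<le> 1/2\<close> becomes \<open>\<parallel>v v* - v v* q\<parallel> \<le> \<epsilon>\<^sup>2\<close>\<close>
  define k where "k = complex_of_real (1 / (2 * \<epsilon>\<^sup>2)) \<odot> (v \<otimes> v\<^sup>\<star>)"
  have P [simp]: "P b \<in> carrier A" if "b \<in> carrier A" for b using that by (simp add: P_def)
  have v [simp]: "v \<in> carrier A" by (simp add: v_def)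
  have k [simp]: "k \<in> carrier A" and ksa: "k\<^sup>\<star> = k" by (simp_all add: k_def adj_smult adj_mult adj_adj)
  obtain q where q [simp]: "q \<in> carrier A" and q': "q\<^sup>\<star> = q" "k \<otimes> q = q \<otimes> k" "q \<oplus> k \<otimes> k \<otimes> q = k \<otimes> k"
    and qc': "\<forall>b\<in>carrier A. \<parallel>b \<ominus> q \<otimes> b\<parallel> \<le> \<parallel>b\<parallel>"
    and kq: "\<parallel>(k \<ominus> k \<otimes> q) \<oplus> (k \<ominus> k \<otimes> q)\<parallel> \<le> 1"
    by (rule cayley[OF k ksa])
  note qc = bspec[OF qc']
  define R where "R b = b \<ominus> q \<otimes> b" for b
  have R [simp]: "R b \<in> carrier A" if "b \<in> carrier A" for b using that by (simp add: R_def)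
  define h' where "h' = (h \<oplus> h \<ominus> h \<otimes> h) \<oplus> (q \<ominus> h \<otimes> q \<ominus> q \<otimes> h \<oplus> h \<otimes> q \<otimes> h)"
  have h' [simp]: "h' \<in> carrier A" by (simp add: h'_def)
  have h'sa: "h'\<^sup>\<star> = h'"
    by (simp add: h'_def minus_eq adj_add adj_mult hsa q'(1) mult_assoc a_ac)
  have h'b: "b \<ominus> h' \<otimes> b = P (R (P b))" if "b \<in> carrier A" for b
    unfolding P_def R_def h'_def using that h q by algebra
  have PRP: "\<parallel>P (R z)\<parallel> \<le> \<parallel>z\<parallel>" if "z \<in> carrier A" for z
    using hc[of "R z"] qc[of z] that by (simp add: P_def[of "R z"]) (simp add: R_def)
  have "\<parallel>2 \<odot> (k \<ominus> k \<otimes> q)\<parallel> \<le> 1" using kq smult_add_left[of "k \<ominus> k \<otimes> q" 1 1] by simp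
  then have kq': "\<parallel>k \<ominus> k \<otimes> q\<parallel> \<le> 1 / 2" by (simp add: nrm_smult)
  have "k \<ominus> k \<otimes> q = complex_of_real (1 / (2 * \<epsilon>\<^sup>2)) \<odot> (v \<otimes> v\<^sup>\<star> \<ominus> v \<otimes> v\<^sup>\<star> \<otimes> q)"
    by (simp add: k_def minus_eq smult_add_right smult_mult_left)
  then have "\<parallel>v \<otimes> v\<^sup>\<star> \<ominus> v \<otimes> v\<^sup>\<star> \<otimes> q\<parallel> / (2 * \<epsilon>\<^sup>2) \<le> 1 / 2"
    using kq' by (simp add: nrm_smult norm_divide norm_mult norm_power)
  then have vv: "\<parallel>v \<otimes> v\<^sup>\<star> \<ominus> v \<otimes> v\<^sup>\<star> \<otimes> q\<parallel> \<le> \<epsilon>\<^sup>2" using \<open>\<epsilon> > 0\<close> by (simp add: divide_simps)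
  have "R v \<otimes> (R v)\<^sup>\<star> = R (v \<otimes> v\<^sup>\<star> \<ominus> v \<otimes> v\<^sup>\<star> \<otimes> q)"
  proof -
    have "(R v)\<^sup>\<star> = v\<^sup>\<star> \<ominus> v\<^sup>\<star> \<otimes> q" by (simp add: R_def minus_eq adj_add adj_mult q'(1))
    then show ?thesis unfolding R_def using v q by algebra
  qed
  then have "\<parallel>R v\<parallel>\<^sup>2 \<le> \<parallel>v \<otimes> v\<^sup>\<star> \<ominus> v \<otimes> v\<^sup>\<star> \<otimes> q\<parallel>"
    using nrm_cstar'[of "R v"] qc[of "v \<otimes> v\<^sup>\<star> \<ominus> v \<otimes> v\<^sup>\<star> \<otimes> q"] by (simp add: R_def)
  also note vv
  finally have "\<parallel>R v\<parallel> \<le> \<epsilon>" by (rule power2_le_imp_le) (use \<open>\<epsilon> > 0\<close> in simp)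
  then have Pa: "\<parallel>P (R (P a))\<parallel> \<le> \<epsilon>" using hc[of "R v"] unfolding v_def[symmetric] P_def[of "R v"] by simp
  show ?case
  proof (intro bexI[of _ h'] conjI ballI h' h'sa)
    fix b assume b: "b \<in> carrier A"
    show "\<parallel>b \<ominus> h' \<otimes> b\<parallel> \<le> \<parallel>b\<parallel>"
      using PRP[of "P b"] hc[OF b] b by (simp add: h'b) (simp add: P_def)
  next
    fix b assume b: "b \<in> insert a F"
    show "\<parallel>b \<ominus> h' \<otimes> b\<parallel> \<le> \<epsilon>"
    proof (cases "b = a")
      case True
      then show ?thesis using Pa by (simp add: h'b)
    next
      case False
      then have bF: "b \<in> F" "b \<in> carrier A" using b F by auto
      then show ?thesis using PRP[of "P b"] hF[OF bF(1)] by (simp add: h'b) (simp add: P_def)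
    qed
  qed
qed

text \<open>
  The \<open>h\<close> from \<open>approx_unit_complement\<close> may have norm up to 2. The remedy
  is \<open>e = 2 h (1 + h\<^sup>2)\<^sup>-\<^sup>1\<close>: it is a contraction, as the imaginary
  part of a Cayley transform, and
  \<open>1 - e = (1 - h)\<^sup>2 (1 + h\<^sup>2)\<^sup>-\<^sup>1\<close> is small where
  \<open>1 - h\<close> is.
\<close>

theorem approx_unit_exists:
  assumes "finite F" "F \<subseteq> carrier A" "\<epsilon> > 0"
  obtains e where "e \<in> carrier A" "e\<^sup>\<star> = e" "\<parallel>e\<parallel> \<le> 1"
    "\<And>a. a \<in> F \<Longrightarrow> \<parallel>e \<otimes> a \<ominus> a\<parallel> < \<epsilon>" "\<And>a. a \<in> F \<Longrightarrow> \<parallel>a \<otimes> e \<ominus> a\<parallel> < \<epsilon>"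
proof -
  let ?F = "F \<union> adj A ` F"
  have "finite ?F" "?F \<subseteq> carrier A" "\<epsilon> / 2 > 0" using assms by auto
  from approx_unit_complement[OF this] obtain h where h [simp]: "h \<in> carrier A" and hsa: "h\<^sup>\<star> = h"
    and hc: "\<And>b. b \<in> carrier A \<Longrightarrow> \<parallel>b \<ominus> h \<otimes> b\<parallel> \<le> \<parallel>b\<parallel>"
    and hF: "\<And>a. a \<in> ?F \<Longrightarrow> \<parallel>a \<ominus> h \<otimes> a\<parallel> \<le> \<epsilon> / 2"
    by blast
  obtain q where q [simp]: "q \<in> carrier A" and q': "q\<^sup>\<star> = q" "h \<otimes> q = q \<otimes> h" "q \<oplus> h \<otimes> h \<otimes> q = h \<otimes> h"
    and qc': "\<forall>b\<in>carrier A. \<parallel>b \<ominus> q \<otimes> b\<parallel> \<le> \<parallel>b\<parallel>"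
    and hq: "\<parallel>(h \<ominus> h \<otimes> q) \<oplus> (h \<ominus> h \<otimes> q)\<parallel> \<le> 1"
    by (rule cayley[OF h hsa])
  note qc = bspec[OF qc']
  define e where "e = (h \<ominus> h \<otimes> q) \<oplus> (h \<ominus> h \<otimes> q)"
  have e [simp]: "e \<in> carrier A" by (simp add: e_def)
  have esa: "e\<^sup>\<star> = e" by (simp add: e_def adj_add adj_mult minus_eq hsa q'(1)) (simp add: q'(2))
  have left: "\<parallel>e \<otimes> a \<ominus> a\<parallel> < \<epsilon>" if aF: "a \<in> ?F" for a
  proof -
    have a [simp]: "a \<in> carrier A" using aF assms by auto
    define y where "y = (a \<ominus> h \<otimes> a) \<ominus> h \<otimes> (a \<ominus> h \<otimes> a)"
    have y [simp]: "y \<in> carrier A" by (simp add: y_def)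
    have qhh: "q \<otimes> h \<otimes> h = h \<otimes> h \<otimes> q"
      by (simp add: mult_assoc q'(2)) (simp add: mult_assoc[symmetric] q'(2))
    have "y \<ominus> q \<otimes> y = a \<ominus> (h \<oplus> h) \<otimes> a \<oplus> q \<otimes> h \<otimes> a \<oplus> q \<otimes> h \<otimes> a \<oplus> (h \<otimes> h \<ominus> q \<ominus> q \<otimes> h \<otimes> h) \<otimes> a"
      unfolding y_def using a h q by algebra
    also have "h \<otimes> h \<ominus> q \<ominus> q \<otimes> h \<otimes> h = (q \<oplus> h \<otimes> h \<otimes> q) \<ominus> q \<ominus> h \<otimes> h \<otimes> q" by (simp add: q'(3) qhh)
    also have "\<dots> = \<zero>" using h q by algebra
    also have "a \<ominus> (h \<oplus> h) \<otimes> a \<oplus> q \<otimes> h \<otimes> a \<oplus> q \<otimes> h \<otimes> a \<oplus> \<zero> \<otimes> a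
        = a \<ominus> ((h \<ominus> q \<otimes> h) \<oplus> (h \<ominus> q \<otimes> h)) \<otimes> a"
      using a h q by algebra
    also have "\<dots> = a \<ominus> e \<otimes> a" by (simp add: e_def q'(2))
    finally have ye: "a \<ominus> e \<otimes> a = y \<ominus> q \<otimes> y" ..
    have "\<parallel>a \<ominus> e \<otimes> a\<parallel> \<le> \<parallel>y\<parallel>" unfolding ye by (rule qc) simp
    also have "\<dots> \<le> \<parallel>a \<ominus> h \<otimes> a\<parallel>" unfolding y_def by (rule hc) simp
    also have "\<dots> \<le> \<epsilon> / 2" by (rule hF[OF aF])
    finally show ?thesis using \<open>\<epsilon> > 0\<close> nrm_diff_commute[of "e \<otimes> a" a] by simp
  qed
  show ?thesis
  proof (rule that[OF e esa])
    show "\<parallel>e\<parallel> \<le> 1" using hq by (simp add: e_def)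
    fix a assume a: "a \<in> F"
    then have ac [simp]: "a \<in> carrier A" using assms by auto
    show "\<parallel>e \<otimes> a \<ominus> a\<parallel> < \<epsilon>" using left a by simp
    have "\<parallel>e \<otimes> a\<^sup>\<star> \<ominus> a\<^sup>\<star>\<parallel> < \<epsilon>" using left a by simp
    moreover have "e \<otimes> a\<^sup>\<star> \<ominus> a\<^sup>\<star> = (a \<otimes> e \<ominus> a)\<^sup>\<star>" by (simp add: minus_eq adj_add adj_mult esa)
    ultimately show "\<parallel>a \<otimes> e \<ominus> a\<parallel> < \<epsilon>" by simp
  qed
qed

end

section \<open>Sequence algebras\<close>

lemma linf_simps [simp]:
  "x \<otimes>\<^bsub>linf B\<^esub> y = (\<lambda>n. x n \<otimes>\<^bsub>B\<^esub> y n)" "x \<oplus>\<^bsub>linf B\<^esub> y = (\<lambda>n. x n \<oplus>\<^bsub>B\<^esub> y n)"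
  "\<zero>\<^bsub>linf B\<^esub> = (\<lambda>_. \<zero>\<^bsub>B\<^esub>)" "c \<odot>\<^bsub>linf B\<^esub> x = (\<lambda>n. c \<odot>\<^bsub>B\<^esub> x n)"
  "x\<^sup>\<star>\<^bsub>linf B\<^esub> = (\<lambda>n. (x n)\<^sup>\<star>\<^bsub>B\<^esub>)" "\<parallel>x\<parallel>\<^bsub>linf B\<^esub> = (SUP n. \<parallel>x n\<parallel>\<^bsub>B\<^esub>)"
  by (simp_all add: linf_def)

lemma mem_linf: "x \<in> carrier (linf B) \<longleftrightarrow> (\<forall>n. x n \<in> carrier B) \<and> (\<exists>C. \<forall>n. \<parallel>x n\<parallel>\<^bsub>B\<^esub> \<le> C)"
  by (simp add: linf_def)

lemma linfD [simp]: "x \<in> carrier (linf B) \<Longrightarrow> x n \<in> carrier B"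
  by (simp add: mem_linf)

abbreviation seq_class :: "'a cstar_struct \<Rightarrow> (nat \<Rightarrow> 'a) \<Rightarrow> (nat \<Rightarrow> 'a) set" where
  "seq_class B x \<equiv> null_seqs B +>\<^bsub>linf B\<^esub> x"

context cstar_seminormed_algebra
begin

definition null_diff :: "(nat \<Rightarrow> 'a) \<Rightarrow> (nat \<Rightarrow> 'a) \<Rightarrow> bool" where
  "null_diff x y \<longleftrightarrow> (\<lambda>n. \<parallel>x n \<ominus> y n\<parallel>) \<longlonglongrightarrow> 0"

lemma null_diffI:
  assumes "\<And>n. \<parallel>x n \<ominus> y n\<parallel> \<le> f n" "f \<longlonglongrightarrow> 0" "\<And>n. x n \<in> carrier A" "\<And>n. y n \<in> carrier A"
  shows "null_diff x y"
  unfolding null_diff_def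
  by (rule tendsto_sandwich[OF _ _ tendsto_const assms(2)]) (auto intro!: always_eventually assms)

lemma linf_const [simp]: "a \<in> carrier A \<Longrightarrow> (\<lambda>_. a) \<in> carrier (linf A)"
  by (auto simp: mem_linf)

lemma linf_add [simp]:
  assumes "x \<in> carrier (linf A)" "y \<in> carrier (linf A)"
  shows "(\<lambda>n. x n \<oplus> y n) \<in> carrier (linf A)"
proof -
  obtain C D where "\<And>n. \<parallel>x n\<parallel> \<le> C" "\<And>n. \<parallel>y n\<parallel> \<le> D" using assms by (auto simp: mem_linf)
  then have "\<parallel>x n \<oplus> y n\<parallel> \<le> C + D" for n
    using nrm_triangle[of "x n" "y n"] assms by (meson add_mono linfD order_trans)
  then show ?thesis using assms by (auto simp: mem_linf)
qed

lemma linf_mult [simp]: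
  assumes "x \<in> carrier (linf A)" "y \<in> carrier (linf A)"
  shows "(\<lambda>n. x n \<otimes> y n) \<in> carrier (linf A)"
proof -
  obtain C D where CD: "\<And>n. \<parallel>x n\<parallel> \<le> C" "\<And>n. \<parallel>y n\<parallel> \<le> D" using assms by (auto simp: mem_linf)
  have "\<parallel>x n \<otimes> y n\<parallel> \<le> C * D" for n
  proof -
    have "\<parallel>x n \<otimes> y n\<parallel> \<le> \<parallel>x n\<parallel> * \<parallel>y n\<parallel>" using assms by (simp add: nrm_mult)
    also have "\<dots> \<le> C * D"
      using order_trans[OF nrm_ge0[OF linfD[OF assms(1), of n]] CD(1)[of n]] assms
      by (intro mult_mono CD) auto
    finally show ?thesis .
  qed
  then show ?thesis using assms by (auto simp: mem_linf)
qed

lemma linf_smult [simp]: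
  assumes "x \<in> carrier (linf A)" shows "(\<lambda>n. c \<odot> x n) \<in> carrier (linf A)"
proof -
  obtain C where "\<And>n. \<parallel>x n\<parallel> \<le> C" using assms by (auto simp: mem_linf)
  then have "\<parallel>c \<odot> x n\<parallel> \<le> cmod c * C" for n using assms by (simp add: nrm_smult mult_left_mono)
  then show ?thesis using assms by (auto simp: mem_linf)
qed

lemma linf_adj [simp]: "x \<in> carrier (linf A) \<Longrightarrow> (\<lambda>n. (x n)\<^sup>\<star>) \<in> carrier (linf A)"
  by (auto simp: mem_linf)

lemma linf_diff [simp]:
  assumes "x \<in> carrier (linf A)" "y \<in> carrier (linf A)"
  shows "(\<lambda>n. x n \<ominus> y n) \<in> carrier (linf A)"
  using linf_add[OF assms(1) linf_smult[OF assms(2), of "-1"]] assms by (simp add: minus_eq minus_smult)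

lemma null_diff_refl [simp]: "x \<in> carrier (linf A) \<Longrightarrow> null_diff x x"
  by (simp add: null_diff_def)

lemma null_diff_sym: "\<lbrakk>null_diff x y; x \<in> carrier (linf A); y \<in> carrier (linf A)\<rbrakk> \<Longrightarrow> null_diff y x"
  unfolding null_diff_def by (subst nrm_diff_commute) auto

lemma null_diff_trans:
  assumes "null_diff x y" "null_diff y z"
    "x \<in> carrier (linf A)" "y \<in> carrier (linf A)" "z \<in> carrier (linf A)"
  shows "null_diff x z"
proof (rule null_diffI[where f = "\<lambda>n. \<parallel>x n \<ominus> y n\<parallel> + \<parallel>y n \<ominus> z n\<parallel>"])
  show "(\<lambda>n. \<parallel>x n \<ominus> y n\<parallel> + \<parallel>y n \<ominus> z n\<parallel>) \<longlonglongrightarrow> 0"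
    using assms(1,2) unfolding null_diff_def by (rule tendsto_add_zero)
qed (use assms in \<open>auto intro!: nrm_diff_triangle\<close>)

lemma null_diff_add:
  assumes "null_diff x x'" "null_diff y y'"
    "x \<in> carrier (linf A)" "x' \<in> carrier (linf A)" "y \<in> carrier (linf A)" "y' \<in> carrier (linf A)"
  shows "null_diff (\<lambda>n. x n \<oplus> y n) (\<lambda>n. x' n \<oplus> y' n)"
proof (rule null_diffI[where f = "\<lambda>n. \<parallel>x n \<ominus> x' n\<parallel> + \<parallel>y n \<ominus> y' n\<parallel>"])
  show "(\<lambda>n. \<parallel>x n \<ominus> x' n\<parallel> + \<parallel>y n \<ominus> y' n\<parallel>) \<longlonglongrightarrow> 0"
    using assms(1,2) unfolding null_diff_def by (rule tendsto_add_zero)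
qed (use assms in \<open>auto intro!: nrm_add_diff_le\<close>)

lemma null_diff_smult:
  assumes "null_diff x x'" "x \<in> carrier (linf A)" "x' \<in> carrier (linf A)"
  shows "null_diff (\<lambda>n. c \<odot> x n) (\<lambda>n. c \<odot> x' n)"
proof (rule null_diffI[where f = "\<lambda>n. cmod c * \<parallel>x n \<ominus> x' n\<parallel>"])
  show "(\<lambda>n. cmod c * \<parallel>x n \<ominus> x' n\<parallel>) \<longlonglongrightarrow> 0"
    using assms(1) unfolding null_diff_def by (rule tendsto_mult_right_zero)
qed (use assms in \<open>auto simp: nrm_smult_diff\<close>)

lemma null_diff_adj:
  assumes "null_diff x x'" "x \<in> carrier (linf A)" "x' \<in> carrier (linf A)"
  shows "null_diff (\<lambda>n. (x n)\<^sup>\<star>) (\<lambda>n. (x' n)\<^sup>\<star>)"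
  using assms by (simp add: null_diff_def nrm_adj_diff)

lemma null_diff_mult:
  assumes "null_diff x x'" "null_diff y y'"
    "x \<in> carrier (linf A)" "x' \<in> carrier (linf A)" "y \<in> carrier (linf A)" "y' \<in> carrier (linf A)"
  shows "null_diff (\<lambda>n. x n \<otimes> y n) (\<lambda>n. x' n \<otimes> y' n)"
proof -
  obtain C D where C: "\<And>n. \<parallel>x' n\<parallel> \<le> C" and D: "\<And>n. \<parallel>y n\<parallel> \<le> D" using assms by (auto simp: mem_linf)
  show ?thesis
  proof (rule null_diffI[where f = "\<lambda>n. \<parallel>x n \<ominus> x' n\<parallel> * D + C * \<parallel>y n \<ominus> y' n\<parallel>"])
    fix n
    have "\<parallel>x n \<otimes> y n \<ominus> x' n \<otimes> y' n\<parallel> \<le> \<parallel>x n \<ominus> x' n\<parallel> * \<parallel>y n\<parallel> + \<parallel>x' n\<parallel> * \<parallel>y n \<ominus> y' n\<parallel>"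
      using assms by (intro nrm_mult_diff_le) auto
    also have "\<dots> \<le> \<parallel>x n \<ominus> x' n\<parallel> * D + C * \<parallel>y n \<ominus> y' n\<parallel>"
      using assms by (intro add_mono mult_left_mono mult_right_mono C D) auto
    finally show "\<parallel>x n \<otimes> y n \<ominus> x' n \<otimes> y' n\<parallel> \<le> \<parallel>x n \<ominus> x' n\<parallel> * D + C * \<parallel>y n \<ominus> y' n\<parallel>" .
    show "(\<lambda>n. \<parallel>x n \<ominus> x' n\<parallel> * D + C * \<parallel>y n \<ominus> y' n\<parallel>) \<longlonglongrightarrow> 0"
      using assms(1,2) unfolding null_diff_def
      by (intro tendsto_add_zero tendsto_mult_left_zero tendsto_mult_right_zero)
  qed (use assms in auto)
qed

lemma seq_class_eq:
  assumes x: "x \<in> carrier (linf A)"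
  shows "seq_class A x = {y \<in> carrier (linf A). null_diff y x}"
proof (intro equalityI subsetI)
  fix y assume "y \<in> seq_class A x"
  then obtain i where i: "i \<in> carrier (linf A)" "(\<lambda>n. \<parallel>i n\<parallel>) \<longlonglongrightarrow> 0" and y: "y = (\<lambda>n. i n \<oplus> x n)"
    by (auto simp: a_r_coset_def' null_seqs_def)
  have "(i n \<oplus> x n) \<ominus> x n = i n" for n
    using linfD[OF i(1)] linfD[OF x] by (simp add: minus_eq a_assoc r_neg)
  then show "y \<in> {y \<in> carrier (linf A). null_diff y x}" using i x by (simp add: null_diff_def y)
next
  fix y assume y: "y \<in> {y \<in> carrier (linf A). null_diff y x}"
  let ?i = "\<lambda>n. y n \<ominus> x n"
  have "y = (\<lambda>n. ?i n \<oplus> x n)" using y x by (auto simp: minus_eq a_assoc l_neg)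
  moreover have "?i \<in> null_seqs A" using y x by (simp add: null_seqs_def null_diff_def)
  ultimately show "y \<in> seq_class A x" by (auto simp: a_r_coset_def')
qed

lemma mem_seq_class:
  "x \<in> carrier (linf A) \<Longrightarrow> y \<in> seq_class A x \<longleftrightarrow> y \<in> carrier (linf A) \<and> null_diff y x"
  by (simp add: seq_class_eq)

lemma seq_class_self: "x \<in> carrier (linf A) \<Longrightarrow> x \<in> seq_class A x"
  by (simp add: seq_class_eq)

lemma seq_class_eq_iff:
  assumes "x \<in> carrier (linf A)" "y \<in> carrier (linf A)"
  shows "seq_class A x = seq_class A y \<longleftrightarrow> null_diff x y"
proof
  assume "seq_class A x = seq_class A y"
  then show "null_diff x y" using seq_class_self[OF assms(1)] assms by (simp add: mem_seq_class)
next
  assume "null_diff x y"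
  then show "seq_class A x = seq_class A y"
    using assms null_diff_trans[of _ x y] null_diff_trans[of _ y x] null_diff_sym[of x y]
    by (auto simp: mem_seq_class)
qed

lemma coset_map_seq_class:
  assumes x: "x \<in> carrier (linf A)"
    and F: "\<And>y. \<lbrakk>y \<in> carrier (linf A); null_diff y x\<rbrakk> \<Longrightarrow> F y \<in> carrier (linf A) \<and> null_diff (F y) (F x)"
  shows "coset_map (linf A) (null_seqs A) F (seq_class A x) = seq_class A (F x)"
proof -
  have "seq_class A (F y) = seq_class A (F x)" if "y \<in> seq_class A x" for y
    using that F[of y] F[of x] x by (simp add: mem_seq_class seq_class_eq_iff)
  then show ?thesis unfolding coset_map_def using seq_class_self[OF x] by blast
qed

lemma seq_algebra_carrier: "carrier (seq_algebra A) = seq_class A ` carrier (linf A)"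
  by (auto simp: seq_algebra_def cstar_quotient_def FactRing_def A_RCOSETS_def')

lemma seq_class_in_carrier [simp]: "x \<in> carrier (linf A) \<Longrightarrow> seq_class A x \<in> carrier (seq_algebra A)"
  by (simp add: seq_algebra_carrier)

lemma seq_algebra_cases:
  assumes "X \<in> carrier (seq_algebra A)"
  obtains x where "x \<in> carrier (linf A)" "X = seq_class A x"
  using assms by (auto simp: seq_algebra_carrier)

lemma seq_class_add:
  assumes xy: "x \<in> carrier (linf A)" "y \<in> carrier (linf A)"
  shows "seq_class A x \<oplus>\<^bsub>seq_algebra A\<^esub> seq_class A y = seq_class A (\<lambda>n. x n \<oplus> y n)"
proof -
  have "seq_class A x \<oplus>\<^bsub>seq_algebra A\<^esub> seq_class A y
      = {z. \<exists>x'\<in>seq_class A x. \<exists>y'\<in>seq_class A y. z = (\<lambda>n. x' n \<oplus> y' n)}"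
    by (auto simp: seq_algebra_def cstar_quotient_def FactRing_def set_add_def')
  also have "\<dots> = seq_class A (\<lambda>n. x n \<oplus> y n)"
  proof (intro equalityI subsetI)
    fix z assume "z \<in> {z. \<exists>x'\<in>seq_class A x. \<exists>y'\<in>seq_class A y. z = (\<lambda>n. x' n \<oplus> y' n)}"
    then show "z \<in> seq_class A (\<lambda>n. x n \<oplus> y n)" using xy by (auto simp: mem_seq_class null_diff_add)
  next
    fix z assume "z \<in> seq_class A (\<lambda>n. x n \<oplus> y n)"
    then have z: "z \<in> carrier (linf A)" "null_diff z (\<lambda>n. x n \<oplus> y n)" using xy by (simp_all add: mem_seq_class)
    let ?x = "\<lambda>n. z n \<ominus> y n"
    have "(z n \<ominus> y n) \<ominus> x n = z n \<ominus> (x n \<oplus> y n)" for n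
      using linfD[OF z(1)] linfD[OF xy(1)] linfD[OF xy(2)]
      by (simp add: minus_eq minus_add a_ac)
    then have "?x \<in> seq_class A x" using z xy by (simp add: mem_seq_class null_diff_def)
    moreover have "z = (\<lambda>n. ?x n \<oplus> y n)" using z xy by (auto simp: minus_eq a_assoc l_neg)
    ultimately show "z \<in> {z. \<exists>x'\<in>seq_class A x. \<exists>y'\<in>seq_class A y. z = (\<lambda>n. x' n \<oplus> y' n)}"
      using seq_class_self[OF xy(2)] by (intro CollectI bexI[of _ ?x] bexI[of _ y])
  qed
  finally show ?thesis .
qed

lemma seq_class_mult:
  assumes xy: "x \<in> carrier (linf A)" "y \<in> carrier (linf A)"
  shows "seq_class A x \<otimes>\<^bsub>seq_algebra A\<^esub> seq_class A y = seq_class A (\<lambda>n. x n \<otimes> y n)"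
proof -
  have "seq_class A (\<lambda>n. x' n \<otimes> y' n) = seq_class A (\<lambda>n. x n \<otimes> y n)"
    if "x' \<in> seq_class A x" "y' \<in> seq_class A y" for x' y'
    using that xy by (simp add: mem_seq_class seq_class_eq_iff null_diff_mult)
  then have "(\<Union>x'\<in>seq_class A x. \<Union>y'\<in>seq_class A y. seq_class A (\<lambda>n. x' n \<otimes> y' n)) = seq_class A (\<lambda>n. x n \<otimes> y n)"
    using seq_class_self[OF xy(1)] seq_class_self[OF xy(2)] by blast
  then show ?thesis
    by (simp add: seq_algebra_def cstar_quotient_def FactRing_def rcoset_mult_def)
qed

lemma seq_class_smult:
  "x \<in> carrier (linf A) \<Longrightarrow> c \<odot>\<^bsub>seq_algebra A\<^esub> seq_class A x = seq_class A (\<lambda>n. c \<odot> x n)"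
  by (simp add: seq_algebra_def cstar_quotient_def coset_map_seq_class null_diff_smult)

lemma seq_class_adj:
  "x \<in> carrier (linf A) \<Longrightarrow> (seq_class A x)\<^sup>\<star>\<^bsub>seq_algebra A\<^esub> = seq_class A (\<lambda>n. (x n)\<^sup>\<star>)"
  by (simp add: seq_algebra_def cstar_quotient_def coset_map_seq_class null_diff_adj)

lemma seq_class_zero: "\<zero>\<^bsub>seq_algebra A\<^esub> = seq_class A (\<lambda>_. \<zero>)"
proof -
  have "seq_class A (\<lambda>_. \<zero>) = null_seqs A"
    unfolding seq_class_eq[OF linf_const[OF zero_closed]]
    by (auto simp: null_seqs_def null_diff_def minus_eq)
  then show ?thesis by (simp add: seq_algebra_def cstar_quotient_def FactRing_def)
qed

lemmas seq_class_ops = seq_class_add seq_class_mult seq_class_smult seq_class_adj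

lemma SUP_nrm_nonneg: "x \<in> carrier (linf A) \<Longrightarrow> 0 \<le> (SUP n. \<parallel>x n\<parallel>)"
  by (rule cSUP_upper2[of _ _ 0]) (auto simp: mem_linf bdd_above_def)

lemma nrm_seq_class: "\<parallel>seq_class A x\<parallel>\<^bsub>seq_algebra A\<^esub> = (INF y\<in>seq_class A x. SUP n. \<parallel>y n\<parallel>)"
  by (simp add: seq_algebra_def cstar_quotient_def)

lemma bdd_below_nrm_seq_class:
  "x \<in> carrier (linf A) \<Longrightarrow> bdd_below ((\<lambda>y. SUP n. \<parallel>y n\<parallel>) ` seq_class A x)"
  using SUP_nrm_nonneg by (intro bdd_belowI2[of _ 0]) (auto simp: mem_seq_class)

text \<open>
  Finitely many terms can be changed to zero within a class. Together with
  \<open>nrm_seq_class_less\<close> this says that the quotient norm is the limit superior of the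
  norms, the only form in which it is used.
\<close>

lemma nrm_seq_class_le:
  assumes x: "x \<in> carrier (linf A)" and c: "0 \<le> c" and ev: "eventually (\<lambda>n. \<parallel>x n\<parallel> \<le> c) sequentially"
  shows "\<parallel>seq_class A x\<parallel>\<^bsub>seq_algebra A\<^esub> \<le> c"
proof -
  define y where "y = (\<lambda>n. if \<parallel>x n\<parallel> \<le> c then x n else \<zero>)"
  have y: "y \<in> carrier (linf A)" using x c by (auto simp: y_def mem_linf)
  have "null_diff y x"
    unfolding null_diff_def using ev x
    by (intro tendsto_eventually) (auto elim!: eventually_mono simp: y_def)
  then have "y \<in> seq_class A x" using x y by (simp add: mem_seq_class)
  moreover have "(SUP n. \<parallel>y n\<parallel>) \<le> c" using c by (intro cSUP_least) (auto simp: y_def)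
  ultimately show ?thesis
    unfolding nrm_seq_class by (rule cINF_lower2[OF bdd_below_nrm_seq_class[OF x]])
qed

lemma nrm_seq_class_less:
  assumes x: "x \<in> carrier (linf A)" and c: "\<parallel>seq_class A x\<parallel>\<^bsub>seq_algebra A\<^esub> < c"
  shows "eventually (\<lambda>n. \<parallel>x n\<parallel> < c) sequentially"
proof -
  obtain y where y: "y \<in> seq_class A x" and lt: "(SUP n. \<parallel>y n\<parallel>) < c"
    using c cINF_less_iff[OF _ bdd_below_nrm_seq_class[OF x]] seq_class_self[OF x]
    unfolding nrm_seq_class by auto
  define s where "s = (SUP n. \<parallel>y n\<parallel>)"
  have yl: "y \<in> carrier (linf A)" "null_diff y x" using y x by (simp_all add: mem_seq_class)
  have ys: "\<parallel>y n\<parallel> \<le> s" for n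
    unfolding s_def using yl(1) by (intro cSUP_upper) (auto simp: mem_linf bdd_above_def)
  have "eventually (\<lambda>n. \<parallel>x n \<ominus> y n\<parallel> < c - s) sequentially"
    using null_diff_sym[OF yl(2) yl(1) x] lt unfolding null_diff_def
    by (intro order_tendstoD(2)) (auto simp: s_def)
  then show ?thesis
  proof (rule eventually_mono)
    fix n assume "\<parallel>x n \<ominus> y n\<parallel> < c - s"
    then show "\<parallel>x n\<parallel> < c" using nrm_le_diff[OF linfD[OF x] linfD[OF yl(1)], of n n] ys[of n] by linarith
  qed
qed

lemma nrm_seq_class_ge0: "x \<in> carrier (linf A) \<Longrightarrow> 0 \<le> \<parallel>seq_class A x\<parallel>\<^bsub>seq_algebra A\<^esub>"
  unfolding nrm_seq_class
proof (rule cINF_greatest)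
  assume "x \<in> carrier (linf A)"
  then show "seq_class A x \<noteq> {}" using seq_class_self by blast
qed (simp add: mem_seq_class SUP_nrm_nonneg)

lemma nrm_const_seq [simp]:
  assumes "a \<in> carrier A" shows "\<parallel>const_seq A a\<parallel>\<^bsub>seq_algebra A\<^esub> = \<parallel>a\<parallel>"
proof (rule antisym)
  show "\<parallel>const_seq A a\<parallel>\<^bsub>seq_algebra A\<^esub> \<le> \<parallel>a\<parallel>"
    unfolding const_seq_def using assms by (intro nrm_seq_class_le) auto
  show "\<parallel>a\<parallel> \<le> \<parallel>const_seq A a\<parallel>\<^bsub>seq_algebra A\<^esub>"
    unfolding const_seq_def
  proof (rule dense_ge)
    fix c assume "\<parallel>seq_class A (\<lambda>_. a)\<parallel>\<^bsub>seq_algebra A\<^esub> < c"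
    then show "\<parallel>a\<parallel> \<le> c" using nrm_seq_class_less[of "\<lambda>_. a" c] assms by simp
  qed
qed

lemma star_algebra_seq_algebra: "star_algebra (seq_algebra A)"
proof -
  note [elim!] = seq_algebra_cases
  have "cring complex_ring" by (rule R.is_cring)
  moreover have "abelian_group (seq_algebra A)"
  proof (rule abelian_groupI)
    fix X assume "X \<in> carrier (seq_algebra A)"
    then obtain x where x: "x \<in> carrier (linf A)" "X = seq_class A x" by blast
    have "seq_class A (\<lambda>n. (-1) \<odot> x n) \<oplus>\<^bsub>seq_algebra A\<^esub> X = \<zero>\<^bsub>seq_algebra A\<^esub>"
      using x by (simp add: seq_class_add[OF linf_smult] seq_class_zero) (simp add: minus_smult[symmetric] l_neg)
    then show "\<exists>Y\<in>carrier (seq_algebra A). Y \<oplus>\<^bsub>seq_algebra A\<^esub> X = \<zero>\<^bsub>seq_algebra A\<^esub>"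
      using x by (intro bexI[of _ "seq_class A (\<lambda>n. (-1) \<odot> x n)"]) auto
  qed (auto simp: seq_class_add seq_class_zero a_ac)
  ultimately have "module complex_ring (seq_algebra A)"
    by (rule moduleI)
       (auto simp: seq_class_ops smult_add_left smult_add_right smult_smult)
  then show ?thesis
    by (rule star_algebra.intro, unfold_locales)
       (auto simp: seq_class_ops mult_assoc distrib_left distrib_right smult_mult_left smult_mult_right
          adj_adj adj_add adj_smult adj_mult)
qed

lemma cstar_seminorm_seq_algebra: "cstar_seminorm (seq_algebra A) (nrm (seq_algebra A))"
  unfolding cstar_seminorm_def
proof (intro conjI allI ballI)
  let ?N = "nrm (seq_algebra A)"
  fix X assume "X \<in> carrier (seq_algebra A)"
  then obtain x where x [simp]: "x \<in> carrier (linf A)" and X: "X = seq_class A x" by (rule seq_algebra_cases)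
  note xn [simp] = linfD[OF x]
  show "0 \<le> ?N X" by (simp add: X nrm_seq_class_ge0)
  have smult_le: "?N (seq_class A (\<lambda>n. c \<odot> z n)) \<le> cmod c * ?N (seq_class A z)"
    if z [simp]: "z \<in> carrier (linf A)" for c z
  proof (cases "c = 0")
    case True
    then show ?thesis using linfD[OF z] by (intro nrm_seq_class_le) (auto simp: nrm_smult nrm_seq_class_ge0)
  next
    case False
    have "?N (seq_class A (\<lambda>n. c \<odot> z n)) / cmod c \<le> ?N (seq_class A z)"
    proof (rule dense_ge)
      fix r assume r: "?N (seq_class A z) < r"
      then have r0: "r \<ge> 0" using nrm_seq_class_ge0[OF z] by linarith
      have "?N (seq_class A (\<lambda>n. c \<odot> z n)) \<le> cmod c * r"
        using nrm_seq_class_less[OF z r] linfD[OF z] r0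
        by (intro nrm_seq_class_le) (auto elim!: eventually_mono simp: nrm_smult intro!: mult_left_mono)
      then show "?N (seq_class A (\<lambda>n. c \<odot> z n)) / cmod c \<le> r" using False by (simp add: divide_le_eq mult.commute)
    qed
    then show ?thesis using False by (simp add: divide_le_eq mult.commute)
  qed
  show "?N (c \<odot>\<^bsub>seq_algebra A\<^esub> X) = cmod c * ?N X" for c
  proof (cases "c = 0")
    case True
    then show ?thesis using smult_le[OF x, of 0] nrm_seq_class_ge0[of "\<lambda>n. 0 \<odot> x n"] by (simp add: X seq_class_smult)
  next
    case False
    have "?N (seq_class A (\<lambda>n. (1/c) \<odot> (c \<odot> x n))) \<le> cmod (1/c) * ?N (seq_class A (\<lambda>n. c \<odot> x n))"
      by (rule smult_le) simp
    then have "?N X \<le> ?N (c \<odot>\<^bsub>seq_algebra A\<^esub> X) / cmod c"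
      using False by (simp add: X seq_class_smult smult_smult norm_divide)
    then show ?thesis
      using smult_le[OF x, of c] False by (simp add: X seq_class_smult le_divide_eq mult.commute)
  qed
  show "?N (X\<^sup>\<star>\<^bsub>seq_algebra A\<^esub> \<otimes>\<^bsub>seq_algebra A\<^esub> X) = (?N X)\<^sup>2"
  proof (rule antisym)
    let ?n = "?N X" and ?m = "?N (X\<^sup>\<star>\<^bsub>seq_algebra A\<^esub> \<otimes>\<^bsub>seq_algebra A\<^esub> X)"
    have XX: "X\<^sup>\<star>\<^bsub>seq_algebra A\<^esub> \<otimes>\<^bsub>seq_algebra A\<^esub> X = seq_class A (\<lambda>n. (x n)\<^sup>\<star> \<otimes> x n)"
      by (simp add: X seq_class_ops)
    have n0: "?n \<ge> 0" and m0: "?m \<ge> 0" unfolding XX by (simp_all add: X nrm_seq_class_ge0)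
    have "sqrt ?m \<le> ?n"
    proof (rule dense_ge)
      fix r assume r: "?n < r"
      then have r0: "0 \<le> r" using n0 by linarith
      have "?m \<le> r\<^sup>2" unfolding XX
        using nrm_seq_class_less[OF x r[unfolded X]]
        by (intro nrm_seq_class_le) (auto elim!: eventually_mono simp: nrm_cstar intro!: power_mono)
      then show "sqrt ?m \<le> r" using r0 by (simp add: real_le_lsqrt m0)
    qed
    then show "?m \<le> ?n\<^sup>2" using m0 by (simp add: sqrt_le_D)
    have "?n\<^sup>2 \<le> ?m"
    proof (rule dense_ge)
      fix r assume r: "?m < r"
      then have r0: "0 \<le> r" using m0 by linarith
      have "?n \<le> sqrt r" unfolding X
        using nrm_seq_class_less[OF _ r[unfolded XX]] r0
        by (intro nrm_seq_class_le) (auto elim!: eventually_mono simp: nrm_cstar intro!: real_le_rsqrt)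
      then show "?n\<^sup>2 \<le> r" using n0 r0 by (metis power_mono real_sqrt_pow2)
    qed
    then show "?n\<^sup>2 \<le> ?m" .
  qed
  fix Y assume "Y \<in> carrier (seq_algebra A)"
  then obtain y where y [simp]: "y \<in> carrier (linf A)" and Y: "Y = seq_class A y" by (rule seq_algebra_cases)
  note yn [simp] = linfD[OF y]
  have NX: "?N X \<ge> 0" and NY: "?N Y \<ge> 0" by (simp_all add: X Y nrm_seq_class_ge0)
  show "?N (X \<oplus>\<^bsub>seq_algebra A\<^esub> Y) \<le> ?N X + ?N Y"
  proof (rule field_le_epsilon)
    fix e :: real assume e: "e > 0"
    have "eventually (\<lambda>n. \<parallel>x n \<oplus> y n\<parallel> \<le> ?N X + ?N Y + e) sequentially"
      using nrm_seq_class_less[OF x, of "?N X + e / 2"] nrm_seq_class_less[OF y, of "?N Y + e / 2"]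
    proof (rule eventually_elim2)
      fix n assume "\<parallel>x n\<parallel> < ?N X + e / 2" "\<parallel>y n\<parallel> < ?N Y + e / 2"
      then show "\<parallel>x n \<oplus> y n\<parallel> \<le> ?N X + ?N Y + e"
        using nrm_triangle[of "x n" "y n"] by simp
    qed (use e in \<open>simp_all add: X Y\<close>)
    then show "?N (X \<oplus>\<^bsub>seq_algebra A\<^esub> Y) \<le> ?N X + ?N Y + e"
      using NX NY e unfolding X Y by (simp add: seq_class_add nrm_seq_class_le)
  qed
  show "?N (X \<otimes>\<^bsub>seq_algebra A\<^esub> Y) \<le> ?N X * ?N Y"
  proof -
    have *: "?N (X \<otimes>\<^bsub>seq_algebra A\<^esub> Y) \<le> r * t" if r: "?N X < r" and t: "?N Y < t" for r t
    proof -
      have rt: "r \<ge> 0" "t \<ge> 0" using NX NY r t by linarith+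
      have "eventually (\<lambda>n. \<parallel>x n \<otimes> y n\<parallel> \<le> r * t) sequentially"
        using nrm_seq_class_less[OF x r[unfolded X]] nrm_seq_class_less[OF y t[unfolded Y]]
      proof eventually_elim
        fix n assume "\<parallel>x n\<parallel> < r" "\<parallel>y n\<parallel> < t"
        then have "\<parallel>x n\<parallel> * \<parallel>y n\<parallel> \<le> r * t" using rt by (intro mult_mono) auto
        then show "\<parallel>x n \<otimes> y n\<parallel> \<le> r * t" using nrm_mult[of "x n" "y n"] by simp
      qed
      then show ?thesis using rt unfolding X Y by (simp add: seq_class_mult nrm_seq_class_le)
    qed
    have "((\<lambda>e. (?N X + e) * (?N Y + e)) \<longlongrightarrow> (?N X + 0) * (?N Y + 0)) (at_right 0)"
      by (intro tendsto_intros)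
    moreover have "eventually (\<lambda>e::real. ?N (X \<otimes>\<^bsub>seq_algebra A\<^esub> Y) \<le> (?N X + e) * (?N Y + e)) (at_right 0)"
      using eventually_at_right_less[of "0::real"] by eventually_elim (rule *, auto)
    ultimately show ?thesis
      using tendsto_lowerbound[OF _ _ trivial_limit_at_right_real] by fastforce
  qed
qed

lemma nrm_seq_class_definite:
  assumes "X \<in> carrier (seq_algebra A)" "\<parallel>X\<parallel>\<^bsub>seq_algebra A\<^esub> = 0" shows "X = \<zero>\<^bsub>seq_algebra A\<^esub>"
proof -
  obtain x where x: "x \<in> carrier (linf A)" and X: "X = seq_class A x" using assms(1) by (rule seq_algebra_cases)
  have "(\<lambda>n. \<parallel>x n\<parallel>) \<longlonglongrightarrow> 0"
  proof (rule order_tendstoI)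
    fix a :: real assume "a < 0"
    then show "eventually (\<lambda>n. a < \<parallel>x n\<parallel>) sequentially"
      using x by (auto intro!: always_eventually intro: less_le_trans)
  next
    fix a :: real assume "0 < a"
    then show "eventually (\<lambda>n. \<parallel>x n\<parallel> < a) sequentially" using assms(2) x by (simp add: X nrm_seq_class_less)
  qed
  then show ?thesis
    using x by (simp add: X seq_class_zero seq_class_eq_iff null_diff_def minus_eq)
qed

lemma cstar_seminormed_seq_algebra: "cstar_seminormed_algebra (seq_algebra A)"
  by (intro cstar_seminormed_algebra.intro star_algebra_seq_algebra cstar_seminormed_algebra_axioms.intro
      cstar_seminorm_seq_algebra)

end

section \<open>Completeness of the sequence algebra\<close>

text \<open>
  Take for \<open>k n\<close> the largest \<open>j \<le> n\<close> such that \<open>P j n\<close>;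
  the second assumption provides one.
\<close>

lemma eventually_diagonal:
  fixes P :: "nat \<Rightarrow> nat \<Rightarrow> bool"
  assumes "\<And>k. eventually (P k) sequentially" and "\<And>n. P 0 n"
  obtains k :: "nat \<Rightarrow> nat" where "filterlim k at_top sequentially" "\<And>n. P (k n) n"
proof -
  define K where "K n = {j. j \<le> n \<and> P j n}" for n
  define k where "k n = Max (K n)" for n
  have fin: "finite (K n)" and ne: "K n \<noteq> {}" for n using assms(2)[of n] by (auto simp: K_def)
  have "P (k n) n" for n using Max_in[OF fin ne, of n] by (auto simp: k_def K_def)
  moreover have "filterlim k at_top sequentially"
    unfolding filterlim_at_top
  proof
    fix Z
    show "eventually (\<lambda>n. Z \<le> k n) sequentially"
      using assms(1)[of Z] eventually_ge_at_top[of Z]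
    proof eventually_elim
      case (elim n)
      then show ?case using Max_ge[OF fin, of Z n] by (simp add: k_def K_def)
    qed
  qed
  ultimately show ?thesis using that by blast
qed

context cstar_seminormed_algebra
begin

lemma seq_class_minus:
  assumes "x \<in> carrier (linf A)" "y \<in> carrier (linf A)"
  shows "seq_class A x \<ominus>\<^bsub>seq_algebra A\<^esub> seq_class A y = seq_class A (\<lambda>n. x n \<ominus> y n)"
proof -
  interpret S: cstar_seminormed_algebra "seq_algebra A" by (rule cstar_seminormed_seq_algebra)
  show ?thesis using assms
    by (simp add: S.minus_eq S.minus_smult seq_class_ops) (simp add: minus_eq minus_smult)
qed

text \<open>
  The limit is represented by a diagonal sequence: its \<open>n\<close>-th term is that of the
  \<open>k(n)\<close>-th among the representatives of the given classes. Here \<open>k(n)\<close>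
  tends to infinity so slowly that the \<open>n\<close>-th terms of the first \<open>k(n)\<close>
  representatives are about as close to each other as their classes are.
\<close>

lemma seq_algebra_complete:
  assumes X: "\<And>i. X i \<in> carrier (seq_algebra A)"
    and cauchy: "\<And>\<epsilon>. \<epsilon> > 0 \<Longrightarrow> \<exists>N. \<forall>i\<ge>N. \<forall>j\<ge>N. \<parallel>X i \<ominus>\<^bsub>seq_algebra A\<^esub> X j\<parallel>\<^bsub>seq_algebra A\<^esub> < \<epsilon>"
  shows "\<exists>Z\<in>carrier (seq_algebra A). (\<lambda>i. \<parallel>X i \<ominus>\<^bsub>seq_algebra A\<^esub> Z\<parallel>\<^bsub>seq_algebra A\<^esub>) \<longlonglongrightarrow> 0"
proof -
  interpret S: cstar_seminormed_algebra "seq_algebra A" by (rule cstar_seminormed_seq_algebra)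
  have "\<exists>x. \<forall>i. x i \<in> carrier (linf A) \<and> X i = seq_class A (x i)"
    using X by (intro choice) (meson seq_algebra_cases)
  then obtain x where x: "\<And>i. x i \<in> carrier (linf A)" and Xx: "\<And>i. X i = seq_class A (x i)" by blast
  let ?D = "\<lambda>i j. \<parallel>X i \<ominus>\<^bsub>seq_algebra A\<^esub> X j\<parallel>\<^bsub>seq_algebra A\<^esub>"
  have D: "?D i j = \<parallel>seq_class A (\<lambda>n. x i n \<ominus> x j n)\<parallel>\<^bsub>seq_algebra A\<^esub>" for i j
    by (simp add: Xx seq_class_minus x)
  define P where "P k n \<longleftrightarrow> (\<forall>i\<le>k. \<forall>j\<le>k. \<parallel>x i n \<ominus> x j n\<parallel> \<le> ?D i j + 1 / (real k + 1))" for k n :: nat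
  obtain k where k: "filterlim k at_top sequentially" and Pk: "\<And>n. P (k n) n"
  proof (rule eventually_diagonal[of P])
    fix k
    have *: "eventually (\<lambda>n. \<parallel>x i n \<ominus> x j n\<parallel> \<le> ?D i j + 1 / (real k + 1)) sequentially" for i j
      by (rule eventually_mono[OF nrm_seq_class_less[where x = "\<lambda>n. x i n \<ominus> x j n" and c = "?D i j + 1 / (real k + 1)"]])
         (auto simp: D x)
    have "eventually (\<lambda>n. \<forall>i\<in>{..k}. \<forall>j\<in>{..k}. \<parallel>x i n \<ominus> x j n\<parallel> \<le> ?D i j + 1 / (real k + 1)) sequentially"
      by (intro eventually_ball_finite ballI *) auto
    then show "eventually (P k) sequentially" by (rule eventually_mono) (auto simp: P_def)
  next
    show "P 0 n" for n using x X by (simp add: P_def)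
  qed blast
  define z where "z n = x (k n) n" for n
  have key: "\<exists>N. \<forall>i\<ge>N. eventually (\<lambda>n. \<parallel>x i n \<ominus> z n\<parallel> \<le> \<epsilon>) sequentially" if e: "\<epsilon> > 0" for \<epsilon>
  proof -
    obtain N where N: "\<And>i j. \<lbrakk>i \<ge> N; j \<ge> N\<rbrakk> \<Longrightarrow> ?D i j < \<epsilon> / 2" using cauchy[of "\<epsilon> / 2"] e by auto
    obtain M :: nat where M: "1 / (real M + 1) < \<epsilon> / 2"
      using reals_Archimedean[of "\<epsilon> / 2"] e by (auto simp: inverse_eq_divide add.commute)
    have "eventually (\<lambda>n. \<parallel>x i n \<ominus> z n\<parallel> \<le> \<epsilon>) sequentially" if i: "i \<ge> N" for i
    proof -
      have "eventually (\<lambda>n. k n \<ge> i \<and> k n \<ge> M) sequentially"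
        using k by (simp add: filterlim_at_top eventually_conj)
      then show ?thesis
      proof (rule eventually_mono)
        fix n assume kn: "k n \<ge> i \<and> k n \<ge> M"
        have "\<parallel>x i n \<ominus> z n\<parallel> \<le> ?D i (k n) + 1 / (real (k n) + 1)"
          using Pk[of n] kn unfolding P_def z_def by blast
        also have "1 / (real (k n) + 1) \<le> 1 / (real M + 1)" using kn by (intro divide_left_mono) auto
        also have "?D i (k n) < \<epsilon> / 2" using N i kn by simp
        finally show "\<parallel>x i n \<ominus> z n\<parallel> \<le> \<epsilon>" using M by simp
      qed
    qed
    then show ?thesis by blast
  qed
  have z: "z \<in> carrier (linf A)"
  proof -
    obtain N where N: "\<And>i j. \<lbrakk>i \<ge> N; j \<ge> N\<rbrakk> \<Longrightarrow> ?D i j < 1" using cauchy[of 1] by auto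
    define C where "C = 1 + (\<Sum>i\<le>N. ?D i N)"
    have DC: "?D i N + 1 \<le> C + 1" for i
    proof (cases "i \<le> N")
      case True
      then have "?D i N \<le> (\<Sum>i\<le>N. ?D i N)" using X by (intro member_le_sum) auto
      then show ?thesis by (simp add: C_def)
    next
      case False
      then have "?D i N < 1" using N[of i N] by simp
      moreover have "0 \<le> (\<Sum>i\<le>N. ?D i N)" using X by (intro sum_nonneg) auto
      ultimately show ?thesis by (simp add: C_def)
    qed
    have bdd: "\<exists>B. \<forall>n. \<parallel>x i n\<parallel> \<le> B" for i using x[of i] by (simp add: mem_linf)
    then obtain B where B: "\<And>i n. \<parallel>x i n\<parallel> \<le> B i" by metis
    define B' where "B' = (\<Sum>i\<le>N. \<bar>B i\<bar>)"
    have BB: "\<parallel>x i n\<parallel> \<le> B'" if "i \<le> N" for i n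
    proof -
      have "\<bar>B i\<bar> \<le> B'" unfolding B'_def using that by (intro member_le_sum) auto
      then show ?thesis using B[of i n] by linarith
    qed
    have "\<parallel>z n\<parallel> \<le> B' + (C + 1)" for n
    proof (cases "k n \<le> N")
      case True
      have "0 \<le> C" using X by (auto simp: C_def intro!: add_nonneg_nonneg sum_nonneg)
      then show ?thesis using BB[OF True, of n] by (simp add: z_def)
    next
      case False
      have "\<parallel>z n \<ominus> x N n\<parallel> \<le> ?D (k n) N + 1 / (real (k n) + 1)"
        using Pk[of n] False unfolding P_def z_def by simp
      also have "\<dots> \<le> ?D (k n) N + 1" by simp
      also have "\<dots> \<le> C + 1" by (rule DC)
      finally show ?thesis
        using nrm_le_diff[of "z n" "x N n"] BB[of N n] x by (simp add: z_def)
    qed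
    then show ?thesis using x by (auto simp: mem_linf z_def)
  qed
  show ?thesis
  proof (intro bexI[of _ "seq_class A z"] LIMSEQ_I)
    fix \<epsilon> :: real assume e: "\<epsilon> > 0"
    then obtain N where N: "\<And>i. i \<ge> N \<Longrightarrow> eventually (\<lambda>n. \<parallel>x i n \<ominus> z n\<parallel> \<le> \<epsilon> / 2) sequentially"
      using key[of "\<epsilon> / 2"] by auto
    have "\<parallel>X i \<ominus>\<^bsub>seq_algebra A\<^esub> seq_class A z\<parallel>\<^bsub>seq_algebra A\<^esub> \<le> \<epsilon> / 2" if "i \<ge> N" for i
      unfolding Xx seq_class_minus[OF x z] by (rule nrm_seq_class_le[OF _ _ N[OF that]]) (use e x z in simp_all)
    moreover have "0 \<le> \<parallel>X i \<ominus>\<^bsub>seq_algebra A\<^esub> seq_class A z\<parallel>\<^bsub>seq_algebra A\<^esub>" for i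
      using X z by simp
    ultimately show "\<exists>N. \<forall>i\<ge>N. norm (\<parallel>X i \<ominus>\<^bsub>seq_algebra A\<^esub> seq_class A z\<parallel>\<^bsub>seq_algebra A\<^esub> - 0) < \<epsilon>"
      using e by (intro exI[of _ N]) (force simp: abs_of_nonneg)
  qed (simp add: z)
qed

lemma seq_algebra_metric: "Metric_space (carrier (seq_algebra A)) (cstar_dist (seq_algebra A))"
proof -
  interpret S: cstar_seminormed_algebra "seq_algebra A" by (rule cstar_seminormed_seq_algebra)
  show ?thesis
    by (rule S.metric_if_definite[OF nrm_seq_class_definite])
qed

theorem cstar_algebra_seq_algebra: "cstar_algebra (seq_algebra A)"
proof -
  interpret S: cstar_seminormed_algebra "seq_algebra A" by (rule cstar_seminormed_seq_algebra)
  interpret M: Metric_space "carrier (seq_algebra A)" "cstar_dist (seq_algebra A)" by (rule seq_algebra_metric)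
  have "M.mcomplete"
    unfolding M.mcomplete_def M.MCauchy_def
  proof (intro allI impI, elim conjE)
    fix X :: "nat \<Rightarrow> (nat \<Rightarrow> 'a) set" assume X: "range X \<subseteq> carrier (seq_algebra A)"
      and C: "\<forall>\<epsilon>>0. \<exists>N. \<forall>n n'. N \<le> n \<longrightarrow> N \<le> n' \<longrightarrow> cstar_dist (seq_algebra A) (X n) (X n') < \<epsilon>"
    have Xi: "X i \<in> carrier (seq_algebra A)" for i using X by auto
    obtain Z where "Z \<in> carrier (seq_algebra A)" "(\<lambda>i. \<parallel>X i \<ominus>\<^bsub>seq_algebra A\<^esub> Z\<parallel>\<^bsub>seq_algebra A\<^esub>) \<longlonglongrightarrow> 0"
      using seq_algebra_complete[of X] Xi C unfolding cstar_dist_def by (simp, meson)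
    then show "\<exists>Z. limitin M.mtopology X Z sequentially"
      using Xi unfolding M.limitin_metric_dist_null by (auto simp: cstar_dist_def)
  qed
  then show ?thesis
    by (intro cstar_algebra.intro[OF S.star_algebra_axioms] cstar_algebra_axioms.intro S.nrm_cstar_seminorm)
       (erule (1) nrm_seq_class_definite)
qed

text \<open>
  Shrinking the \<open>n\<close>-th term \<open>y\<^sub>n\<close> of a representative to norm at
  most 1 moves it by \<open>max 0 (\<parallel>y\<^sub>n\<parallel> - 1)\<close>, which tends to 0.
\<close>

lemma contractive_representative:
  assumes "X \<in> carrier (seq_algebra A)" "\<parallel>X\<parallel>\<^bsub>seq_algebra A\<^esub> \<le> 1"
  obtains x where "x \<in> carrier (linf A)" "X = seq_class A x" "\<And>n. \<parallel>x n\<parallel> \<le> 1"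
proof -
  obtain y where y: "y \<in> carrier (linf A)" and X: "X = seq_class A y" using assms(1) by (rule seq_algebra_cases)
  note yn [simp] = linfD[OF y]
  define c where "c n = 1 / max 1 \<parallel>y n\<parallel>" for n
  have c: "0 < c n" "c n \<le> 1" for n by (auto simp: c_def)
  define x where "x n = complex_of_real (c n) \<odot> y n" for n
  have nx: "\<parallel>x n\<parallel> \<le> 1" for n using c[of n] by (simp add: x_def nrm_smult) (simp add: c_def)
  have x: "x \<in> carrier (linf A)" unfolding mem_linf using nx by (auto simp: x_def)
  have "\<parallel>y n \<ominus> x n\<parallel> = max 0 (\<parallel>y n\<parallel> - 1)" for n
  proof -
    have "y n \<ominus> x n = complex_of_real (1 - c n) \<odot> y n"
      using smult_add_left[of "y n" 1 "- complex_of_real (c n)"]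
      by (simp add: x_def minus_eq minus_smult smult_smult)
    then have "\<parallel>y n \<ominus> x n\<parallel> = (1 - c n) * \<parallel>y n\<parallel>"
      using c[of n] by (simp add: nrm_smult del: of_real_diff)
    also have "\<dots> = max 0 (\<parallel>y n\<parallel> - 1)" by (auto simp: c_def max_def field_simps)
    finally show ?thesis .
  qed
  moreover have "(\<lambda>n. max 0 (\<parallel>y n\<parallel> - 1)) \<longlonglongrightarrow> 0"
  proof (rule order_tendstoI)
    fix a :: real assume "0 < a"
    then show "eventually (\<lambda>n. max 0 (\<parallel>y n\<parallel> - 1) < a) sequentially"
      using nrm_seq_class_less[OF y, of "1 + a"] assms(2) unfolding X by (auto elim!: eventually_mono)
  qed (auto intro!: always_eventually)
  ultimately have "null_diff y x" by (simp add: null_diff_def)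
  then have "X = seq_class A x" using x y by (simp add: X seq_class_eq_iff)
  then show ?thesis using that x nx by blast
qed

end

section \<open>Dynamical systems and covariant families\<close>

context star_algebra
begin

lemma mult_diff_right: "\<lbrakk>u \<in> carrier A; a \<in> carrier A; b \<in> carrier A\<rbrakk> \<Longrightarrow> u \<otimes> (a \<ominus> b) = u \<otimes> a \<ominus> u \<otimes> b"
  and mult_diff_left: "\<lbrakk>u \<in> carrier A; a \<in> carrier A; b \<in> carrier A\<rbrakk> \<Longrightarrow> (a \<ominus> b) \<otimes> u = a \<otimes> u \<ominus> b \<otimes> u"
  by (simp_all add: minus_eq distrib_left distrib_right)

lemma diff_diff_swap:
  "\<lbrakk>p \<in> carrier A; q \<in> carrier A; r \<in> carrier A; s \<in> carrier A\<rbrakk> \<Longrightarrow> (p \<ominus> q) \<ominus> (r \<ominus> s) = (p \<ominus> r) \<ominus> (q \<ominus> s)"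
  by (simp add: minus_eq minus_add a_ac)

end

locale cstar_dynamical_system = cstar_algebra A + H: group H
  for A :: "'a cstar_struct" (structure) and H :: "('h, 'm) monoid_scheme" +
  fixes \<alpha> :: "'h \<Rightarrow> 'a \<Rightarrow> 'a"
  assumes action: "cstar_action H A \<alpha>"
begin

lemma act_hom: "h \<in> carrier H \<Longrightarrow> star_hom A A (\<alpha> h)"
  using action by (simp add: cstar_action_def)

lemma act_group_action: "group_action H (carrier A) \<alpha>"
  using action by (simp add: cstar_action_def)

lemma act_closed [simp]: "\<lbrakk>h \<in> carrier H; a \<in> carrier A\<rbrakk> \<Longrightarrow> \<alpha> h a \<in> carrier A"
  by (rule star_homD(1)[OF act_hom])

lemma act_add: "\<lbrakk>h \<in> carrier H; a \<in> carrier A; b \<in> carrier A\<rbrakk> \<Longrightarrow> \<alpha> h (a \<oplus> b) = \<alpha> h a \<oplus> \<alpha> h b"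
  and act_smult: "\<lbrakk>h \<in> carrier H; a \<in> carrier A\<rbrakk> \<Longrightarrow> \<alpha> h (c \<odot> a) = c \<odot> \<alpha> h a"
  and act_mult: "\<lbrakk>h \<in> carrier H; a \<in> carrier A; b \<in> carrier A\<rbrakk> \<Longrightarrow> \<alpha> h (a \<otimes> b) = \<alpha> h a \<otimes> \<alpha> h b"
  and act_adj: "\<lbrakk>h \<in> carrier H; a \<in> carrier A\<rbrakk> \<Longrightarrow> \<alpha> h (a\<^sup>\<star>) = (\<alpha> h a)\<^sup>\<star>"
  and act_minus: "\<lbrakk>h \<in> carrier H; a \<in> carrier A; b \<in> carrier A\<rbrakk> \<Longrightarrow> \<alpha> h (a \<ominus> b) = \<alpha> h a \<ominus> \<alpha> h b"
  and act_zero [simp]: "h \<in> carrier H \<Longrightarrow> \<alpha> h \<zero> = \<zero>"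
  using star_homD[OF act_hom] star_hom_minus[OF star_algebra_axioms star_algebra_axioms act_hom]
    star_hom_zero[OF star_algebra_axioms star_algebra_axioms act_hom] by auto

lemmas act_ops = act_add act_smult act_mult act_adj act_minus

lemma act_act: "\<lbrakk>g \<in> carrier H; h \<in> carrier H; a \<in> carrier A\<rbrakk> \<Longrightarrow> \<alpha> g (\<alpha> h a) = \<alpha> (g \<otimes>\<^bsub>H\<^esub> h) a"
  using group_action.composition_rule[OF act_group_action] by simp

lemma act_one [simp]: "a \<in> carrier A \<Longrightarrow> \<alpha> \<one>\<^bsub>H\<^esub> a = a"
  using group_action.id_eq_one[OF act_group_action] by (metis restrict_apply')

lemma act_inv [simp]:
  assumes "h \<in> carrier H" "a \<in> carrier A"
  shows "\<alpha> h (\<alpha> (inv\<^bsub>H\<^esub> h) a) = a" "\<alpha> (inv\<^bsub>H\<^esub> h) (\<alpha> h a) = a"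
  using assms by (simp_all add: act_act)

lemma act_nrm [simp]:
  assumes "h \<in> carrier H" "a \<in> carrier A" shows "\<parallel>\<alpha> h a\<parallel> = \<parallel>a\<parallel>"
proof -
  have le: "\<parallel>\<alpha> h a\<parallel> \<le> \<parallel>a\<parallel>" if "h \<in> carrier H" "a \<in> carrier A" for h a
    using that by (intro star_hom_contractive[OF cstar_algebra_axioms cstar_seminormed_algebra_axioms act_hom])
  show ?thesis using le[OF assms] le[of "inv\<^bsub>H\<^esub> h" "\<alpha> h a"] assms by simp
qed

abbreviation S :: "(nat \<Rightarrow> 'a) set cstar_struct" where "S \<equiv> seq_algebra A"
abbreviation \<sigma> :: "'h \<Rightarrow> (nat \<Rightarrow> 'a) set \<Rightarrow> (nat \<Rightarrow> 'a) set" where "\<sigma> \<equiv> seq_action A \<alpha>"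
abbreviation \<kappa> :: "'a \<Rightarrow> (nat \<Rightarrow> 'a) set" where "\<kappa> \<equiv> const_seq A"

sublocale S: cstar_algebra S
  by (rule cstar_algebra_seq_algebra)

lemma const_ops:
  assumes "a \<in> carrier A"
  shows "\<kappa> a \<in> carrier S"
    and "b \<in> carrier A \<Longrightarrow> \<kappa> (a \<oplus> b) = \<kappa> a \<oplus>\<^bsub>S\<^esub> \<kappa> b"
    and "b \<in> carrier A \<Longrightarrow> \<kappa> (a \<otimes> b) = \<kappa> a \<otimes>\<^bsub>S\<^esub> \<kappa> b"
    and "b \<in> carrier A \<Longrightarrow> \<kappa> (a \<ominus> b) = \<kappa> a \<ominus>\<^bsub>S\<^esub> \<kappa> b"
    and "\<kappa> (c \<odot> a) = c \<odot>\<^bsub>S\<^esub> \<kappa> a"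
    and "\<kappa> (a\<^sup>\<star>) = (\<kappa> a)\<^sup>\<star>\<^bsub>S\<^esub>"
  using assms by (simp_all add: const_seq_def seq_class_ops seq_class_minus)

declare const_ops(1) [simp]

lemma linf_act [simp]: "\<lbrakk>h \<in> carrier H; x \<in> carrier (linf A)\<rbrakk> \<Longrightarrow> (\<lambda>n. \<alpha> h (x n)) \<in> carrier (linf A)"
  by (auto simp: mem_linf)

lemma seq_action_class:
  assumes "h \<in> carrier H" "x \<in> carrier (linf A)"
  shows "\<sigma> h (seq_class A x) = seq_class A (\<lambda>n. \<alpha> h (x n))"
  using assms coset_map_seq_class[of x "\<lambda>x n. \<alpha> h (x n)"]
  by (simp add: seq_action_def null_diff_def act_minus[symmetric])

lemma seq_action_closed [simp]: "\<lbrakk>h \<in> carrier H; X \<in> carrier S\<rbrakk> \<Longrightarrow> \<sigma> h X \<in> carrier S"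
  by (elim seq_algebra_cases) (simp add: seq_action_class)

lemma seq_action_ops:
  assumes "h \<in> carrier H" "X \<in> carrier S"
  shows "Y \<in> carrier S \<Longrightarrow> \<sigma> h (X \<oplus>\<^bsub>S\<^esub> Y) = \<sigma> h X \<oplus>\<^bsub>S\<^esub> \<sigma> h Y"
    and "Y \<in> carrier S \<Longrightarrow> \<sigma> h (X \<otimes>\<^bsub>S\<^esub> Y) = \<sigma> h X \<otimes>\<^bsub>S\<^esub> \<sigma> h Y"
    and "Y \<in> carrier S \<Longrightarrow> \<sigma> h (X \<ominus>\<^bsub>S\<^esub> Y) = \<sigma> h X \<ominus>\<^bsub>S\<^esub> \<sigma> h Y"
    and "\<sigma> h (c \<odot>\<^bsub>S\<^esub> X) = c \<odot>\<^bsub>S\<^esub> \<sigma> h X"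
    and "\<sigma> h (X\<^sup>\<star>\<^bsub>S\<^esub>) = (\<sigma> h X)\<^sup>\<star>\<^bsub>S\<^esub>"
    and "g \<in> carrier H \<Longrightarrow> \<sigma> g (\<sigma> h X) = \<sigma> (g \<otimes>\<^bsub>H\<^esub> h) X"
    and "\<sigma> \<one>\<^bsub>H\<^esub> X = X"
  using assms
  by (auto elim!: seq_algebra_cases simp: seq_class_ops seq_class_minus seq_action_class act_ops act_act)

lemma seq_action_const [simp]: "\<lbrakk>h \<in> carrier H; a \<in> carrier A\<rbrakk> \<Longrightarrow> \<sigma> h (\<kappa> a) = \<kappa> (\<alpha> h a)"
  by (simp add: const_seq_def seq_action_class)

lemma seq_action_inv [simp]:
  assumes "h \<in> carrier H" "X \<in> carrier S"
  shows "\<sigma> h (\<sigma> (inv\<^bsub>H\<^esub> h) X) = X" "\<sigma> (inv\<^bsub>H\<^esub> h) (\<sigma> h X) = X"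
  using assms by (simp_all add: seq_action_ops)

lemma seq_action_zero [simp]: "h \<in> carrier H \<Longrightarrow> \<sigma> h \<zero>\<^bsub>S\<^esub> = \<zero>\<^bsub>S\<^esub>"
  using seq_action_ops(4)[of h "\<zero>\<^bsub>S\<^esub>" 0] by simp

lemma seq_action_hom: "h \<in> carrier H \<Longrightarrow> star_hom S S (\<sigma> h)"
  by (simp add: star_hom_def seq_action_ops)

lemma seq_action_nrm_le: "\<lbrakk>h \<in> carrier H; X \<in> carrier S\<rbrakk> \<Longrightarrow> \<parallel>\<sigma> h X\<parallel>\<^bsub>S\<^esub> \<le> \<parallel>X\<parallel>\<^bsub>S\<^esub>"
  by (rule star_hom_contractive[OF S.cstar_algebra_axioms S.cstar_seminormed_algebra_axioms seq_action_hom])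

text \<open>
  \<open>Y h a\<close> stands for \<open>a w\<^sub>h\<close>, where
  \<open>w\<^sub>h a = \<alpha>\<^sub>h(a) w\<^sub>h\<close> and \<open>w\<close> is a unitary
  representation. The first five clauses are the relations of the elements
  \<open>a \<delta>\<^sub>h\<close> of \<open>C\<^sub>c(H, A)\<close>.
\<close>

definition covariant_family :: "('h \<Rightarrow> 'a \<Rightarrow> (nat \<Rightarrow> 'a) set) \<Rightarrow> bool" where
  "covariant_family Y \<longleftrightarrow>
    (\<forall>h\<in>carrier H. \<forall>a\<in>carrier A. Y h a \<in> carrier S) \<and>
    (\<forall>h\<in>carrier H. \<forall>a\<in>carrier A. \<forall>b\<in>carrier A. Y h (a \<oplus> b) = Y h a \<oplus>\<^bsub>S\<^esub> Y h b) \<and>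
    (\<forall>h\<in>carrier H. \<forall>a\<in>carrier A. \<forall>c. Y h (c \<odot> a) = c \<odot>\<^bsub>S\<^esub> Y h a) \<and>
    (\<forall>g\<in>carrier H. \<forall>h\<in>carrier H. \<forall>a\<in>carrier A. \<forall>b\<in>carrier A.
      Y g a \<otimes>\<^bsub>S\<^esub> Y h b = Y (g \<otimes>\<^bsub>H\<^esub> h) (a \<otimes> \<alpha> g b)) \<and>
    (\<forall>h\<in>carrier H. \<forall>a\<in>carrier A. (Y h a)\<^sup>\<star>\<^bsub>S\<^esub> = Y (inv\<^bsub>H\<^esub> h) (\<alpha> (inv\<^bsub>H\<^esub> h) (a\<^sup>\<star>))) \<and>
    (\<forall>g\<in>carrier H. \<forall>h\<in>carrier H. \<forall>a\<in>carrier A.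
      \<sigma> g (Y h a) = Y (g \<otimes>\<^bsub>H\<^esub> h \<otimes>\<^bsub>H\<^esub> inv\<^bsub>H\<^esub> g) (\<alpha> g a)) \<and>
    (\<forall>a\<in>carrier A. Y \<one>\<^bsub>H\<^esub> a = \<kappa> a)"

text \<open>
  The expressions in \<open>a\<close> whose norms tend to 0 in the definition of approximate
  representability, with \<open>x\<close> in the role of the \<open>n\<close>-th family. They are
  collected in a list because the same three steps treat them all: they are bounded and additive in
  \<open>a\<close>, it suffices to control them for finitely many \<open>(a, g, h)\<close> at a
  time, and for \<open>x\<close> coming from a covariant family they can be computed in
  \<open>A\<close>.
\<close>

definition defect_ops :: "('h \<Rightarrow> 'a) \<Rightarrow> 'h \<Rightarrow> 'h \<Rightarrow> ('a \<Rightarrow> 'a) list" where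
  "defect_ops x g h =
    [\<lambda>a. x h \<otimes> (x h)\<^sup>\<star> \<otimes> a \<ominus> a, \<lambda>a. a \<otimes> (x h \<otimes> (x h)\<^sup>\<star>) \<ominus> a,
     \<lambda>a. (x h)\<^sup>\<star> \<otimes> x h \<otimes> a \<ominus> a, \<lambda>a. a \<otimes> ((x h)\<^sup>\<star> \<otimes> x h) \<ominus> a,
     \<lambda>a. a \<otimes> (x g \<otimes> x h \<ominus> x (g \<otimes>\<^bsub>H\<^esub> h)), \<lambda>a. (x g \<otimes> x h \<ominus> x (g \<otimes>\<^bsub>H\<^esub> h)) \<otimes> a,
     \<lambda>a. \<alpha> h a \<ominus> x h \<otimes> a \<otimes> (x h)\<^sup>\<star>,
     \<lambda>a. a \<otimes> (x (g \<otimes>\<^bsub>H\<^esub> h \<otimes>\<^bsub>H\<^esub> inv\<^bsub>H\<^esub> g) \<ominus> \<alpha> g (x h)),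
     \<lambda>a. (x (g \<otimes>\<^bsub>H\<^esub> h \<otimes>\<^bsub>H\<^esub> inv\<^bsub>H\<^esub> g) \<ominus> \<alpha> g (x h)) \<otimes> a]"

lemma length_defect_ops [simp]: "length (defect_ops x g h) = 9"
  by (simp add: defect_ops_def)

lemma nrm_mult_le_one:
  assumes "x \<in> carrier A" "y \<in> carrier A" "\<parallel>x\<parallel> \<le> 1" "\<parallel>y\<parallel> \<le> 1" shows "\<parallel>x \<otimes> y\<parallel> \<le> 1"
proof -
  have "\<parallel>x\<parallel> * \<parallel>y\<parallel> \<le> 1" using assms by (intro mult_le_one) auto
  then show ?thesis using nrm_mult[OF assms(1,2)] by linarith
qed

lemma nrm_mult_le_left: "\<lbrakk>x \<in> carrier A; a \<in> carrier A; \<parallel>x\<parallel> \<le> C\<rbrakk> \<Longrightarrow> \<parallel>x \<otimes> a\<parallel> \<le> C * \<parallel>a\<parallel>"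
  by (rule order_trans[OF nrm_mult]) (auto intro: mult_right_mono)

lemma nrm_mult_le_right: "\<lbrakk>x \<in> carrier A; a \<in> carrier A; \<parallel>x\<parallel> \<le> C\<rbrakk> \<Longrightarrow> \<parallel>a \<otimes> x\<parallel> \<le> C * \<parallel>a\<parallel>"
  using mult_left_mono[of "\<parallel>x\<parallel>" C "\<parallel>a\<parallel>"] nrm_mult[of a x] by (simp add: mult.commute)

lemma defect_ops_bounded_additive:
  assumes x: "\<And>h. h \<in> carrier H \<Longrightarrow> x h \<in> carrier A" "\<And>h. h \<in> carrier H \<Longrightarrow> \<parallel>x h\<parallel> \<le> 1"
    and g [simp]: "g \<in> carrier H" and h [simp]: "h \<in> carrier H" and T: "T \<in> set (defect_ops x g h)"
  shows "a \<in> carrier A \<Longrightarrow> T a \<in> carrier A"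
    and "\<lbrakk>a \<in> carrier A; b \<in> carrier A\<rbrakk> \<Longrightarrow> T (a \<ominus> b) = T a \<ominus> T b"
    and "a \<in> carrier A \<Longrightarrow> \<parallel>T a\<parallel> \<le> 2 * \<parallel>a\<parallel>"
proof -
  let ?k = "g \<otimes>\<^bsub>H\<^esub> h \<otimes>\<^bsub>H\<^esub> inv\<^bsub>H\<^esub> g"
  have c [simp]: "x g \<in> carrier A" "x h \<in> carrier A" "x (g \<otimes>\<^bsub>H\<^esub> h) \<in> carrier A" "x ?k \<in> carrier A"
    using x(1) by simp_all
  show "T a \<in> carrier A" if "a \<in> carrier A" using T that by (auto simp: defect_ops_def)
  show "T (a \<ominus> b) = T a \<ominus> T b" if [simp]: "a \<in> carrier A" "b \<in> carrier A"
  proof -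
    have M: "(p \<ominus> a) \<ominus> (q \<ominus> b) = (p \<ominus> q) \<ominus> (a \<ominus> b)" if "p \<in> carrier A" "q \<in> carrier A" for p q
      using that by (intro diff_diff_swap) auto
    have M': "(\<alpha> h a \<ominus> p) \<ominus> (\<alpha> h b \<ominus> q) = (\<alpha> h a \<ominus> \<alpha> h b) \<ominus> (p \<ominus> q)" if "p \<in> carrier A" "q \<in> carrier A" for p q
      using that by (intro diff_diff_swap) auto
    show ?thesis using T
      unfolding defect_ops_def
      by (simp only: list.set insert_iff empty_iff simp_thms, elim disjE; hypsubst;
          simp add: M M' act_minus mult_diff_right[of _ a b] mult_diff_left[of _ a b]
            mult_diff_left[of "(x h)\<^sup>\<star>" "x h \<otimes> a" "x h \<otimes> b"])
  qed
  show "\<parallel>T a\<parallel> \<le> 2 * \<parallel>a\<parallel>" if a [simp]: "a \<in> carrier A"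
  proof -
    have n: "\<parallel>x g\<parallel> \<le> 1" "\<parallel>x h\<parallel> \<le> 1" "\<parallel>x (g \<otimes>\<^bsub>H\<^esub> h)\<parallel> \<le> 1" "\<parallel>x ?k\<parallel> \<le> 1" using x(2) by simp_all
    have d: "\<parallel>u \<ominus> v\<parallel> \<le> 2" if "u \<in> carrier A" "v \<in> carrier A" "\<parallel>u\<parallel> \<le> 1" "\<parallel>v\<parallel> \<le> 1" for u v
      using nrm_diff_le[of u v] that by linarith
    have e: "\<parallel>u \<ominus> v\<parallel> \<le> 2 * \<parallel>a\<parallel>" if "u \<in> carrier A" "v \<in> carrier A" "\<parallel>u\<parallel> \<le> 1 * \<parallel>a\<parallel>" "\<parallel>v\<parallel> \<le> 1 * \<parallel>a\<parallel>" for u v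
      using nrm_diff_le[of u v] that by linarith
    have xax: "\<parallel>x h \<otimes> a \<otimes> (x h)\<^sup>\<star>\<parallel> \<le> 1 * \<parallel>a\<parallel>"
      using nrm_mult_le_right[of "(x h)\<^sup>\<star>" "x h \<otimes> a" 1] nrm_mult_le_left[of "x h" a 1] n by simp
    have nn: "\<parallel>x h \<otimes> (x h)\<^sup>\<star>\<parallel> \<le> 1" "\<parallel>(x h)\<^sup>\<star> \<otimes> x h\<parallel> \<le> 1" "\<parallel>x g \<otimes> x h\<parallel> \<le> 1" "\<parallel>\<alpha> g (x h)\<parallel> \<le> 1"
      using n by (auto intro!: nrm_mult_le_one)
    show ?thesis using T unfolding defect_ops_def
      by (simp, elim disjE; hypsubst; intro e nrm_mult_le_left nrm_mult_le_right d nn n xax; simp)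
  qed
qed

lemma approximately_representableI:
  assumes x: "\<And>n h. h \<in> carrier H \<Longrightarrow> x n h \<in> carrier A" "\<And>n h. h \<in> carrier H \<Longrightarrow> \<parallel>x n h\<parallel> \<le> 1"
    and T: "\<And>a g h i. \<lbrakk>a \<in> carrier A; g \<in> carrier H; h \<in> carrier H; i < 9\<rbrakk>
      \<Longrightarrow> (\<lambda>n. \<parallel>(defect_ops (x n) g h ! i) a\<parallel>) \<longlonglongrightarrow> 0"
  shows "approximately_representable H A \<alpha>"
  unfolding approximately_representable_def approximate_unit_def
proof (intro exI[of _ x] conjI allI ballI)
  fix h a assume h: "h \<in> carrier H" and a: "a \<in> carrier A"
  note t = T[OF a h h, unfolded defect_ops_def]
  show "(\<lambda>n. \<parallel>x n h \<otimes> (x n h)\<^sup>\<star> \<otimes> a \<ominus> a\<parallel>) \<longlonglongrightarrow> 0" using t[of 0] by simp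
  show "(\<lambda>n. \<parallel>a \<otimes> (x n h \<otimes> (x n h)\<^sup>\<star>) \<ominus> a\<parallel>) \<longlonglongrightarrow> 0" using t[of 1] by simp
  show "(\<lambda>n. \<parallel>(x n h)\<^sup>\<star> \<otimes> x n h \<otimes> a \<ominus> a\<parallel>) \<longlonglongrightarrow> 0" using t[of 2] by simp
  show "(\<lambda>n. \<parallel>a \<otimes> ((x n h)\<^sup>\<star> \<otimes> x n h) \<ominus> a\<parallel>) \<longlonglongrightarrow> 0" using t[of 3] by simp
  show "(\<lambda>n. \<parallel>\<alpha> h a \<ominus> x n h \<otimes> a \<otimes> (x n h)\<^sup>\<star>\<parallel>) \<longlonglongrightarrow> 0" using t[of 6] by simp
next
  fix g h a assume gh: "g \<in> carrier H" "h \<in> carrier H" and a: "a \<in> carrier A"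
  note t = T[OF a gh, unfolded defect_ops_def]
  show "(\<lambda>n. \<parallel>a \<otimes> (x n g \<otimes> x n h \<ominus> x n (g \<otimes>\<^bsub>H\<^esub> h))\<parallel> + \<parallel>(x n g \<otimes> x n h \<ominus> x n (g \<otimes>\<^bsub>H\<^esub> h)) \<otimes> a\<parallel>) \<longlonglongrightarrow> 0"
    using tendsto_add_zero[OF t[of 4] t[of 5]] by simp
  show "(\<lambda>n. \<parallel>a \<otimes> (x n (g \<otimes>\<^bsub>H\<^esub> h \<otimes>\<^bsub>H\<^esub> inv\<^bsub>H\<^esub> g) \<ominus> \<alpha> g (x n h))\<parallel>
      + \<parallel>(x n (g \<otimes>\<^bsub>H\<^esub> h \<otimes>\<^bsub>H\<^esub> inv\<^bsub>H\<^esub> g) \<ominus> \<alpha> g (x n h)) \<otimes> a\<parallel>) \<longlonglongrightarrow> 0"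
    using tendsto_add_zero[OF t[of 7] t[of 8]] by simp
qed (use x in auto)

text \<open>
  The \<open>n\<close>-th family is chosen for the first \<open>n + 1\<close> elements of
  \<open>Q \<times> H \<times> H\<close>, where \<open>Q\<close> is countable and dense in
  \<open>A\<close>; the bound \<open>2 \<parallel>a\<parallel>\<close> for the defects extends the
  convergence from \<open>Q\<close> to \<open>A\<close>.
\<close>

lemma approximately_representable_if_local:
  assumes sep: "separable_space (cstar_topology A)" and count: "countable (carrier H)"
    and loc: "\<And>F \<epsilon>. \<lbrakk>finite F; F \<subseteq> carrier A \<times> carrier H \<times> carrier H; \<epsilon> > 0\<rbrakk> \<Longrightarrow>
      \<exists>x. (\<forall>h\<in>carrier H. x h \<in> carrier A \<and> \<parallel>x h\<parallel> \<le> 1) \<and>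
        (\<forall>(a, g, h)\<in>F. \<forall>i<9. \<parallel>(defect_ops x g h ! i) a\<parallel> < \<epsilon>)"
  shows "approximately_representable H A \<alpha>"
proof -
  interpret M: Metric_space "carrier A" "cstar_dist A" by (rule cstar_dist_metric)
  obtain Q where Q: "countable Q" "Q \<subseteq> carrier A" "M.mtopology closure_of Q = carrier A"
    using sep unfolding separable_space_def cstar_topology_def by auto
  have dense: "\<exists>q\<in>Q. \<parallel>a \<ominus> q\<parallel> < \<epsilon>" if a: "a \<in> carrier A" "\<epsilon> > 0" for a \<epsilon>
  proof -
    have "a \<in> M.mtopology closure_of Q" using a Q(3) by simp
    then obtain q where "q \<in> Q" "q \<in> M.mball a \<epsilon>"
      unfolding M.metric_closure_of using a by blast
    then show ?thesis using Q(2) a by (auto simp: cstar_dist_def)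
  qed
  let ?T = "Q \<times> carrier H \<times> carrier H"
  have ne: "?T \<noteq> {}" using dense[of \<zero> 1] H.one_closed by auto
  have cT: "countable ?T" using Q(1) count by simp
  let ?t = "from_nat_into ?T"
  have tT: "?t ` {..n} \<subseteq> carrier A \<times> carrier H \<times> carrier H" for n
  proof -
    have "?t ` {..n} \<subseteq> ?T" by (intro image_subsetI from_nat_into[OF ne])
    also have "\<dots> \<subseteq> carrier A \<times> carrier H \<times> carrier H" using Q(2) by auto
    finally show ?thesis .
  qed
  define good where "good n x \<longleftrightarrow> (\<forall>h\<in>carrier H. x h \<in> carrier A \<and> \<parallel>x h\<parallel> \<le> 1) \<and>
      (\<forall>(a, g, h)\<in>?t ` {..n}. \<forall>i<9. \<parallel>(defect_ops x g h ! i) a\<parallel> < 1 / (real n + 1))" for n x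
  have "\<exists>x. good n x" for n
    unfolding good_def by (rule loc[OF _ tT]) auto
  then obtain x where good: "\<And>n. good n (x n)" by metis
  have x: "x n h \<in> carrier A" "\<parallel>x n h\<parallel> \<le> 1" if "h \<in> carrier H" for n h
    using good[of n] that by (simp_all add: good_def)
  have small: "\<parallel>(defect_ops (x n) g h ! i) a\<parallel> < 1 / (real n + 1)"
    if "(a, g, h) \<in> ?t ` {..n}" "i < 9" for n a g h i
    using good[of n] that unfolding good_def by blast
  show ?thesis
  proof (rule approximately_representableI[OF x])
    fix a g h and i :: nat assume a: "a \<in> carrier A" and g: "g \<in> carrier H" and h: "h \<in> carrier H" and i: "i < 9"
    define T where "T n = defect_ops (x n) g h ! i" for n
    have Tset: "T n \<in> set (defect_ops (x n) g h)" for n using i by (simp add: T_def)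
    have T1: "T n a \<in> carrier A" if "a \<in> carrier A" for n a
      by (rule defect_ops_bounded_additive(1)[OF _ _ g h Tset that]) (fact x)+
    have T2: "T n (a \<ominus> b) = T n a \<ominus> T n b" if "a \<in> carrier A" "b \<in> carrier A" for n a b
      by (rule defect_ops_bounded_additive(2)[OF _ _ g h Tset that]) (fact x)+
    have T3: "\<parallel>T n a\<parallel> \<le> 2 * \<parallel>a\<parallel>" if "a \<in> carrier A" for n a
      by (rule defect_ops_bounded_additive(3)[OF _ _ g h Tset that]) (fact x)+
    note T = T1 T2 T3
    have "(\<lambda>n. \<parallel>T n a\<parallel>) \<longlonglongrightarrow> 0"
    proof (rule LIMSEQ_I)
      fix \<epsilon> :: real assume e: "\<epsilon> > 0"
      obtain q where q: "q \<in> Q" "\<parallel>a \<ominus> q\<parallel> < \<epsilon> / 4" using dense[OF a, of "\<epsilon> / 4"] e by auto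
      have qc: "q \<in> carrier A" using q Q(2) by auto
      obtain k where k: "?t k = (q, g, h)"
        using from_nat_into_surj[OF cT, of "(q, g, h)"] q g h by auto
      obtain N :: nat where N: "1 / (real N + 1) < \<epsilon> / 2"
        using reals_Archimedean[of "\<epsilon> / 2"] e by (auto simp: inverse_eq_divide add.commute)
      show "\<exists>N. \<forall>n\<ge>N. norm (\<parallel>T n a\<parallel> - 0) < \<epsilon>"
      proof (intro exI[of _ "max k N"] allI impI)
        fix n assume n: "n \<ge> max k N"
        have "(q, g, h) \<in> ?t ` {..n}" using k n by (intro image_eqI[of _ _ k]) auto
        from small[OF this i] have "\<parallel>T n q\<parallel> < 1 / (real n + 1)" by (simp add: T_def)
        also have "\<dots> \<le> 1 / (real N + 1)" using n by (intro divide_left_mono) auto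
        finally have 1: "\<parallel>T n q\<parallel> < \<epsilon> / 2" using N by simp
        have "\<parallel>T n a\<parallel> \<le> \<parallel>T n a \<ominus> T n q\<parallel> + \<parallel>T n q\<parallel>" using T(1) a qc by (intro nrm_le_diff)
        also have "T n a \<ominus> T n q = T n (a \<ominus> q)" using T(2)[OF a qc] by simp
        also have "\<parallel>T n (a \<ominus> q)\<parallel> \<le> 2 * \<parallel>a \<ominus> q\<parallel>" using T(3) a qc by simp
        finally have "\<parallel>T n a\<parallel> < \<epsilon>" using 1 q(2) by linarith
        then show "norm (\<parallel>T n a\<parallel> - 0) < \<epsilon>" using T(1)[OF a, of n] by simp
      qed
    qed
    then show "(\<lambda>n. \<parallel>(defect_ops (x n) g h ! i) a\<parallel>) \<longlonglongrightarrow> 0" by (simp add: T_def)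
  qed
qed

end

section \<open>Approximate representability from a covariant family\<close>

context cstar_dynamical_system
begin

lemma covariant_familyD:
  assumes "covariant_family Y"
  shows "\<lbrakk>h \<in> carrier H; a \<in> carrier A\<rbrakk> \<Longrightarrow> Y h a \<in> carrier S"
    "\<lbrakk>h \<in> carrier H; a \<in> carrier A; b \<in> carrier A\<rbrakk> \<Longrightarrow> Y h (a \<oplus> b) = Y h a \<oplus>\<^bsub>S\<^esub> Y h b"
    "\<lbrakk>h \<in> carrier H; a \<in> carrier A\<rbrakk> \<Longrightarrow> Y h (c \<odot> a) = c \<odot>\<^bsub>S\<^esub> Y h a"
    "\<lbrakk>g \<in> carrier H; h \<in> carrier H; a \<in> carrier A; b \<in> carrier A\<rbrakk>
      \<Longrightarrow> Y g a \<otimes>\<^bsub>S\<^esub> Y h b = Y (g \<otimes>\<^bsub>H\<^esub> h) (a \<otimes> \<alpha> g b)"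
    "\<lbrakk>h \<in> carrier H; a \<in> carrier A\<rbrakk> \<Longrightarrow> (Y h a)\<^sup>\<star>\<^bsub>S\<^esub> = Y (inv\<^bsub>H\<^esub> h) (\<alpha> (inv\<^bsub>H\<^esub> h) (a\<^sup>\<star>))"
    "\<lbrakk>g \<in> carrier H; h \<in> carrier H; a \<in> carrier A\<rbrakk>
      \<Longrightarrow> \<sigma> g (Y h a) = Y (g \<otimes>\<^bsub>H\<^esub> h \<otimes>\<^bsub>H\<^esub> inv\<^bsub>H\<^esub> g) (\<alpha> g a)"
    "a \<in> carrier A \<Longrightarrow> Y \<one>\<^bsub>H\<^esub> a = \<kappa> a"
  using assms by (simp_all add: covariant_family_def)

lemma covariant_family_minus:
  assumes Y: "covariant_family Y" and "h \<in> carrier H" "a \<in> carrier A" "b \<in> carrier A"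
  shows "Y h (a \<ominus> b) = Y h a \<ominus>\<^bsub>S\<^esub> Y h b"
  using assms(2-) by (simp add: minus_eq minus_smult S.minus_eq S.minus_smult covariant_familyD[OF Y])

lemma covariant_family_mult_const:
  assumes Y: "covariant_family Y" and "h \<in> carrier H" "a \<in> carrier A" "b \<in> carrier A"
  shows "Y h a \<otimes>\<^bsub>S\<^esub> \<kappa> b = Y h (a \<otimes> \<alpha> h b)" "\<kappa> b \<otimes>\<^bsub>S\<^esub> Y h a = Y h (b \<otimes> a)"
  using covariant_familyD(4)[OF Y assms(2) H.one_closed assms(3,4)]
    covariant_familyD(4)[OF Y H.one_closed assms(2) assms(4,3)] assms(2-)
  by (simp_all add: covariant_familyD(7)[OF Y])

lemma covariant_family_mult_adj:
  assumes Y: "covariant_family Y" and [simp]: "h \<in> carrier H" "a \<in> carrier A" "b \<in> carrier A"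
  shows "Y h a \<otimes>\<^bsub>S\<^esub> (Y h b)\<^sup>\<star>\<^bsub>S\<^esub> = \<kappa> (a \<otimes> b\<^sup>\<star>)"
    "(Y h a)\<^sup>\<star>\<^bsub>S\<^esub> \<otimes>\<^bsub>S\<^esub> Y h b = \<kappa> (\<alpha> (inv\<^bsub>H\<^esub> h) (a\<^sup>\<star> \<otimes> b))"
  by (simp_all add: covariant_familyD[OF Y] act_mult)

text \<open>
  By the C*-identity, as \<open>Y\<^sub>h(a) Y\<^sub>h(a)*\<close> is the constant sequence
  \<open>a a*\<close>. So norms in the range of \<open>Y\<close> can be computed in
  \<open>A\<close>.
\<close>

lemma covariant_family_nrm:
  assumes Y: "covariant_family Y" and [simp]: "h \<in> carrier H" "a \<in> carrier A"
  shows "\<parallel>Y h a\<parallel>\<^bsub>S\<^esub> = \<parallel>a\<parallel>"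
proof -
  have "\<parallel>Y h a\<parallel>\<^bsub>S\<^esub>\<^sup>2 = \<parallel>a\<parallel>\<^sup>2"
    using S.nrm_cstar'[of "Y h a"] by (simp add: covariant_familyD(1)[OF Y] covariant_family_mult_adj[OF Y] nrm_cstar')
  then show ?thesis by (simp add: power2_eq_iff_nonneg covariant_familyD(1)[OF Y])
qed

lemma act_unit_defect:
  assumes [simp]: "g \<in> carrier H" "e \<in> carrier A" "c \<in> carrier A"
  shows "\<parallel>\<alpha> g e \<otimes> c \<ominus> c\<parallel> = \<parallel>e \<otimes> \<alpha> (inv\<^bsub>H\<^esub> g) c \<ominus> \<alpha> (inv\<^bsub>H\<^esub> g) c\<parallel>"
    "\<parallel>c \<otimes> \<alpha> g e \<ominus> c\<parallel> = \<parallel>\<alpha> (inv\<^bsub>H\<^esub> g) c \<otimes> e \<ominus> \<alpha> (inv\<^bsub>H\<^esub> g) c\<parallel>"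
proof -
  have "\<alpha> g e \<otimes> c \<ominus> c = \<alpha> g (e \<otimes> \<alpha> (inv\<^bsub>H\<^esub> g) c \<ominus> \<alpha> (inv\<^bsub>H\<^esub> g) c)"
    "c \<otimes> \<alpha> g e \<ominus> c = \<alpha> g (\<alpha> (inv\<^bsub>H\<^esub> g) c \<otimes> e \<ominus> \<alpha> (inv\<^bsub>H\<^esub> g) c)"
    by (simp_all add: act_minus act_mult)
  then show "\<parallel>\<alpha> g e \<otimes> c \<ominus> c\<parallel> = \<parallel>e \<otimes> \<alpha> (inv\<^bsub>H\<^esub> g) c \<ominus> \<alpha> (inv\<^bsub>H\<^esub> g) c\<parallel>"
    "\<parallel>c \<otimes> \<alpha> g e \<ominus> c\<parallel> = \<parallel>\<alpha> (inv\<^bsub>H\<^esub> g) c \<otimes> e \<ominus> \<alpha> (inv\<^bsub>H\<^esub> g) c\<parallel>"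
    by simp_all
qed

lemma unit_square_defect:
  assumes [simp]: "e \<in> carrier A" "c \<in> carrier A" and e: "\<parallel>e\<parallel> \<le> 1"
  shows "\<parallel>e \<otimes> e \<otimes> c \<ominus> c\<parallel> \<le> 2 * \<parallel>e \<otimes> c \<ominus> c\<parallel>" "\<parallel>c \<otimes> (e \<otimes> e) \<ominus> c\<parallel> \<le> 2 * \<parallel>c \<otimes> e \<ominus> c\<parallel>"
proof -
  have "e \<otimes> e \<otimes> c \<ominus> c = e \<otimes> (e \<otimes> c \<ominus> c) \<oplus> (e \<otimes> c \<ominus> c)"
    "c \<otimes> (e \<otimes> e) \<ominus> c = (c \<otimes> e \<ominus> c) \<otimes> e \<oplus> (c \<otimes> e \<ominus> c)"
    using assms(1,2) by algebra+
  moreover have "\<parallel>e \<otimes> (e \<otimes> c \<ominus> c)\<parallel> \<le> 1 * \<parallel>e \<otimes> c \<ominus> c\<parallel>" "\<parallel>(c \<otimes> e \<ominus> c) \<otimes> e\<parallel> \<le> 1 * \<parallel>c \<otimes> e \<ominus> c\<parallel>"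
    using e by (intro nrm_mult_le_left nrm_mult_le_right; simp)+
  ultimately show "\<parallel>e \<otimes> e \<otimes> c \<ominus> c\<parallel> \<le> 2 * \<parallel>e \<otimes> c \<ominus> c\<parallel>" "\<parallel>c \<otimes> (e \<otimes> e) \<ominus> c\<parallel> \<le> 2 * \<parallel>c \<otimes> e \<ominus> c\<parallel>"
    using nrm_triangle[of "e \<otimes> (e \<otimes> c \<ominus> c)" "e \<otimes> c \<ominus> c"] nrm_triangle[of "(c \<otimes> e \<ominus> c) \<otimes> e" "c \<otimes> e \<ominus> c"]
    by simp_all
qed

text \<open>
  For \<open>x\<^sub>h = Y\<^sub>h(e)\<close> every defect is \<open>Y\<^sub>k(b)\<close> for some
  \<open>k\<close> in \<open>H\<close> and \<open>b\<close> in \<open>A\<close> (a constant sequence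
  if \<open>k = 1\<close>), and \<open>\<parallel>b\<parallel>\<close> is bounded by at most three
  of the unit defects of \<open>e\<close> at the listed translates of \<open>a\<close>. Translates
  occur because \<open>\<alpha>\<^sub>g(e)\<close> is a unit for \<open>a\<close> to the same extent
  as \<open>e\<close> is one for \<open>\<alpha>\<^sub>g\<^sup>-\<^sup>1(a)\<close>.
\<close>

lemma covariant_family_defects:
  assumes Y: "covariant_family Y" and g [simp]: "g \<in> carrier H" and h [simp]: "h \<in> carrier H"
    and a [simp]: "a \<in> carrier A" and e [simp]: "e \<in> carrier A" and esa: "e\<^sup>\<star> = e" and e1: "\<parallel>e\<parallel> \<le> 1"
    and unit: "\<And>s. s \<in> {a, \<alpha> h a, \<alpha> (inv\<^bsub>H\<^esub> g) a, \<alpha> (inv\<^bsub>H\<^esub> g) (\<alpha> (g \<otimes>\<^bsub>H\<^esub> h) a),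
        \<alpha> (g \<otimes>\<^bsub>H\<^esub> h \<otimes>\<^bsub>H\<^esub> inv\<^bsub>H\<^esub> g) a, \<alpha> (inv\<^bsub>H\<^esub> g) (\<alpha> (g \<otimes>\<^bsub>H\<^esub> h \<otimes>\<^bsub>H\<^esub> inv\<^bsub>H\<^esub> g) a)}
      \<Longrightarrow> \<parallel>e \<otimes> s \<ominus> s\<parallel> < \<delta> \<and> \<parallel>s \<otimes> e \<ominus> s\<parallel> < \<delta>"
    and y: "\<And>h. h \<in> carrier H \<Longrightarrow> y h \<in> carrier (linf A)" "\<And>h. h \<in> carrier H \<Longrightarrow> Y h e = seq_class A (y h)"
    and i: "i < 9"
  shows "\<parallel>seq_class A (\<lambda>n. (defect_ops (\<lambda>h. y h n) g h ! i) a)\<parallel>\<^bsub>S\<^esub> < 3 * \<delta>"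
    and "(\<lambda>n. (defect_ops (\<lambda>h. y h n) g h ! i) a) \<in> carrier (linf A)"
proof -
  let ?k = "g \<otimes>\<^bsub>H\<^esub> h \<otimes>\<^bsub>H\<^esub> inv\<^bsub>H\<^esub> g"
  have yl [simp]: "y g \<in> carrier (linf A)" "y h \<in> carrier (linf A)" "y (g \<otimes>\<^bsub>H\<^esub> h) \<in> carrier (linf A)" "y ?k \<in> carrier (linf A)"
    by (simp_all add: y(1))
  have cl [simp]: "Y g e \<in> carrier S" "Y h e \<in> carrier S" "Y (g \<otimes>\<^bsub>H\<^esub> h) e \<in> carrier S" "Y ?k e \<in> carrier S"
    by (simp_all add: covariant_familyD(1)[OF Y])
  have \<delta>: "\<delta> > 0" using unit[of a] nrm_ge0[of "e \<otimes> a \<ominus> a"] by (simp del: nrm_ge0)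
  \<comment> \<open>the list \<open>defect_ops\<close>, evaluated in the sequence algebra\<close>
  define X where "X = [\<lambda>b. Y h e \<otimes>\<^bsub>S\<^esub> (Y h e)\<^sup>\<star>\<^bsub>S\<^esub> \<otimes>\<^bsub>S\<^esub> b \<ominus>\<^bsub>S\<^esub> b, \<lambda>b. b \<otimes>\<^bsub>S\<^esub> (Y h e \<otimes>\<^bsub>S\<^esub> (Y h e)\<^sup>\<star>\<^bsub>S\<^esub>) \<ominus>\<^bsub>S\<^esub> b,
     \<lambda>b. (Y h e)\<^sup>\<star>\<^bsub>S\<^esub> \<otimes>\<^bsub>S\<^esub> Y h e \<otimes>\<^bsub>S\<^esub> b \<ominus>\<^bsub>S\<^esub> b, \<lambda>b. b \<otimes>\<^bsub>S\<^esub> ((Y h e)\<^sup>\<star>\<^bsub>S\<^esub> \<otimes>\<^bsub>S\<^esub> Y h e) \<ominus>\<^bsub>S\<^esub> b,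
     \<lambda>b. b \<otimes>\<^bsub>S\<^esub> (Y g e \<otimes>\<^bsub>S\<^esub> Y h e \<ominus>\<^bsub>S\<^esub> Y (g \<otimes>\<^bsub>H\<^esub> h) e), \<lambda>b. (Y g e \<otimes>\<^bsub>S\<^esub> Y h e \<ominus>\<^bsub>S\<^esub> Y (g \<otimes>\<^bsub>H\<^esub> h) e) \<otimes>\<^bsub>S\<^esub> b,
     \<lambda>b. \<kappa> (\<alpha> h a) \<ominus>\<^bsub>S\<^esub> Y h e \<otimes>\<^bsub>S\<^esub> b \<otimes>\<^bsub>S\<^esub> (Y h e)\<^sup>\<star>\<^bsub>S\<^esub>,
     \<lambda>b. b \<otimes>\<^bsub>S\<^esub> (Y ?k e \<ominus>\<^bsub>S\<^esub> \<sigma> g (Y h e)), \<lambda>b. (Y ?k e \<ominus>\<^bsub>S\<^esub> \<sigma> g (Y h e)) \<otimes>\<^bsub>S\<^esub> b]"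
  have i': "i = 0 \<or> i = 1 \<or> i = 2 \<or> i = 3 \<or> i = 4 \<or> i = 5 \<or> i = 6 \<or> i = 7 \<or> i = 8"
    using i by arith
  show "(\<lambda>n. (defect_ops (\<lambda>h. y h n) g h ! i) a) \<in> carrier (linf A)"
    using i' by (elim disjE; simp add: defect_ops_def)
  have "seq_class A (\<lambda>n. (defect_ops (\<lambda>h. y h n) g h ! i) a) = (X ! i) (\<kappa> a)"
    using i' by (elim disjE; simp add: defect_ops_def X_def y(2) const_seq_def seq_class_ops seq_class_minus seq_action_class)
  also have "\<parallel>(X ! i) (\<kappa> a)\<parallel>\<^bsub>S\<^esub> < 3 * \<delta>"
  proof -
    note Yops = covariant_family_mult_adj[OF Y] covariant_family_mult_const[OF Y] covariant_familyD(4,6)[OF Y]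
      covariant_family_minus[OF Y, symmetric] const_ops(3,4)[symmetric]
    note Ynrm = covariant_family_nrm[OF Y]
    have X04: "\<parallel>(X ! 0) (\<kappa> a)\<parallel>\<^bsub>S\<^esub> = \<parallel>e \<otimes> e \<otimes> a \<ominus> a\<parallel>" "\<parallel>(X ! 1) (\<kappa> a)\<parallel>\<^bsub>S\<^esub> = \<parallel>a \<otimes> (e \<otimes> e) \<ominus> a\<parallel>"
      "\<parallel>(X ! 2) (\<kappa> a)\<parallel>\<^bsub>S\<^esub> = \<parallel>\<alpha> (inv\<^bsub>H\<^esub> h) (e \<otimes> e) \<otimes> a \<ominus> a\<parallel>"
      "\<parallel>(X ! 3) (\<kappa> a)\<parallel>\<^bsub>S\<^esub> = \<parallel>a \<otimes> \<alpha> (inv\<^bsub>H\<^esub> h) (e \<otimes> e) \<ominus> a\<parallel>"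
      by (simp_all add: X_def Yops esa)
    have X4: "\<parallel>(X ! 4) (\<kappa> a)\<parallel>\<^bsub>S\<^esub> = \<parallel>a \<otimes> (e \<otimes> \<alpha> g e \<ominus> e)\<parallel>"
      "\<parallel>(X ! 5) (\<kappa> a)\<parallel>\<^bsub>S\<^esub> = \<parallel>(e \<otimes> \<alpha> g e \<ominus> e) \<otimes> \<alpha> (g \<otimes>\<^bsub>H\<^esub> h) a\<parallel>"
      by (simp_all add: X_def Yops Ynrm)
    have "Y h e \<otimes>\<^bsub>S\<^esub> \<kappa> a \<otimes>\<^bsub>S\<^esub> (Y h e)\<^sup>\<star>\<^bsub>S\<^esub> = \<kappa> (e \<otimes> \<alpha> h a \<otimes> e)" by (simp add: Yops esa)
    then have X6: "\<parallel>(X ! 6) (\<kappa> a)\<parallel>\<^bsub>S\<^esub> = \<parallel>\<alpha> h a \<ominus> e \<otimes> \<alpha> h a \<otimes> e\<parallel>"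
      by (simp add: X_def const_ops(4)[symmetric])
    have X7: "\<parallel>(X ! 7) (\<kappa> a)\<parallel>\<^bsub>S\<^esub> = \<parallel>a \<otimes> (e \<ominus> \<alpha> g e)\<parallel>" "\<parallel>(X ! 8) (\<kappa> a)\<parallel>\<^bsub>S\<^esub> = \<parallel>(e \<ominus> \<alpha> g e) \<otimes> \<alpha> ?k a\<parallel>"
      by (simp_all add: X_def Yops Ynrm)
    have two: "\<parallel>u \<ominus> v\<parallel> < 2 * \<delta>" if "\<parallel>u \<ominus> w\<parallel> < \<delta>" "\<parallel>v \<ominus> w\<parallel> < \<delta>" "u \<in> carrier A" "v \<in> carrier A" "w \<in> carrier A" for u v w
      using nrm_diff_triangle[of u w v] nrm_diff_commute[of v w] that by simp
    consider "i < 2" | "i = 2 \<or> i = 3" | "i = 4" | "i = 5" | "i = 6" | "i = 7" | "i = 8" using i by linarith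
    then show ?thesis
    proof cases
      case 1
      then have "i = 0 \<or> i = 1" by arith
      then show ?thesis using unit_square_defect[OF e a e1] unit[of a] \<delta> X04(1,2) by auto
    next
      case 2
      then show ?thesis
        using unit_square_defect[OF e act_closed[OF h a] e1] unit[of "\<alpha> h a"] \<delta> X04(3,4)
          act_unit_defect[of "inv\<^bsub>H\<^esub> h" "e \<otimes> e" a] by auto
    next
      case 3
      have "a \<otimes> (e \<otimes> \<alpha> g e \<ominus> e) = (a \<otimes> e \<ominus> a) \<otimes> \<alpha> g e \<oplus> ((a \<otimes> \<alpha> g e \<ominus> a) \<ominus> (a \<otimes> e \<ominus> a))"
        using a e act_closed[OF g e] by algebra
      then have "\<parallel>a \<otimes> (e \<otimes> \<alpha> g e \<ominus> e)\<parallel> \<le> \<parallel>(a \<otimes> e \<ominus> a) \<otimes> \<alpha> g e\<parallel> + \<parallel>(a \<otimes> \<alpha> g e \<ominus> a) \<ominus> (a \<otimes> e \<ominus> a)\<parallel>"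
        using nrm_triangle[of "(a \<otimes> e \<ominus> a) \<otimes> \<alpha> g e" "(a \<otimes> \<alpha> g e \<ominus> a) \<ominus> (a \<otimes> e \<ominus> a)"] by simp
      moreover have "\<parallel>(a \<otimes> e \<ominus> a) \<otimes> \<alpha> g e\<parallel> \<le> 1 * \<parallel>a \<otimes> e \<ominus> a\<parallel>" using e1 by (intro nrm_mult_le_right) auto
      moreover have "\<parallel>(a \<otimes> \<alpha> g e \<ominus> a) \<ominus> (a \<otimes> e \<ominus> a)\<parallel> \<le> \<parallel>a \<otimes> \<alpha> g e \<ominus> a\<parallel> + \<parallel>a \<otimes> e \<ominus> a\<parallel>"
        by (intro nrm_diff_le) auto
      ultimately show ?thesis using 3 X4(1) unit[of a] unit[of "\<alpha> (inv\<^bsub>H\<^esub> g) a"] act_unit_defect(2)[OF g e a] by simp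
    next
      case 4
      let ?c = "\<alpha> (g \<otimes>\<^bsub>H\<^esub> h) a"
      have "(e \<otimes> \<alpha> g e \<ominus> e) \<otimes> ?c = e \<otimes> (\<alpha> g e \<otimes> ?c \<ominus> ?c)"
        by (simp add: mult_diff_right mult_diff_left mult_assoc)
      then have "\<parallel>(e \<otimes> \<alpha> g e \<ominus> e) \<otimes> ?c\<parallel> \<le> 1 * \<parallel>\<alpha> g e \<otimes> ?c \<ominus> ?c\<parallel>"
        using e1 nrm_mult_le_left[of e "\<alpha> g e \<otimes> ?c \<ominus> ?c" 1] by simp
      then show ?thesis using 4 X4(2) unit[of "\<alpha> (inv\<^bsub>H\<^esub> g) ?c"] act_unit_defect(1)[OF g e, of ?c] \<delta> by simp
    next
      case 5
      let ?c = "\<alpha> h a"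
      have "?c \<ominus> e \<otimes> ?c \<otimes> e = (?c \<ominus> e \<otimes> ?c) \<ominus> e \<otimes> (?c \<otimes> e \<ominus> ?c)"
        by (simp add: mult_diff_right mult_diff_left mult_assoc minus_eq distrib_left distrib_right minus_add a_ac r_neg1 r_neg2 r_neg l_neg)
      then have "\<parallel>?c \<ominus> e \<otimes> ?c \<otimes> e\<parallel> \<le> \<parallel>?c \<ominus> e \<otimes> ?c\<parallel> + \<parallel>e \<otimes> (?c \<otimes> e \<ominus> ?c)\<parallel>"
        using nrm_diff_le[of "?c \<ominus> e \<otimes> ?c" "e \<otimes> (?c \<otimes> e \<ominus> ?c)"] by simp
      moreover have "\<parallel>e \<otimes> (?c \<otimes> e \<ominus> ?c)\<parallel> \<le> 1 * \<parallel>?c \<otimes> e \<ominus> ?c\<parallel>" using e1 by (intro nrm_mult_le_left) auto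
      ultimately show ?thesis using 5 X6 unit[of ?c] nrm_diff_commute[of ?c "e \<otimes> ?c"] \<delta> by simp
    next
      case 6
      then show ?thesis
        using two[of "a \<otimes> e" a "a \<otimes> \<alpha> g e"] unit[of a] unit[of "\<alpha> (inv\<^bsub>H\<^esub> g) a"] act_unit_defect(2)[OF g e a] X7(1) \<delta>
        by (simp add: mult_diff_right)
    next
      case 7
      let ?c = "\<alpha> ?k a"
      show ?thesis
        using 7 two[of "e \<otimes> ?c" ?c "\<alpha> g e \<otimes> ?c"] unit[of ?c] unit[of "\<alpha> (inv\<^bsub>H\<^esub> g) ?c"] act_unit_defect(1)[OF g e, of ?c] X7(2) \<delta>
        by (simp add: mult_diff_left)
    qed
  qed
  finally show "\<parallel>seq_class A (\<lambda>n. (defect_ops (\<lambda>h. y h n) g h ! i) a)\<parallel>\<^bsub>S\<^esub> < 3 * \<delta>" .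
qed

text \<open>
  For finitely many \<open>(a, g, h)\<close>, choose \<open>e\<close> for all translates that occur,
  represent the \<open>Y\<^sub>h(e)\<close> by sequences of contractions and take a term late enough
  for the finitely many strict inequalities.
\<close>

theorem approximately_representable_if_covariant_family:
  assumes sep: "separable_space (cstar_topology A)" and count: "countable (carrier H)"
    and Y: "covariant_family Y"
  shows "approximately_representable H A \<alpha>"
proof (rule approximately_representable_if_local[OF sep count])
  fix F :: "('a \<times> 'h \<times> 'h) set" and \<epsilon> :: real
  assume F: "finite F" "F \<subseteq> carrier A \<times> carrier H \<times> carrier H" and \<epsilon>: "\<epsilon> > 0"
  define U where "U = (\<lambda>(a, g, h). {a, \<alpha> h a, \<alpha> (inv\<^bsub>H\<^esub> g) a, \<alpha> (inv\<^bsub>H\<^esub> g) (\<alpha> (g \<otimes>\<^bsub>H\<^esub> h) a),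
        \<alpha> (g \<otimes>\<^bsub>H\<^esub> h \<otimes>\<^bsub>H\<^esub> inv\<^bsub>H\<^esub> g) a, \<alpha> (inv\<^bsub>H\<^esub> g) (\<alpha> (g \<otimes>\<^bsub>H\<^esub> h \<otimes>\<^bsub>H\<^esub> inv\<^bsub>H\<^esub> g) a)})"
  have U: "finite (\<Union>(U ` F))" "\<Union>(U ` F) \<subseteq> carrier A" using F by (auto simp: U_def)
  obtain e where e: "e \<in> carrier A" "e\<^sup>\<star> = e" "\<parallel>e\<parallel> \<le> 1"
    and unit: "\<And>s. s \<in> \<Union>(U ` F) \<Longrightarrow> \<parallel>e \<otimes> s \<ominus> s\<parallel> < \<epsilon> / 3" "\<And>s. s \<in> \<Union>(U ` F) \<Longrightarrow> \<parallel>s \<otimes> e \<ominus> s\<parallel> < \<epsilon> / 3"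
    using approx_unit_exists[OF U, of "\<epsilon> / 3"] \<epsilon> by auto
  have "\<exists>y. h \<in> carrier H \<longrightarrow> y \<in> carrier (linf A) \<and> Y h e = seq_class A y \<and> (\<forall>n. \<parallel>y n\<parallel> \<le> 1)" for h
    using contractive_representative[of "Y h e"] covariant_familyD(1)[OF Y, of h e] covariant_family_nrm[OF Y, of h e] e
    by metis
  then obtain y where y: "\<And>h. h \<in> carrier H \<Longrightarrow> y h \<in> carrier (linf A)"
    "\<And>h. h \<in> carrier H \<Longrightarrow> Y h e = seq_class A (y h)" and y1: "\<And>h n. h \<in> carrier H \<Longrightarrow> \<parallel>y h n\<parallel> \<le> 1"
    by metis
  have "eventually (\<lambda>n. \<forall>t\<in>F. \<forall>i\<in>{..<9}. case t of (a, g, h) \<Rightarrow> \<parallel>(defect_ops (\<lambda>h. y h n) g h ! i) a\<parallel> < \<epsilon>) sequentially"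
  proof (intro eventually_ball_finite ballI)
    fix t and i :: nat assume t: "t \<in> F" and i: "i \<in> {..<9}"
    obtain a g h where agh: "t = (a, g, h)" by (cases t)
    then have c: "a \<in> carrier A" "g \<in> carrier H" "h \<in> carrier H" using t F by auto
    have un: "\<parallel>e \<otimes> s \<ominus> s\<parallel> < \<epsilon> / 3 \<and> \<parallel>s \<otimes> e \<ominus> s\<parallel> < \<epsilon> / 3" if "s \<in> U (a, g, h)" for s
      using unit[of s] t that agh by auto
    note d = covariant_family_defects[OF Y c(2,3,1) e un[unfolded U_def prod.case] y, of i]
    show "eventually (\<lambda>n. case t of (a, g, h) \<Rightarrow> \<parallel>(defect_ops (\<lambda>h. y h n) g h ! i) a\<parallel> < \<epsilon>) sequentially"
      unfolding agh prod.case using d i by (intro nrm_seq_class_less) auto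
  qed (use F in auto)
  then obtain n where n: "\<forall>t\<in>F. \<forall>i\<in>{..<9}. case t of (a, g, h) \<Rightarrow> \<parallel>(defect_ops (\<lambda>h. y h n) g h ! i) a\<parallel> < \<epsilon>"
    using eventually_happens' sequentially_bot by blast
  show "\<exists>x. (\<forall>h\<in>carrier H. x h \<in> carrier A \<and> \<parallel>x h\<parallel> \<le> 1) \<and>
      (\<forall>(a, g, h)\<in>F. \<forall>i<9. \<parallel>(defect_ops x g h ! i) a\<parallel> < \<epsilon>)"
    using n y y1 by (intro exI[of _ "\<lambda>h. y h n"]) (auto simp: split_beta)
qed

end

section \<open>Implementing elements of the sequence algebra\<close>

context cstar_dynamical_system
begin

text \<open>
  The relations of approximate representability, read as identities in
  \<open>A\<^sub>\<infinity>\<close>. They hold only against constant sequences, since they cannot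
  distinguish elements that agree as multipliers of \<open>A\<close>.
\<close>

definition implementing :: "('h \<Rightarrow> (nat \<Rightarrow> 'a) set) \<Rightarrow> bool" where
  "implementing X \<longleftrightarrow>
    (\<forall>h\<in>carrier H. X h \<in> carrier S) \<and>
    (\<forall>h\<in>carrier H. \<forall>a\<in>carrier A.
      X h \<otimes>\<^bsub>S\<^esub> (X h)\<^sup>\<star>\<^bsub>S\<^esub> \<otimes>\<^bsub>S\<^esub> \<kappa> a = \<kappa> a \<and> \<kappa> a \<otimes>\<^bsub>S\<^esub> (X h \<otimes>\<^bsub>S\<^esub> (X h)\<^sup>\<star>\<^bsub>S\<^esub>) = \<kappa> a \<and>
      (X h)\<^sup>\<star>\<^bsub>S\<^esub> \<otimes>\<^bsub>S\<^esub> X h \<otimes>\<^bsub>S\<^esub> \<kappa> a = \<kappa> a \<and> \<kappa> a \<otimes>\<^bsub>S\<^esub> ((X h)\<^sup>\<star>\<^bsub>S\<^esub> \<otimes>\<^bsub>S\<^esub> X h) = \<kappa> a \<and>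
      X h \<otimes>\<^bsub>S\<^esub> \<kappa> a \<otimes>\<^bsub>S\<^esub> (X h)\<^sup>\<star>\<^bsub>S\<^esub> = \<kappa> (\<alpha> h a)) \<and>
    (\<forall>g\<in>carrier H. \<forall>h\<in>carrier H. \<forall>a\<in>carrier A.
      \<kappa> a \<otimes>\<^bsub>S\<^esub> (X g \<otimes>\<^bsub>S\<^esub> X h) = \<kappa> a \<otimes>\<^bsub>S\<^esub> X (g \<otimes>\<^bsub>H\<^esub> h) \<and>
      X g \<otimes>\<^bsub>S\<^esub> X h \<otimes>\<^bsub>S\<^esub> \<kappa> a = X (g \<otimes>\<^bsub>H\<^esub> h) \<otimes>\<^bsub>S\<^esub> \<kappa> a \<and>
      \<kappa> a \<otimes>\<^bsub>S\<^esub> \<sigma> g (X h) = \<kappa> a \<otimes>\<^bsub>S\<^esub> X (g \<otimes>\<^bsub>H\<^esub> h \<otimes>\<^bsub>H\<^esub> inv\<^bsub>H\<^esub> g) \<and>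
      \<sigma> g (X h) \<otimes>\<^bsub>S\<^esub> \<kappa> a = X (g \<otimes>\<^bsub>H\<^esub> h \<otimes>\<^bsub>H\<^esub> inv\<^bsub>H\<^esub> g) \<otimes>\<^bsub>S\<^esub> \<kappa> a)"

lemma implementing_if_approximately_representable:
  assumes "approximately_representable H A \<alpha>"
  obtains X where "implementing X"
  using assms unfolding approximately_representable_def
proof (elim exE, goal_cases)
  case (1 x)
  then have xc: "\<And>n h. h \<in> carrier H \<Longrightarrow> x n h \<in> carrier A" "\<And>n h. h \<in> carrier H \<Longrightarrow> \<parallel>x n h\<parallel> \<le> 1"
    and u: "\<And>h. h \<in> carrier H \<Longrightarrow> approximate_unit A (\<lambda>n. x n h \<otimes> (x n h)\<^sup>\<star>)"
      "\<And>h. h \<in> carrier H \<Longrightarrow> approximate_unit A (\<lambda>n. (x n h)\<^sup>\<star> \<otimes> x n h)"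
    and m: "\<And>g h a. \<lbrakk>g \<in> carrier H; h \<in> carrier H; a \<in> carrier A\<rbrakk> \<Longrightarrow>
      (\<lambda>n. \<parallel>a \<otimes> (x n g \<otimes> x n h \<ominus> x n (g \<otimes>\<^bsub>H\<^esub> h))\<parallel> + \<parallel>(x n g \<otimes> x n h \<ominus> x n (g \<otimes>\<^bsub>H\<^esub> h)) \<otimes> a\<parallel>) \<longlonglongrightarrow> 0"
    and i: "\<And>h a. \<lbrakk>h \<in> carrier H; a \<in> carrier A\<rbrakk> \<Longrightarrow> (\<lambda>n. \<parallel>\<alpha> h a \<ominus> x n h \<otimes> a \<otimes> (x n h)\<^sup>\<star>\<parallel>) \<longlonglongrightarrow> 0"
    and e: "\<And>g h a. \<lbrakk>g \<in> carrier H; h \<in> carrier H; a \<in> carrier A\<rbrakk> \<Longrightarrow>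
      (\<lambda>n. \<parallel>a \<otimes> (x n (g \<otimes>\<^bsub>H\<^esub> h \<otimes>\<^bsub>H\<^esub> inv\<^bsub>H\<^esub> g) \<ominus> \<alpha> g (x n h))\<parallel>
        + \<parallel>(x n (g \<otimes>\<^bsub>H\<^esub> h \<otimes>\<^bsub>H\<^esub> inv\<^bsub>H\<^esub> g) \<ominus> \<alpha> g (x n h)) \<otimes> a\<parallel>) \<longlonglongrightarrow> 0"
    by simp_all
  define X where "X h = seq_class A (\<lambda>n. x n h)" for h
  have xl [simp]: "(\<lambda>n. x n h) \<in> carrier (linf A)" if "h \<in> carrier H" for h
    using xc that by (auto simp: mem_linf intro!: exI[of _ 1])
  note xc(1)[simp]
  have split: "f \<longlonglongrightarrow> 0 \<and> g \<longlonglongrightarrow> 0" if "(\<lambda>n. f n + g n) \<longlonglongrightarrow> 0" "\<And>n. 0 \<le> f n" "\<And>n. 0 \<le> g n" for f g :: "nat \<Rightarrow> real"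
    using that(2,3)
    by (auto intro!: tendsto_sandwich[OF _ _ tendsto_const that(1)] always_eventually)
  have "implementing X"
    unfolding implementing_def
  proof (intro conjI ballI)
    fix h assume h [simp]: "h \<in> carrier H"
    show "X h \<in> carrier S" by (simp add: X_def)
    fix a assume a [simp]: "a \<in> carrier A"
    show "X h \<otimes>\<^bsub>S\<^esub> (X h)\<^sup>\<star>\<^bsub>S\<^esub> \<otimes>\<^bsub>S\<^esub> \<kappa> a = \<kappa> a" "\<kappa> a \<otimes>\<^bsub>S\<^esub> (X h \<otimes>\<^bsub>S\<^esub> (X h)\<^sup>\<star>\<^bsub>S\<^esub>) = \<kappa> a"
      "(X h)\<^sup>\<star>\<^bsub>S\<^esub> \<otimes>\<^bsub>S\<^esub> X h \<otimes>\<^bsub>S\<^esub> \<kappa> a = \<kappa> a" "\<kappa> a \<otimes>\<^bsub>S\<^esub> ((X h)\<^sup>\<star>\<^bsub>S\<^esub> \<otimes>\<^bsub>S\<^esub> X h) = \<kappa> a"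
      using u[OF h] by (simp_all add: X_def const_seq_def seq_class_ops seq_class_eq_iff null_diff_def approximate_unit_def)
    have "\<kappa> (\<alpha> h a) = X h \<otimes>\<^bsub>S\<^esub> \<kappa> a \<otimes>\<^bsub>S\<^esub> (X h)\<^sup>\<star>\<^bsub>S\<^esub>"
      using i[OF h a] by (simp add: X_def const_seq_def seq_class_ops seq_class_eq_iff null_diff_def)
    then show "X h \<otimes>\<^bsub>S\<^esub> \<kappa> a \<otimes>\<^bsub>S\<^esub> (X h)\<^sup>\<star>\<^bsub>S\<^esub> = \<kappa> (\<alpha> h a)" ..
  next
    fix g h a assume g [simp]: "g \<in> carrier H" and h [simp]: "h \<in> carrier H" and a [simp]: "a \<in> carrier A"
    have m': "(\<lambda>n. \<parallel>a \<otimes> (x n g \<otimes> x n h \<ominus> x n (g \<otimes>\<^bsub>H\<^esub> h))\<parallel>) \<longlonglongrightarrow> 0 \<and> (\<lambda>n. \<parallel>(x n g \<otimes> x n h \<ominus> x n (g \<otimes>\<^bsub>H\<^esub> h)) \<otimes> a\<parallel>) \<longlonglongrightarrow> 0"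
      by (rule split[OF m[OF g h a]]) simp_all
    let ?k = "g \<otimes>\<^bsub>H\<^esub> h \<otimes>\<^bsub>H\<^esub> inv\<^bsub>H\<^esub> g"
    have e': "(\<lambda>n. \<parallel>a \<otimes> (x n ?k \<ominus> \<alpha> g (x n h))\<parallel>) \<longlonglongrightarrow> 0 \<and> (\<lambda>n. \<parallel>(x n ?k \<ominus> \<alpha> g (x n h)) \<otimes> a\<parallel>) \<longlonglongrightarrow> 0"
      by (rule split[OF e[OF g h a]]) simp_all
    show "\<kappa> a \<otimes>\<^bsub>S\<^esub> (X g \<otimes>\<^bsub>S\<^esub> X h) = \<kappa> a \<otimes>\<^bsub>S\<^esub> X (g \<otimes>\<^bsub>H\<^esub> h)"
      "X g \<otimes>\<^bsub>S\<^esub> X h \<otimes>\<^bsub>S\<^esub> \<kappa> a = X (g \<otimes>\<^bsub>H\<^esub> h) \<otimes>\<^bsub>S\<^esub> \<kappa> a"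
      using m' by (simp_all add: X_def const_seq_def seq_class_ops seq_class_eq_iff null_diff_def mult_diff_right mult_diff_left)
    have "\<kappa> a \<otimes>\<^bsub>S\<^esub> X ?k = \<kappa> a \<otimes>\<^bsub>S\<^esub> \<sigma> g (X h)" "X ?k \<otimes>\<^bsub>S\<^esub> \<kappa> a = \<sigma> g (X h) \<otimes>\<^bsub>S\<^esub> \<kappa> a"
      using e' by (simp_all add: X_def const_seq_def seq_action_class seq_class_ops seq_class_eq_iff null_diff_def mult_diff_right mult_diff_left)
    then show "\<kappa> a \<otimes>\<^bsub>S\<^esub> \<sigma> g (X h) = \<kappa> a \<otimes>\<^bsub>S\<^esub> X ?k" "\<sigma> g (X h) \<otimes>\<^bsub>S\<^esub> \<kappa> a = X ?k \<otimes>\<^bsub>S\<^esub> \<kappa> a" by simp_all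
  qed
  then show ?case by (rule that)
qed

lemma implementingD:
  assumes "implementing X" "h \<in> carrier H"
  shows "X h \<in> carrier S"
    and "a \<in> carrier A \<Longrightarrow> X h \<otimes>\<^bsub>S\<^esub> (X h)\<^sup>\<star>\<^bsub>S\<^esub> \<otimes>\<^bsub>S\<^esub> \<kappa> a = \<kappa> a"
    and "a \<in> carrier A \<Longrightarrow> \<kappa> a \<otimes>\<^bsub>S\<^esub> (X h \<otimes>\<^bsub>S\<^esub> (X h)\<^sup>\<star>\<^bsub>S\<^esub>) = \<kappa> a"
    and "a \<in> carrier A \<Longrightarrow> (X h)\<^sup>\<star>\<^bsub>S\<^esub> \<otimes>\<^bsub>S\<^esub> X h \<otimes>\<^bsub>S\<^esub> \<kappa> a = \<kappa> a"
    and "a \<in> carrier A \<Longrightarrow> \<kappa> a \<otimes>\<^bsub>S\<^esub> ((X h)\<^sup>\<star>\<^bsub>S\<^esub> \<otimes>\<^bsub>S\<^esub> X h) = \<kappa> a"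
    and "a \<in> carrier A \<Longrightarrow> X h \<otimes>\<^bsub>S\<^esub> \<kappa> a \<otimes>\<^bsub>S\<^esub> (X h)\<^sup>\<star>\<^bsub>S\<^esub> = \<kappa> (\<alpha> h a)"
    and "\<lbrakk>g \<in> carrier H; a \<in> carrier A\<rbrakk> \<Longrightarrow> \<kappa> a \<otimes>\<^bsub>S\<^esub> (X g \<otimes>\<^bsub>S\<^esub> X h) = \<kappa> a \<otimes>\<^bsub>S\<^esub> X (g \<otimes>\<^bsub>H\<^esub> h)"
    and "\<lbrakk>g \<in> carrier H; a \<in> carrier A\<rbrakk> \<Longrightarrow> X g \<otimes>\<^bsub>S\<^esub> X h \<otimes>\<^bsub>S\<^esub> \<kappa> a = X (g \<otimes>\<^bsub>H\<^esub> h) \<otimes>\<^bsub>S\<^esub> \<kappa> a"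
    and "\<lbrakk>g \<in> carrier H; a \<in> carrier A\<rbrakk> \<Longrightarrow> \<kappa> a \<otimes>\<^bsub>S\<^esub> \<sigma> g (X h) = \<kappa> a \<otimes>\<^bsub>S\<^esub> X (g \<otimes>\<^bsub>H\<^esub> h \<otimes>\<^bsub>H\<^esub> inv\<^bsub>H\<^esub> g)"
    and "\<lbrakk>g \<in> carrier H; a \<in> carrier A\<rbrakk> \<Longrightarrow> \<sigma> g (X h) \<otimes>\<^bsub>S\<^esub> \<kappa> a = X (g \<otimes>\<^bsub>H\<^esub> h \<otimes>\<^bsub>H\<^esub> inv\<^bsub>H\<^esub> g) \<otimes>\<^bsub>S\<^esub> \<kappa> a"
  using assms unfolding implementing_def by simp_all

text \<open>
  Insert \<open>X\<^sub>h* X\<^sub>h\<close>, which is a unit for \<open>A\<close>, on the right of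
  \<open>a\<close>.
\<close>

lemma implementing_commute:
  assumes X: "implementing X" and h [simp]: "h \<in> carrier H" and a [simp]: "a \<in> carrier A"
  shows "X h \<otimes>\<^bsub>S\<^esub> \<kappa> a = \<kappa> (\<alpha> h a) \<otimes>\<^bsub>S\<^esub> X h"
proof -
  note [simp] = implementingD(1)[OF X]
  have "X h \<otimes>\<^bsub>S\<^esub> \<kappa> a = X h \<otimes>\<^bsub>S\<^esub> (\<kappa> a \<otimes>\<^bsub>S\<^esub> ((X h)\<^sup>\<star>\<^bsub>S\<^esub> \<otimes>\<^bsub>S\<^esub> X h))" using implementingD(5)[OF X h a] by simp
  also have "\<dots> = X h \<otimes>\<^bsub>S\<^esub> \<kappa> a \<otimes>\<^bsub>S\<^esub> (X h)\<^sup>\<star>\<^bsub>S\<^esub> \<otimes>\<^bsub>S\<^esub> X h" by (simp add: S.mult_assoc)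
  finally show ?thesis by (simp add: implementingD(6)[OF X h a])
qed

text \<open>
  On \<open>A\<close> the element \<open>X\<^sub>1\<close> is idempotent, and it commutes with
  \<open>A\<close>; cancel one factor with \<open>X\<^sub>1*\<close>.
\<close>

lemma implementing_one:
  assumes X: "implementing X" and a [simp]: "a \<in> carrier A"
  shows "\<kappa> a \<otimes>\<^bsub>S\<^esub> X \<one>\<^bsub>H\<^esub> = \<kappa> a" "X \<one>\<^bsub>H\<^esub> \<otimes>\<^bsub>S\<^esub> \<kappa> a = \<kappa> a"
proof -
  let ?u = "X \<one>\<^bsub>H\<^esub>"
  have o: "\<one>\<^bsub>H\<^esub> \<in> carrier H" by simp
  have u [simp]: "?u \<in> carrier S" by (rule implementingD(1)[OF X o])
  have com: "?u \<otimes>\<^bsub>S\<^esub> \<kappa> a = \<kappa> a \<otimes>\<^bsub>S\<^esub> ?u" using implementing_commute[OF X o a] by simp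
  have "\<kappa> a \<otimes>\<^bsub>S\<^esub> ?u = ?u \<otimes>\<^bsub>S\<^esub> (\<kappa> a \<otimes>\<^bsub>S\<^esub> (?u \<otimes>\<^bsub>S\<^esub> ?u\<^sup>\<star>\<^bsub>S\<^esub>))" using implementingD(3)[OF X o a] com by simp
  also have "\<dots> = \<kappa> a \<otimes>\<^bsub>S\<^esub> (?u \<otimes>\<^bsub>S\<^esub> ?u) \<otimes>\<^bsub>S\<^esub> ?u\<^sup>\<star>\<^bsub>S\<^esub>"
    by (simp add: S.mult_assoc[symmetric] com)
  also have "\<dots> = \<kappa> a \<otimes>\<^bsub>S\<^esub> ?u \<otimes>\<^bsub>S\<^esub> ?u\<^sup>\<star>\<^bsub>S\<^esub>" using implementingD(7)[OF X o o a] by simp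
  also have "\<dots> = \<kappa> a" using implementingD(3)[OF X o a] by (simp add: S.mult_assoc)
  finally show "\<kappa> a \<otimes>\<^bsub>S\<^esub> ?u = \<kappa> a" .
  then show "?u \<otimes>\<^bsub>S\<^esub> \<kappa> a = \<kappa> a" by (simp add: com)
qed

text \<open>
  The formula for the adjoint is the one that needs an argument: \<open>X\<^sub>h*\<close> acts on
  \<open>A\<close> like the element at \<open>h\<^sup>-\<^sup>1\<close>, because the latter is a
  left inverse of \<open>X\<^sub>h\<close> on \<open>A\<close>.
\<close>

lemma covariant_family_if_implementing:
  assumes X: "implementing X"
  shows "covariant_family (\<lambda>h a. \<kappa> a \<otimes>\<^bsub>S\<^esub> X h)"
  unfolding covariant_family_def
proof (intro conjI ballI allI)
  note [simp] = implementingD(1)[OF X]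
  fix h a assume h [simp]: "h \<in> carrier H" and a [simp]: "a \<in> carrier A"
  show "\<kappa> a \<otimes>\<^bsub>S\<^esub> X h \<in> carrier S" by simp
  show "\<kappa> (c \<odot> a) \<otimes>\<^bsub>S\<^esub> X h = c \<odot>\<^bsub>S\<^esub> (\<kappa> a \<otimes>\<^bsub>S\<^esub> X h)" for c by (simp add: const_ops S.smult_mult_left)
  show "(\<kappa> a \<otimes>\<^bsub>S\<^esub> X h)\<^sup>\<star>\<^bsub>S\<^esub> = \<kappa> (\<alpha> (inv\<^bsub>H\<^esub> h) (a\<^sup>\<star>)) \<otimes>\<^bsub>S\<^esub> X (inv\<^bsub>H\<^esub> h)"
  proof -
    define c where "c = \<alpha> (inv\<^bsub>H\<^esub> h) (a\<^sup>\<star>)"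
    have c [simp]: "c \<in> carrier A" by (simp add: c_def)
    have hi [simp]: "inv\<^bsub>H\<^esub> h \<in> carrier H" by simp
    have ac: "\<alpha> h c = a\<^sup>\<star>" by (simp add: c_def)
    have "(\<kappa> a \<otimes>\<^bsub>S\<^esub> X h)\<^sup>\<star>\<^bsub>S\<^esub> = (X h)\<^sup>\<star>\<^bsub>S\<^esub> \<otimes>\<^bsub>S\<^esub> \<kappa> (\<alpha> h c)" by (simp add: S.adj_mult const_ops ac)
    also have "\<dots> = (X h)\<^sup>\<star>\<^bsub>S\<^esub> \<otimes>\<^bsub>S\<^esub> X h \<otimes>\<^bsub>S\<^esub> \<kappa> c \<otimes>\<^bsub>S\<^esub> (X h)\<^sup>\<star>\<^bsub>S\<^esub>"
      unfolding implementingD(6)[OF X h c, symmetric] by (simp add: S.mult_assoc)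
    also have "\<dots> = \<kappa> c \<otimes>\<^bsub>S\<^esub> (X h)\<^sup>\<star>\<^bsub>S\<^esub>" by (simp add: implementingD(4)[OF X h c])
    also have "\<kappa> c = \<kappa> c \<otimes>\<^bsub>S\<^esub> (X (inv\<^bsub>H\<^esub> h) \<otimes>\<^bsub>S\<^esub> X h)"
      by (simp add: implementingD(7)[OF X h hi c] implementing_one[OF X c])
    also have "\<kappa> c \<otimes>\<^bsub>S\<^esub> (X (inv\<^bsub>H\<^esub> h) \<otimes>\<^bsub>S\<^esub> X h) = X (inv\<^bsub>H\<^esub> h) \<otimes>\<^bsub>S\<^esub> \<kappa> (\<alpha> h c) \<otimes>\<^bsub>S\<^esub> X h"
      using implementing_commute[OF X hi act_closed[OF h c]] by (simp add: S.mult_assoc)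
    also have "\<dots> \<otimes>\<^bsub>S\<^esub> (X h)\<^sup>\<star>\<^bsub>S\<^esub> = X (inv\<^bsub>H\<^esub> h) \<otimes>\<^bsub>S\<^esub> (\<kappa> (\<alpha> h c) \<otimes>\<^bsub>S\<^esub> (X h \<otimes>\<^bsub>S\<^esub> (X h)\<^sup>\<star>\<^bsub>S\<^esub>))"
      by (simp add: S.mult_assoc)
    also have "\<dots> = \<kappa> c \<otimes>\<^bsub>S\<^esub> X (inv\<^bsub>H\<^esub> h)"
      using implementing_commute[OF X hi act_closed[OF h c]] by (simp add: implementingD(3)[OF X h act_closed[OF h c]])
    finally show ?thesis by (simp add: c_def)
  qed
  fix b assume b [simp]: "b \<in> carrier A"
  show "\<kappa> (a \<oplus> b) \<otimes>\<^bsub>S\<^esub> X h = \<kappa> a \<otimes>\<^bsub>S\<^esub> X h \<oplus>\<^bsub>S\<^esub> \<kappa> b \<otimes>\<^bsub>S\<^esub> X h" by (simp add: const_ops S.distrib_right)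
next
  note [simp] = implementingD(1)[OF X]
  fix g h a assume g [simp]: "g \<in> carrier H" and h [simp]: "h \<in> carrier H" and a [simp]: "a \<in> carrier A"
  show "\<sigma> g (\<kappa> a \<otimes>\<^bsub>S\<^esub> X h) = \<kappa> (\<alpha> g a) \<otimes>\<^bsub>S\<^esub> X (g \<otimes>\<^bsub>H\<^esub> h \<otimes>\<^bsub>H\<^esub> inv\<^bsub>H\<^esub> g)"
    by (simp add: seq_action_ops implementingD(9)[OF X])
  fix b assume b [simp]: "b \<in> carrier A"
  have "\<kappa> a \<otimes>\<^bsub>S\<^esub> X g \<otimes>\<^bsub>S\<^esub> (\<kappa> b \<otimes>\<^bsub>S\<^esub> X h) = \<kappa> a \<otimes>\<^bsub>S\<^esub> (X g \<otimes>\<^bsub>S\<^esub> \<kappa> b) \<otimes>\<^bsub>S\<^esub> X h" by (simp add: S.mult_assoc)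
  also have "\<dots> = \<kappa> (a \<otimes> \<alpha> g b) \<otimes>\<^bsub>S\<^esub> (X g \<otimes>\<^bsub>S\<^esub> X h)"
    by (simp add: implementing_commute[OF X] const_ops S.mult_assoc)
  also have "\<dots> = \<kappa> (a \<otimes> \<alpha> g b) \<otimes>\<^bsub>S\<^esub> X (g \<otimes>\<^bsub>H\<^esub> h)" by (simp add: implementingD(7)[OF X])
  finally show "\<kappa> a \<otimes>\<^bsub>S\<^esub> X g \<otimes>\<^bsub>S\<^esub> (\<kappa> b \<otimes>\<^bsub>S\<^esub> X h) = \<kappa> (a \<otimes> \<alpha> g b) \<otimes>\<^bsub>S\<^esub> X (g \<otimes>\<^bsub>H\<^esub> h)" .
qed (simp add: implementing_one[OF X])

end

section \<open>The hereditary subalgebra\<close>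

context cstar_dynamical_system
begin

abbreviation D :: "(nat \<Rightarrow> 'a) set cstar_struct" where "D \<equiv> seq_hereditary A"

text \<open>
  The set whose closure is the carrier of \<open>D\<close>, separated from the closure to allow
  induction on the number of summands.
\<close>

definition corner_span :: "(nat \<Rightarrow> 'a) set set" where
  "corner_span = {\<Oplus>\<^bsub>S\<^esub>i\<in>{..<n}. \<kappa> (a i) \<otimes>\<^bsub>S\<^esub> X i \<otimes>\<^bsub>S\<^esub> \<kappa> (b i) | n a X b.
      (\<forall>i<n::nat. a i \<in> carrier A \<and> X i \<in> carrier S \<and> b i \<in> carrier A)}"

lemma corner_span_zero: "\<zero>\<^bsub>S\<^esub> \<in> corner_span"
proof -
  have "\<zero>\<^bsub>S\<^esub> = (\<Oplus>\<^bsub>S\<^esub>i\<in>{..<0::nat}. \<kappa> ((\<lambda>_. \<zero>) i) \<otimes>\<^bsub>S\<^esub> (\<lambda>_. \<zero>\<^bsub>S\<^esub>) i \<otimes>\<^bsub>S\<^esub> \<kappa> ((\<lambda>_. \<zero>) i))" by simp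
  then show ?thesis unfolding corner_span_def mem_Collect_eq
    by (intro exI[of _ "0::nat"] exI[of _ "\<lambda>_. \<zero>"] exI[of _ "\<lambda>_. \<zero>\<^bsub>S\<^esub>"] conjI) simp_all
qed

lemma corner_span_step:
  assumes s: "s \<in> corner_span" and c: "c \<in> carrier A" "Z \<in> carrier S" "d \<in> carrier A"
  shows "\<kappa> c \<otimes>\<^bsub>S\<^esub> Z \<otimes>\<^bsub>S\<^esub> \<kappa> d \<oplus>\<^bsub>S\<^esub> s \<in> corner_span"
proof -
  obtain n :: nat and a X b where
    n: "\<forall>i<n. a i \<in> carrier A \<and> X i \<in> carrier S \<and> b i \<in> carrier A"
    and s': "s = (\<Oplus>\<^bsub>S\<^esub>i\<in>{..<n}. \<kappa> (a i) \<otimes>\<^bsub>S\<^esub> X i \<otimes>\<^bsub>S\<^esub> \<kappa> (b i))"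
    using s unfolding corner_span_def by blast
  define f where "f i = \<kappa> ((a(n := c)) i) \<otimes>\<^bsub>S\<^esub> (X(n := Z)) i \<otimes>\<^bsub>S\<^esub> \<kappa> ((b(n := d)) i)" for i
  have "(\<Oplus>\<^bsub>S\<^esub>i\<in>{..<Suc n}. f i) = f n \<oplus>\<^bsub>S\<^esub> (\<Oplus>\<^bsub>S\<^esub>i\<in>{..<n}. f i)"
    unfolding lessThan_Suc using n c by (intro S.finsum_insert) (auto simp: f_def)
  also have "(\<Oplus>\<^bsub>S\<^esub>i\<in>{..<n}. f i) = s"
    unfolding s' using n c by (intro S.finsum_cong') (auto simp: f_def)
  finally have "\<kappa> c \<otimes>\<^bsub>S\<^esub> Z \<otimes>\<^bsub>S\<^esub> \<kappa> d \<oplus>\<^bsub>S\<^esub> s = (\<Oplus>\<^bsub>S\<^esub>i\<in>{..<Suc n}. f i)" by (simp add: f_def)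
  then show ?thesis
    unfolding corner_span_def mem_Collect_eq f_def using n c
    by (intro exI[of _ "Suc n"] exI[of _ "a(n := c)"] exI[of _ "X(n := Z)"] exI[of _ "b(n := d)"]) (auto simp: less_Suc_eq)
qed

lemma corner_span_induct [consumes 1, case_names zero step]:
  assumes "s \<in> corner_span" and zero: "P \<zero>\<^bsub>S\<^esub>"
    and step: "\<And>c Z d s. \<lbrakk>c \<in> carrier A; Z \<in> carrier S; d \<in> carrier A; s \<in> corner_span; s \<in> carrier S; P s\<rbrakk>
      \<Longrightarrow> P (\<kappa> c \<otimes>\<^bsub>S\<^esub> Z \<otimes>\<^bsub>S\<^esub> \<kappa> d \<oplus>\<^bsub>S\<^esub> s)"
  shows "P s"
proof -
  obtain n :: nat and a X b where
    n: "\<forall>i<n. a i \<in> carrier A \<and> X i \<in> carrier S \<and> b i \<in> carrier A"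
    and s': "s = (\<Oplus>\<^bsub>S\<^esub>i\<in>{..<n}. \<kappa> (a i) \<otimes>\<^bsub>S\<^esub> X i \<otimes>\<^bsub>S\<^esub> \<kappa> (b i))"
    using assms(1) unfolding corner_span_def by blast
  define f where "f i = \<kappa> (a i) \<otimes>\<^bsub>S\<^esub> X i \<otimes>\<^bsub>S\<^esub> \<kappa> (b i)" for i
  have "P (\<Oplus>\<^bsub>S\<^esub>i\<in>{..<m}. f i)" if "m \<le> n" for m
    using that
  proof (induction m)
    case 0
    then show ?case by (simp add: zero)
  next
    case (Suc m)
    have sum: "(\<Oplus>\<^bsub>S\<^esub>i\<in>{..<Suc m}. f i) = f m \<oplus>\<^bsub>S\<^esub> (\<Oplus>\<^bsub>S\<^esub>i\<in>{..<m}. f i)"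
      unfolding lessThan_Suc using n Suc.prems by (intro S.finsum_insert) (auto simp: f_def)
    have cl: "(\<Oplus>\<^bsub>S\<^esub>i\<in>{..<m}. f i) \<in> carrier S"
      using n Suc.prems by (intro S.finsum_closed) (auto simp: f_def)
    have sp: "(\<Oplus>\<^bsub>S\<^esub>i\<in>{..<m}. f i) \<in> corner_span"
      unfolding corner_span_def f_def mem_Collect_eq using n Suc.prems by (intro exI[of _ m] exI[of _ a] exI[of _ X] exI[of _ b]) auto
    show ?case unfolding sum using n Suc.prems Suc.IH cl sp by (subst f_def) (intro step, auto)
  qed
  then show ?thesis unfolding s' f_def by blast
qed

lemma corner_span_in_carrier: "s \<in> corner_span \<Longrightarrow> s \<in> carrier S"
  by (induction rule: corner_span_induct) auto

lemma corner_span_product: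
  "\<lbrakk>c \<in> carrier A; Z \<in> carrier S; d \<in> carrier A\<rbrakk> \<Longrightarrow> \<kappa> c \<otimes>\<^bsub>S\<^esub> Z \<otimes>\<^bsub>S\<^esub> \<kappa> d \<in> corner_span"
  using corner_span_step[OF corner_span_zero, of c Z d] by simp

lemma corner_span_add: "\<lbrakk>s \<in> corner_span; t \<in> corner_span\<rbrakk> \<Longrightarrow> s \<oplus>\<^bsub>S\<^esub> t \<in> corner_span"
proof (induction rule: corner_span_induct)
  case (step c Z d s)
  then show ?case
    using corner_span_step[of "s \<oplus>\<^bsub>S\<^esub> t" c Z d] corner_span_in_carrier[of t] by (simp add: S.a_assoc)
qed (simp add: corner_span_in_carrier)

lemma corner_span_map:
  assumes "s \<in> corner_span" and zero: "F \<zero>\<^bsub>S\<^esub> = \<zero>\<^bsub>S\<^esub>"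
    and add: "\<And>x y. \<lbrakk>x \<in> carrier S; y \<in> carrier S\<rbrakk> \<Longrightarrow> F (x \<oplus>\<^bsub>S\<^esub> y) = F x \<oplus>\<^bsub>S\<^esub> F y"
    and gen: "\<And>c Z d. \<lbrakk>c \<in> carrier A; Z \<in> carrier S; d \<in> carrier A\<rbrakk> \<Longrightarrow> F (\<kappa> c \<otimes>\<^bsub>S\<^esub> Z \<otimes>\<^bsub>S\<^esub> \<kappa> d) \<in> corner_span"
  shows "F s \<in> corner_span"
  using assms(1)
proof (induction rule: corner_span_induct)
  case (step c Z d s)
  then show ?case by (subst add) (auto intro: corner_span_add gen)
qed (simp add: zero corner_span_zero)

lemma D_simps [simp]:
  "mult D = mult S" "add D = add S" "smult D = smult S" "adj D = adj S" "nrm D = nrm S" "\<zero>\<^bsub>D\<^esub> = \<zero>\<^bsub>S\<^esub>"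
  by (simp_all add: seq_hereditary_def)

lemma D_iff: "x \<in> carrier D \<longleftrightarrow> x \<in> carrier S \<and> (\<forall>r>0. \<exists>y\<in>corner_span. \<parallel>x \<ominus>\<^bsub>S\<^esub> y\<parallel>\<^bsub>S\<^esub> < r)"
proof -
  interpret M: Metric_space "carrier S" "cstar_dist S" by (rule S.cstar_dist_metric)
  have 1: "carrier D = {x \<in> carrier S. \<forall>r>0. \<exists>y\<in>corner_span. y \<in> M.mball x r}"
    by (simp add: seq_hereditary_def cstar_topology_def corner_span_def M.metric_closure_of)
  have 2: "y \<in> M.mball x r \<longleftrightarrow> \<parallel>x \<ominus>\<^bsub>S\<^esub> y\<parallel>\<^bsub>S\<^esub> < r" if "x \<in> carrier S" "y \<in> corner_span" for x y r
    using that corner_span_in_carrier[OF that(2)] by (simp add: cstar_dist_def)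
  show ?thesis unfolding 1 using 2 by blast
qed

lemma D_in_carrier [simp]: "x \<in> carrier D \<Longrightarrow> x \<in> carrier S"
  by (simp add: D_iff)

lemma corner_span_subset_D: "s \<in> corner_span \<Longrightarrow> s \<in> carrier D"
  unfolding D_iff by (auto intro!: bexI[of _ s] simp: corner_span_in_carrier)

text \<open>
  Proved by approximating \<open>x\<close> in the span first and then the image of the approximant.
  All closure properties of \<open>D\<close> below are instances; sums and products are treated in
  one argument after the other.
\<close>

lemma D_map:
  assumes x: "x \<in> carrier D" and F: "\<And>y. y \<in> carrier S \<Longrightarrow> F y \<in> carrier S"
    and lip: "\<And>y z. \<lbrakk>y \<in> carrier S; z \<in> carrier S\<rbrakk> \<Longrightarrow> \<parallel>F y \<ominus>\<^bsub>S\<^esub> F z\<parallel>\<^bsub>S\<^esub> \<le> C * \<parallel>y \<ominus>\<^bsub>S\<^esub> z\<parallel>\<^bsub>S\<^esub>"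
    and sp: "\<And>y. y \<in> corner_span \<Longrightarrow> F y \<in> carrier D"
  shows "F x \<in> carrier D"
  unfolding D_iff
proof (intro conjI allI impI)
  have xS: "x \<in> carrier S" using x by simp
  then show "F x \<in> carrier S" by (rule F)
  fix r :: real assume r: "r > 0"
  define K where "K = \<bar>C\<bar> + 1"
  have K: "K > 0" "C \<le> K" by (auto simp: K_def)
  define \<delta> where "\<delta> = r / (2 * K)"
  have \<delta>: "\<delta> > 0" using r by (simp add: \<delta>_def K)
  obtain y where y: "y \<in> corner_span" "\<parallel>x \<ominus>\<^bsub>S\<^esub> y\<parallel>\<^bsub>S\<^esub> < \<delta>" using x \<delta> unfolding D_iff by blast
  have yS: "y \<in> carrier S" by (rule corner_span_in_carrier[OF y(1)])
  obtain z where z: "z \<in> corner_span" "\<parallel>F y \<ominus>\<^bsub>S\<^esub> z\<parallel>\<^bsub>S\<^esub> < r / 2"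
    using sp[OF y(1)] r unfolding D_iff by (meson half_gt_zero)
  have "\<parallel>F x \<ominus>\<^bsub>S\<^esub> F y\<parallel>\<^bsub>S\<^esub> \<le> C * \<parallel>x \<ominus>\<^bsub>S\<^esub> y\<parallel>\<^bsub>S\<^esub>" by (rule lip[OF xS yS])
  also have "\<dots> \<le> K * \<parallel>x \<ominus>\<^bsub>S\<^esub> y\<parallel>\<^bsub>S\<^esub>" using xS yS by (intro mult_right_mono K) auto
  also have "\<dots> \<le> K * \<delta>" using y(2) K by (intro mult_left_mono) auto
  also have "\<dots> = r / 2" using K by (simp add: \<delta>_def)
  finally have "\<parallel>F x \<ominus>\<^bsub>S\<^esub> F y\<parallel>\<^bsub>S\<^esub> \<le> r / 2" .
  then have "\<parallel>F x \<ominus>\<^bsub>S\<^esub> z\<parallel>\<^bsub>S\<^esub> < r"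
    using z(2) S.nrm_diff_triangle[OF F[OF xS] F[OF yS] corner_span_in_carrier[OF z(1)]] by simp
  then show "\<exists>y\<in>corner_span. \<parallel>F x \<ominus>\<^bsub>S\<^esub> y\<parallel>\<^bsub>S\<^esub> < r" using z(1) by blast
qed

lemma D_equal:
  assumes x: "x \<in> carrier D"
    and FG: "\<And>y. y \<in> carrier S \<Longrightarrow> F y \<in> carrier S" "\<And>y. y \<in> carrier S \<Longrightarrow> G y \<in> carrier S"
    and lip: "\<And>y z. \<lbrakk>y \<in> carrier S; z \<in> carrier S\<rbrakk> \<Longrightarrow> \<parallel>F y \<ominus>\<^bsub>S\<^esub> F z\<parallel>\<^bsub>S\<^esub> \<le> C * \<parallel>y \<ominus>\<^bsub>S\<^esub> z\<parallel>\<^bsub>S\<^esub>"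
      "\<And>y z. \<lbrakk>y \<in> carrier S; z \<in> carrier S\<rbrakk> \<Longrightarrow> \<parallel>G y \<ominus>\<^bsub>S\<^esub> G z\<parallel>\<^bsub>S\<^esub> \<le> C * \<parallel>y \<ominus>\<^bsub>S\<^esub> z\<parallel>\<^bsub>S\<^esub>"
    and eq: "\<And>y. y \<in> corner_span \<Longrightarrow> F y = G y"
  shows "F x = G x"
proof (rule S.eq_if_diff_zero)
  have xS: "x \<in> carrier S" using x by simp
  show Fx: "F x \<in> carrier S" and Gx: "G x \<in> carrier S" using FG xS by auto
  have "\<parallel>F x \<ominus>\<^bsub>S\<^esub> G x\<parallel>\<^bsub>S\<^esub> \<le> 0"
  proof (rule field_le_epsilon)
    fix e :: real assume e: "e > 0"
    define K where "K = \<bar>C\<bar> + 1"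
  have K: "K > 0" "C \<le> K" by (auto simp: K_def)
  define \<delta> where "\<delta> = e / (2 * K)"
    have \<delta>: "\<delta> > 0" using e by (simp add: \<delta>_def K)
    obtain y where y: "y \<in> corner_span" "\<parallel>x \<ominus>\<^bsub>S\<^esub> y\<parallel>\<^bsub>S\<^esub> < \<delta>" using x \<delta> unfolding D_iff by blast
    have yS: "y \<in> carrier S" by (rule corner_span_in_carrier[OF y(1)])
    have "C * \<parallel>x \<ominus>\<^bsub>S\<^esub> y\<parallel>\<^bsub>S\<^esub> \<le> K * \<parallel>x \<ominus>\<^bsub>S\<^esub> y\<parallel>\<^bsub>S\<^esub>" using xS yS by (intro mult_right_mono K) auto
    also have "\<dots> \<le> K * \<delta>" using y(2) K by (intro mult_left_mono) auto
    also have "\<dots> = e / 2" using K by (simp add: \<delta>_def)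
    finally have "C * \<parallel>x \<ominus>\<^bsub>S\<^esub> y\<parallel>\<^bsub>S\<^esub> \<le> e / 2" .
    then have "\<parallel>F x \<ominus>\<^bsub>S\<^esub> F y\<parallel>\<^bsub>S\<^esub> \<le> e / 2" "\<parallel>G y \<ominus>\<^bsub>S\<^esub> G x\<parallel>\<^bsub>S\<^esub> \<le> e / 2"
      using lip[OF xS yS] S.nrm_diff_commute[OF FG(2)[OF yS] FG(2)[OF xS]] by simp_all
    then show "\<parallel>F x \<ominus>\<^bsub>S\<^esub> G x\<parallel>\<^bsub>S\<^esub> \<le> 0 + e"
      using S.nrm_diff_triangle[OF Fx FG(1)[OF yS] Gx] eq[OF y(1)] by simp
  qed
  then show "\<parallel>F x \<ominus>\<^bsub>S\<^esub> G x\<parallel>\<^bsub>S\<^esub> = 0" using S.nrm_ge0[OF S.diff_in_carrier[OF Fx Gx]] by linarith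
qed

lemma mult_lipschitz:
  assumes "U \<in> carrier S" "y \<in> carrier S" "z \<in> carrier S"
  shows "\<parallel>U \<otimes>\<^bsub>S\<^esub> y \<ominus>\<^bsub>S\<^esub> U \<otimes>\<^bsub>S\<^esub> z\<parallel>\<^bsub>S\<^esub> \<le> \<parallel>U\<parallel>\<^bsub>S\<^esub> * \<parallel>y \<ominus>\<^bsub>S\<^esub> z\<parallel>\<^bsub>S\<^esub>"
    "\<parallel>y \<otimes>\<^bsub>S\<^esub> U \<ominus>\<^bsub>S\<^esub> z \<otimes>\<^bsub>S\<^esub> U\<parallel>\<^bsub>S\<^esub> \<le> \<parallel>U\<parallel>\<^bsub>S\<^esub> * \<parallel>y \<ominus>\<^bsub>S\<^esub> z\<parallel>\<^bsub>S\<^esub>"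
  using assms S.nrm_mult[of U "y \<ominus>\<^bsub>S\<^esub> z"] S.nrm_mult[of "y \<ominus>\<^bsub>S\<^esub> z" U]
  by (simp_all add: S.mult_diff_right[symmetric] S.mult_diff_left[symmetric] mult.commute)

lemma D_adj [simp]: "x \<in> carrier D \<Longrightarrow> x\<^sup>\<star>\<^bsub>S\<^esub> \<in> carrier D"
proof (rule D_map[where C = 1 and F = "adj S"])
  fix s assume "s \<in> corner_span"
  then have "s\<^sup>\<star>\<^bsub>S\<^esub> \<in> corner_span"
  proof (rule corner_span_map[where F = "adj S"])
    fix c Z d assume c: "c \<in> carrier A" "Z \<in> carrier S" "d \<in> carrier A"
    have "(\<kappa> c \<otimes>\<^bsub>S\<^esub> Z \<otimes>\<^bsub>S\<^esub> \<kappa> d)\<^sup>\<star>\<^bsub>S\<^esub> = \<kappa> (d\<^sup>\<star>) \<otimes>\<^bsub>S\<^esub> Z\<^sup>\<star>\<^bsub>S\<^esub> \<otimes>\<^bsub>S\<^esub> \<kappa> (c\<^sup>\<star>)"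
      using c by (simp add: S.adj_mult const_ops S.mult_assoc)
    then show "(\<kappa> c \<otimes>\<^bsub>S\<^esub> Z \<otimes>\<^bsub>S\<^esub> \<kappa> d)\<^sup>\<star>\<^bsub>S\<^esub> \<in> corner_span" using c by (simp add: corner_span_product)
  qed (simp_all add: S.adj_add)
  then show "s\<^sup>\<star>\<^bsub>S\<^esub> \<in> carrier D" by (rule corner_span_subset_D)
qed (simp_all add: S.nrm_adj_diff)

lemma D_smult [simp]: "x \<in> carrier D \<Longrightarrow> c \<odot>\<^bsub>S\<^esub> x \<in> carrier D"
proof (rule D_map[where C = "cmod c" and F = "\<lambda>x. c \<odot>\<^bsub>S\<^esub> x"])
  fix s assume "s \<in> corner_span"
  then have "c \<odot>\<^bsub>S\<^esub> s \<in> corner_span"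
  proof (rule corner_span_map[where F = "\<lambda>x. c \<odot>\<^bsub>S\<^esub> x"])
    fix a Z d assume a: "a \<in> carrier A" "Z \<in> carrier S" "d \<in> carrier A"
    have "c \<odot>\<^bsub>S\<^esub> (\<kappa> a \<otimes>\<^bsub>S\<^esub> Z \<otimes>\<^bsub>S\<^esub> \<kappa> d) = \<kappa> (c \<odot> a) \<otimes>\<^bsub>S\<^esub> Z \<otimes>\<^bsub>S\<^esub> \<kappa> d"
      using a by (simp add: S.smult_mult_left const_ops)
    then show "c \<odot>\<^bsub>S\<^esub> (\<kappa> a \<otimes>\<^bsub>S\<^esub> Z \<otimes>\<^bsub>S\<^esub> \<kappa> d) \<in> corner_span" using a by (simp add: corner_span_product)
  qed (simp_all add: S.smult_add_right)
  then show "c \<odot>\<^bsub>S\<^esub> s \<in> carrier D" by (rule corner_span_subset_D)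
qed (simp_all add: S.nrm_smult_diff)

lemma add_lipschitz:
  assumes "U \<in> carrier S" "y \<in> carrier S" "z \<in> carrier S"
  shows "\<parallel>(U \<oplus>\<^bsub>S\<^esub> y) \<ominus>\<^bsub>S\<^esub> (U \<oplus>\<^bsub>S\<^esub> z)\<parallel>\<^bsub>S\<^esub> \<le> 1 * \<parallel>y \<ominus>\<^bsub>S\<^esub> z\<parallel>\<^bsub>S\<^esub>"
  using assms S.nrm_add_diff_le[of U y U z] by simp

lemma D_add [simp]:
  assumes x: "x \<in> carrier D" and y: "y \<in> carrier D" shows "x \<oplus>\<^bsub>S\<^esub> y \<in> carrier D"
proof (rule D_map[OF y, of "\<lambda>y. x \<oplus>\<^bsub>S\<^esub> y", OF _ add_lipschitz])
  fix s assume s: "s \<in> corner_span"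
  have sS: "s \<in> carrier S" by (rule corner_span_in_carrier[OF s])
  have "s \<oplus>\<^bsub>S\<^esub> x \<in> carrier D"
    by (rule D_map[OF x, of "\<lambda>x. s \<oplus>\<^bsub>S\<^esub> x", OF _ add_lipschitz])
       (use s sS in \<open>auto intro: corner_span_subset_D corner_span_add\<close>)
  then show "x \<oplus>\<^bsub>S\<^esub> s \<in> carrier D" using x sS S.a_comm[of x s] by simp
qed (use x in auto)

lemma corner_span_mult: "\<lbrakk>s \<in> corner_span; t \<in> corner_span\<rbrakk> \<Longrightarrow> s \<otimes>\<^bsub>S\<^esub> t \<in> corner_span"
proof (rule corner_span_map[where F = "\<lambda>s. s \<otimes>\<^bsub>S\<^esub> t"])
  fix c Z d assume t: "t \<in> corner_span" and c: "c \<in> carrier A" "Z \<in> carrier S" "d \<in> carrier A"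
  show "\<kappa> c \<otimes>\<^bsub>S\<^esub> Z \<otimes>\<^bsub>S\<^esub> \<kappa> d \<otimes>\<^bsub>S\<^esub> t \<in> corner_span"
  proof (rule corner_span_map[OF t, where F = "\<lambda>t. \<kappa> c \<otimes>\<^bsub>S\<^esub> Z \<otimes>\<^bsub>S\<^esub> \<kappa> d \<otimes>\<^bsub>S\<^esub> t"])
    fix c' Z' d' assume c': "c' \<in> carrier A" "Z' \<in> carrier S" "d' \<in> carrier A"
    have "\<kappa> c \<otimes>\<^bsub>S\<^esub> Z \<otimes>\<^bsub>S\<^esub> \<kappa> d \<otimes>\<^bsub>S\<^esub> (\<kappa> c' \<otimes>\<^bsub>S\<^esub> Z' \<otimes>\<^bsub>S\<^esub> \<kappa> d')
        = \<kappa> c \<otimes>\<^bsub>S\<^esub> (Z \<otimes>\<^bsub>S\<^esub> \<kappa> d \<otimes>\<^bsub>S\<^esub> \<kappa> c' \<otimes>\<^bsub>S\<^esub> Z') \<otimes>\<^bsub>S\<^esub> \<kappa> d'"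
      using c c' by (simp add: S.mult_assoc)
    then show "\<kappa> c \<otimes>\<^bsub>S\<^esub> Z \<otimes>\<^bsub>S\<^esub> \<kappa> d \<otimes>\<^bsub>S\<^esub> (\<kappa> c' \<otimes>\<^bsub>S\<^esub> Z' \<otimes>\<^bsub>S\<^esub> \<kappa> d') \<in> corner_span"
      using c c' by (simp add: corner_span_product)
  qed (use c in \<open>simp_all add: S.distrib_left\<close>)
qed (auto simp: corner_span_in_carrier S.distrib_right)

lemma D_mult [simp]:
  assumes x: "x \<in> carrier D" and y: "y \<in> carrier D" shows "x \<otimes>\<^bsub>S\<^esub> y \<in> carrier D"
proof (rule D_map[OF y, of "\<lambda>y. x \<otimes>\<^bsub>S\<^esub> y", OF _ mult_lipschitz(1)])
  fix s assume s: "s \<in> corner_span"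
  have sS: "s \<in> carrier S" by (rule corner_span_in_carrier[OF s])
  show "x \<otimes>\<^bsub>S\<^esub> s \<in> carrier D"
    by (rule D_map[OF x, of "\<lambda>x. x \<otimes>\<^bsub>S\<^esub> s", OF _ mult_lipschitz(2)])
       (use s sS in \<open>auto intro: corner_span_subset_D corner_span_mult\<close>)
qed (use x in auto)

text \<open>
  The product \<open>e a e\<close> of constant sequences lies in the span and is close to
  \<open>a\<close> when \<open>e\<close> is almost a unit for \<open>a\<close>.
\<close>

lemma const_in_D [simp]:
  assumes a [simp]: "a \<in> carrier A" shows "\<kappa> a \<in> carrier D"
  unfolding D_iff
proof (intro conjI allI impI)
  fix r :: real assume r: "r > 0"
  obtain e where e [simp]: "e \<in> carrier A" and e1: "\<parallel>e\<parallel> \<le> 1"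
    and ea: "\<parallel>e \<otimes> a \<ominus> a\<parallel> < r / 2" "\<parallel>a \<otimes> e \<ominus> a\<parallel> < r / 2"
    using approx_unit_exists[of "{a}" "r / 2"] r by auto
  have "\<kappa> a \<ominus>\<^bsub>S\<^esub> \<kappa> e \<otimes>\<^bsub>S\<^esub> \<kappa> a \<otimes>\<^bsub>S\<^esub> \<kappa> e = \<kappa> (a \<ominus> e \<otimes> a \<otimes> e)" by (simp add: const_ops)
  moreover have "a \<ominus> e \<otimes> a \<otimes> e = (a \<ominus> e \<otimes> a) \<ominus> e \<otimes> (a \<otimes> e \<ominus> a)"
    using a e by algebra
  moreover have "\<parallel>e \<otimes> (a \<otimes> e \<ominus> a)\<parallel> \<le> 1 * \<parallel>a \<otimes> e \<ominus> a\<parallel>" using e1 by (intro nrm_mult_le_left) auto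
  ultimately have "\<parallel>\<kappa> a \<ominus>\<^bsub>S\<^esub> \<kappa> e \<otimes>\<^bsub>S\<^esub> \<kappa> a \<otimes>\<^bsub>S\<^esub> \<kappa> e\<parallel>\<^bsub>S\<^esub> < r"
    using ea nrm_diff_commute[of a "e \<otimes> a"] nrm_diff_le[of "a \<ominus> e \<otimes> a" "e \<otimes> (a \<otimes> e \<ominus> a)"] by simp
  then show "\<exists>y\<in>corner_span. \<parallel>\<kappa> a \<ominus>\<^bsub>S\<^esub> y\<parallel>\<^bsub>S\<^esub> < r"
    by (intro bexI[of _ "\<kappa> e \<otimes>\<^bsub>S\<^esub> \<kappa> a \<otimes>\<^bsub>S\<^esub> \<kappa> e"]) (auto intro: corner_span_product)
qed simp

lemma seq_action_in_D [simp]: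
  assumes h [simp]: "h \<in> carrier H" shows "x \<in> carrier D \<Longrightarrow> \<sigma> h x \<in> carrier D"
proof (rule D_map[where C = 1 and F = "\<sigma> h"])
  fix s assume "s \<in> corner_span"
  then have "\<sigma> h s \<in> corner_span"
    by (rule corner_span_map[where F = "\<sigma> h"]) (simp_all add: seq_action_ops corner_span_product)
  then show "\<sigma> h s \<in> carrier D" by (rule corner_span_subset_D)
qed (simp_all add: seq_action_ops(3)[symmetric] seq_action_nrm_le)

text \<open>
  The span is generated by products that begin with an element of \<open>A\<close>, so elements of
  \<open>A\<^sub>\<infinity>\<close> that agree on \<open>A\<close> agree on \<open>D\<close>.
\<close>

lemma D_left_eq:
  assumes U: "U \<in> carrier S" "V \<in> carrier S" and eq: "\<And>a. a \<in> carrier A \<Longrightarrow> U \<otimes>\<^bsub>S\<^esub> \<kappa> a = V \<otimes>\<^bsub>S\<^esub> \<kappa> a"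
    and x: "x \<in> carrier D"
  shows "U \<otimes>\<^bsub>S\<^esub> x = V \<otimes>\<^bsub>S\<^esub> x"
proof (rule D_equal[OF x, of "\<lambda>x. U \<otimes>\<^bsub>S\<^esub> x" "\<lambda>x. V \<otimes>\<^bsub>S\<^esub> x" "max \<parallel>U\<parallel>\<^bsub>S\<^esub> \<parallel>V\<parallel>\<^bsub>S\<^esub>"])
  fix y z assume yz: "y \<in> carrier S" "z \<in> carrier S"
  show "\<parallel>U \<otimes>\<^bsub>S\<^esub> y \<ominus>\<^bsub>S\<^esub> U \<otimes>\<^bsub>S\<^esub> z\<parallel>\<^bsub>S\<^esub> \<le> max \<parallel>U\<parallel>\<^bsub>S\<^esub> \<parallel>V\<parallel>\<^bsub>S\<^esub> * \<parallel>y \<ominus>\<^bsub>S\<^esub> z\<parallel>\<^bsub>S\<^esub>"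
    "\<parallel>V \<otimes>\<^bsub>S\<^esub> y \<ominus>\<^bsub>S\<^esub> V \<otimes>\<^bsub>S\<^esub> z\<parallel>\<^bsub>S\<^esub> \<le> max \<parallel>U\<parallel>\<^bsub>S\<^esub> \<parallel>V\<parallel>\<^bsub>S\<^esub> * \<parallel>y \<ominus>\<^bsub>S\<^esub> z\<parallel>\<^bsub>S\<^esub>"
    using yz U by (auto intro!: order_trans[OF mult_lipschitz(1)] mult_right_mono)
next
  fix s assume "s \<in> corner_span"
  then show "U \<otimes>\<^bsub>S\<^esub> s = V \<otimes>\<^bsub>S\<^esub> s"
  proof (induction rule: corner_span_induct)
    case (step c Z d s)
    have "U \<otimes>\<^bsub>S\<^esub> (\<kappa> c \<otimes>\<^bsub>S\<^esub> Z \<otimes>\<^bsub>S\<^esub> \<kappa> d) = V \<otimes>\<^bsub>S\<^esub> (\<kappa> c \<otimes>\<^bsub>S\<^esub> Z \<otimes>\<^bsub>S\<^esub> \<kappa> d)"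
      using step U by (simp add: S.mult_assoc[symmetric] eq)
    then show ?case using step U by (simp add: S.distrib_left)
  qed (use U in simp)
qed (use U in auto)

lemma D_right_eq:
  assumes U: "U \<in> carrier S" "V \<in> carrier S" and eq: "\<And>a. a \<in> carrier A \<Longrightarrow> \<kappa> a \<otimes>\<^bsub>S\<^esub> U = \<kappa> a \<otimes>\<^bsub>S\<^esub> V"
    and x: "x \<in> carrier D"
  shows "x \<otimes>\<^bsub>S\<^esub> U = x \<otimes>\<^bsub>S\<^esub> V"
proof -
  have "U\<^sup>\<star>\<^bsub>S\<^esub> \<otimes>\<^bsub>S\<^esub> x\<^sup>\<star>\<^bsub>S\<^esub> = V\<^sup>\<star>\<^bsub>S\<^esub> \<otimes>\<^bsub>S\<^esub> x\<^sup>\<star>\<^bsub>S\<^esub>"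
  proof (rule D_left_eq)
    fix a assume a: "a \<in> carrier A"
    have "(\<kappa> (a\<^sup>\<star>) \<otimes>\<^bsub>S\<^esub> U)\<^sup>\<star>\<^bsub>S\<^esub> = (\<kappa> (a\<^sup>\<star>) \<otimes>\<^bsub>S\<^esub> V)\<^sup>\<star>\<^bsub>S\<^esub>" using eq[of "a\<^sup>\<star>"] a by simp
    then show "U\<^sup>\<star>\<^bsub>S\<^esub> \<otimes>\<^bsub>S\<^esub> \<kappa> a = V\<^sup>\<star>\<^bsub>S\<^esub> \<otimes>\<^bsub>S\<^esub> \<kappa> a" using a U by (simp add: S.adj_mult const_ops S.adj_adj)
  qed (use U x in auto)
  then have "(x \<otimes>\<^bsub>S\<^esub> U)\<^sup>\<star>\<^bsub>S\<^esub> = (x \<otimes>\<^bsub>S\<^esub> V)\<^sup>\<star>\<^bsub>S\<^esub>" using U x by (simp add: S.adj_mult)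
  then have "((x \<otimes>\<^bsub>S\<^esub> U)\<^sup>\<star>\<^bsub>S\<^esub>)\<^sup>\<star>\<^bsub>S\<^esub> = ((x \<otimes>\<^bsub>S\<^esub> V)\<^sup>\<star>\<^bsub>S\<^esub>)\<^sup>\<star>\<^bsub>S\<^esub>" by simp
  then show ?thesis using U x by (subst (asm) (1 2) S.adj_adj) simp_all
qed

end

section \<open>Multiplier representations\<close>

context cstar_dynamical_system
begin

abbreviation \<M> :: "(((nat \<Rightarrow> 'a) set \<Rightarrow> (nat \<Rightarrow> 'a) set) \<times> ((nat \<Rightarrow> 'a) set \<Rightarrow> (nat \<Rightarrow> 'a) set)) cstar_struct" where
  "\<M> \<equiv> multiplier_algebra D"

definition normalizes :: "(nat \<Rightarrow> 'a) set \<Rightarrow> bool" where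
  "normalizes U \<longleftrightarrow> U \<in> carrier S \<and> (\<forall>x\<in>carrier D. U \<otimes>\<^bsub>S\<^esub> x \<in> carrier D \<and> x \<otimes>\<^bsub>S\<^esub> U \<in> carrier D)"

lemma normalizesD [simp]:
  "normalizes U \<Longrightarrow> U \<in> carrier S"
  "\<lbrakk>normalizes U; x \<in> carrier D\<rbrakk> \<Longrightarrow> U \<otimes>\<^bsub>S\<^esub> x \<in> carrier D"
  "\<lbrakk>normalizes U; x \<in> carrier D\<rbrakk> \<Longrightarrow> x \<otimes>\<^bsub>S\<^esub> U \<in> carrier D"
  by (simp_all add: normalizes_def)

lemma normalizes_mult [simp]: "\<lbrakk>normalizes U; normalizes V\<rbrakk> \<Longrightarrow> normalizes (U \<otimes>\<^bsub>S\<^esub> V)"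
  unfolding normalizes_def[of "U \<otimes>\<^bsub>S\<^esub> V"] by (simp add: S.mult_assoc) (simp add: S.mult_assoc[symmetric])

lemma normalizes_adj [simp]: assumes U: "normalizes U" shows "normalizes (U\<^sup>\<star>\<^bsub>S\<^esub>)"
  unfolding normalizes_def
proof (intro conjI ballI)
  fix x assume x: "x \<in> carrier D"
  have "U\<^sup>\<star>\<^bsub>S\<^esub> \<otimes>\<^bsub>S\<^esub> x = (x\<^sup>\<star>\<^bsub>S\<^esub> \<otimes>\<^bsub>S\<^esub> U)\<^sup>\<star>\<^bsub>S\<^esub>" "x \<otimes>\<^bsub>S\<^esub> U\<^sup>\<star>\<^bsub>S\<^esub> = (U \<otimes>\<^bsub>S\<^esub> x\<^sup>\<star>\<^bsub>S\<^esub>)\<^sup>\<star>\<^bsub>S\<^esub>"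
    using U x by (simp_all add: S.adj_mult S.adj_adj)
  then show "U\<^sup>\<star>\<^bsub>S\<^esub> \<otimes>\<^bsub>S\<^esub> x \<in> carrier D" "x \<otimes>\<^bsub>S\<^esub> U\<^sup>\<star>\<^bsub>S\<^esub> \<in> carrier D" using U x by simp_all
qed (use U in simp)

lemma normalizes_D [simp]: "x \<in> carrier D \<Longrightarrow> normalizes x"
  by (simp add: normalizes_def)

text \<open>
  An element \<open>U\<close> of \<open>A\<^sub>\<infinity>\<close> with \<open>U D\<close> and
  \<open>D U\<close> contained in \<open>D\<close>, regarded as a multiplier of \<open>D\<close>.
  All operations of the multiplier algebra that occur restrict to those of
  \<open>A\<^sub>\<infinity>\<close>.
\<close>

definition mult_op :: "(nat \<Rightarrow> 'a) set \<Rightarrow> ((nat \<Rightarrow> 'a) set \<Rightarrow> (nat \<Rightarrow> 'a) set) \<times> ((nat \<Rightarrow> 'a) set \<Rightarrow> (nat \<Rightarrow> 'a) set)" where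
  "mult_op U = (\<lambda>x\<in>carrier D. U \<otimes>\<^bsub>S\<^esub> x, \<lambda>x\<in>carrier D. x \<otimes>\<^bsub>S\<^esub> U)"

lemma multiplier_incl_mult_op: "multiplier_incl D x = mult_op x"
  by (simp add: multiplier_incl_def mult_op_def)

lemma mult_op_in_carrier: assumes U: "normalizes U" shows "mult_op U \<in> carrier \<M>"
proof -
  have "bounded_op D (\<lambda>x\<in>carrier D. U \<otimes>\<^bsub>S\<^esub> x)"
    unfolding bounded_op_def using U
    by (auto simp: S.distrib_left S.smult_mult_right intro!: exI[of _ "\<parallel>U\<parallel>\<^bsub>S\<^esub>"] S.nrm_mult)
  moreover have "bounded_op D (\<lambda>x\<in>carrier D. x \<otimes>\<^bsub>S\<^esub> U)"
    unfolding bounded_op_def using U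
    by (auto simp: S.distrib_right S.smult_mult_left intro!: exI[of _ "\<parallel>U\<parallel>\<^bsub>S\<^esub>"] order_trans[OF S.nrm_mult] simp: mult.commute)
  ultimately show ?thesis
    using U by (simp add: multiplier_algebra_def double_centralizers_def mult_op_def S.mult_assoc)
qed

lemma mult_op_mult: "\<lbrakk>normalizes U; normalizes V\<rbrakk> \<Longrightarrow> mult_op U \<otimes>\<^bsub>\<M>\<^esub> mult_op V = mult_op (U \<otimes>\<^bsub>S\<^esub> V)"
  by (auto simp: multiplier_algebra_def mult_op_def compose_def S.mult_assoc fun_eq_iff)

lemma mult_op_adj: "normalizes U \<Longrightarrow> (mult_op U)\<^sup>\<star>\<^bsub>\<M>\<^esub> = mult_op (U\<^sup>\<star>\<^bsub>S\<^esub>)"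
  by (auto simp: multiplier_algebra_def mult_op_def S.adj_mult S.adj_adj fun_eq_iff)

lemma mult_op_eqI:
  assumes "U \<in> carrier S" "V \<in> carrier S" "\<And>a. a \<in> carrier A \<Longrightarrow> U \<otimes>\<^bsub>S\<^esub> \<kappa> a = V \<otimes>\<^bsub>S\<^esub> \<kappa> a"
    "\<And>a. a \<in> carrier A \<Longrightarrow> \<kappa> a \<otimes>\<^bsub>S\<^esub> U = \<kappa> a \<otimes>\<^bsub>S\<^esub> V"
  shows "mult_op U = mult_op V"
  using D_left_eq[OF assms(1-3)] D_right_eq[OF assms(1,2,4)] by (auto simp: mult_op_def fun_eq_iff)

lemma mult_op_one:
  assumes "U \<in> carrier S" "\<And>a. a \<in> carrier A \<Longrightarrow> U \<otimes>\<^bsub>S\<^esub> \<kappa> a = \<kappa> a"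
    "\<And>a. a \<in> carrier A \<Longrightarrow> \<kappa> a \<otimes>\<^bsub>S\<^esub> U = \<kappa> a"
  shows "mult_op U = \<one>\<^bsub>\<M>\<^esub>"
proof -
  have "U \<otimes>\<^bsub>S\<^esub> x = x \<and> x \<otimes>\<^bsub>S\<^esub> U = x" if x: "x \<in> carrier D" for x
  proof -
    have *: "s \<in> corner_span \<Longrightarrow> U \<otimes>\<^bsub>S\<^esub> s = s \<and> s \<otimes>\<^bsub>S\<^esub> U = s" for s
    proof (induction rule: corner_span_induct)
      case (step c Z d s)
      have "U \<otimes>\<^bsub>S\<^esub> (\<kappa> c \<otimes>\<^bsub>S\<^esub> Z \<otimes>\<^bsub>S\<^esub> \<kappa> d) = \<kappa> c \<otimes>\<^bsub>S\<^esub> Z \<otimes>\<^bsub>S\<^esub> \<kappa> d"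
        using step assms(1,2) by (simp add: S.mult_assoc[symmetric])
      moreover have "\<kappa> c \<otimes>\<^bsub>S\<^esub> Z \<otimes>\<^bsub>S\<^esub> \<kappa> d \<otimes>\<^bsub>S\<^esub> U = \<kappa> c \<otimes>\<^bsub>S\<^esub> Z \<otimes>\<^bsub>S\<^esub> \<kappa> d"
        using step assms(1,3) by (simp add: S.mult_assoc)
      ultimately show ?case using step assms(1) by (simp add: S.distrib_left S.distrib_right)
    qed (use assms(1) in simp)
    have "\<parallel>U\<parallel>\<^bsub>S\<^esub> * r \<le> max 1 \<parallel>U\<parallel>\<^bsub>S\<^esub> * r" "1 * r \<le> max 1 \<parallel>U\<parallel>\<^bsub>S\<^esub> * r" if "r \<ge> 0" for r
      using that by (intro mult_right_mono; simp)+
    note bound = this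
    have "U \<otimes>\<^bsub>S\<^esub> x = x"
      using assms(1) *
      by (intro D_equal[OF x, of "\<lambda>x. U \<otimes>\<^bsub>S\<^esub> x" "\<lambda>x. x" "max 1 \<parallel>U\<parallel>\<^bsub>S\<^esub>"])
         (auto intro!: order_trans[OF mult_lipschitz(1)] bound(1) simp: bound(2)[simplified])
    moreover have "x \<otimes>\<^bsub>S\<^esub> U = x"
      using assms(1) *
      by (intro D_equal[OF x, of "\<lambda>x. x \<otimes>\<^bsub>S\<^esub> U" "\<lambda>x. x" "max 1 \<parallel>U\<parallel>\<^bsub>S\<^esub>"])
         (auto intro!: order_trans[OF mult_lipschitz(2)] bound(1) simp: bound(2)[simplified])
    ultimately show ?thesis by simp
  qed
  then show ?thesis by (auto simp: mult_op_def multiplier_algebra_def fun_eq_iff)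
qed

lemma inv_into_seq_action:
  assumes h [simp]: "h \<in> carrier H" and x [simp]: "x \<in> carrier D"
  shows "inv_into (carrier D) (\<sigma> h) x = \<sigma> (inv\<^bsub>H\<^esub> h) x"
proof -
  have "inj_on (\<sigma> h) (carrier D)"
    by (rule inj_on_inverseI[where g = "\<sigma> (inv\<^bsub>H\<^esub> h)"]) simp
  then have "inv_into (carrier D) (\<sigma> h) (\<sigma> h (\<sigma> (inv\<^bsub>H\<^esub> h) x)) = \<sigma> (inv\<^bsub>H\<^esub> h) x"
    by (rule inv_into_f_f) simp
  then show ?thesis by simp
qed

lemma multiplier_extend_mult_op:
  assumes h [simp]: "h \<in> carrier H" and U: "normalizes U"
  shows "multiplier_extend D (\<sigma> h) (mult_op U) = mult_op (\<sigma> h U)"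
  using U by (auto simp: multiplier_extend_def mult_op_def inv_into_seq_action seq_action_ops(2) fun_eq_iff)

text \<open>
  By \<open>X\<^sub>h a = \<alpha>\<^sub>h(a) X\<^sub>h\<close>, the element
  \<open>X\<^sub>h\<close> can be moved past the outer factors of the generators
  \<open>a Z b\<close> of \<open>D\<close> and absorbed into \<open>Z\<close>.
\<close>

lemma implementing_normalizes:
  assumes X: "implementing X" and h [simp]: "h \<in> carrier H" shows "normalizes (X h)"
  unfolding normalizes_def
proof (intro conjI ballI)
  note [simp] = implementingD(1)[OF X]
  show "X h \<in> carrier S" by simp
  fix x assume x: "x \<in> carrier D"
  show "X h \<otimes>\<^bsub>S\<^esub> x \<in> carrier D"
  proof (rule D_map[OF x, of "\<lambda>x. X h \<otimes>\<^bsub>S\<^esub> x", OF _ mult_lipschitz(1)])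
    fix s assume "s \<in> corner_span"
    then have "X h \<otimes>\<^bsub>S\<^esub> s \<in> corner_span"
    proof (rule corner_span_map[where F = "\<lambda>x. X h \<otimes>\<^bsub>S\<^esub> x"])
      fix c Z d assume c [simp]: "c \<in> carrier A" "Z \<in> carrier S" "d \<in> carrier A"
      have "X h \<otimes>\<^bsub>S\<^esub> (\<kappa> c \<otimes>\<^bsub>S\<^esub> Z \<otimes>\<^bsub>S\<^esub> \<kappa> d) = (X h \<otimes>\<^bsub>S\<^esub> \<kappa> c) \<otimes>\<^bsub>S\<^esub> Z \<otimes>\<^bsub>S\<^esub> \<kappa> d"
        by (simp add: S.mult_assoc)
      also have "\<dots> = \<kappa> (\<alpha> h c) \<otimes>\<^bsub>S\<^esub> (X h \<otimes>\<^bsub>S\<^esub> Z) \<otimes>\<^bsub>S\<^esub> \<kappa> d"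
        by (simp add: implementing_commute[OF X] S.mult_assoc)
      finally show "X h \<otimes>\<^bsub>S\<^esub> (\<kappa> c \<otimes>\<^bsub>S\<^esub> Z \<otimes>\<^bsub>S\<^esub> \<kappa> d) \<in> corner_span" by (simp add: corner_span_product)
    qed (simp_all add: S.distrib_left)
    then show "X h \<otimes>\<^bsub>S\<^esub> s \<in> carrier D" by (rule corner_span_subset_D)
  qed simp_all
  show "x \<otimes>\<^bsub>S\<^esub> X h \<in> carrier D"
  proof (rule D_map[OF x, of "\<lambda>x. x \<otimes>\<^bsub>S\<^esub> X h", OF _ mult_lipschitz(2)])
    fix s assume "s \<in> corner_span"
    then have "s \<otimes>\<^bsub>S\<^esub> X h \<in> corner_span"
    proof (rule corner_span_map[where F = "\<lambda>x. x \<otimes>\<^bsub>S\<^esub> X h"])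
      fix c Z d assume c [simp]: "c \<in> carrier A" "Z \<in> carrier S" "d \<in> carrier A"
      have "\<kappa> c \<otimes>\<^bsub>S\<^esub> Z \<otimes>\<^bsub>S\<^esub> \<kappa> d \<otimes>\<^bsub>S\<^esub> X h = \<kappa> c \<otimes>\<^bsub>S\<^esub> Z \<otimes>\<^bsub>S\<^esub> (\<kappa> (\<alpha> h (\<alpha> (inv\<^bsub>H\<^esub> h) d)) \<otimes>\<^bsub>S\<^esub> X h)"
        by (simp add: S.mult_assoc)
      also have "\<dots> = \<kappa> c \<otimes>\<^bsub>S\<^esub> (Z \<otimes>\<^bsub>S\<^esub> X h) \<otimes>\<^bsub>S\<^esub> \<kappa> (\<alpha> (inv\<^bsub>H\<^esub> h) d)"
        by (subst implementing_commute[OF X, symmetric]) (simp_all add: S.mult_assoc)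
      finally show "\<kappa> c \<otimes>\<^bsub>S\<^esub> Z \<otimes>\<^bsub>S\<^esub> \<kappa> d \<otimes>\<^bsub>S\<^esub> X h \<in> corner_span" by (simp add: corner_span_product)
    qed (simp_all add: S.distrib_right)
    then show "s \<otimes>\<^bsub>S\<^esub> X h \<in> carrier D" by (rule corner_span_subset_D)
  qed simp_all
qed

definition multiplier_representation where
  "multiplier_representation w \<longleftrightarrow> w \<in> hom H (unitary_group \<M>) \<and>
    (\<forall>h\<in>carrier H. \<forall>a\<in>carrier A.
      multiplier_incl D (\<kappa> (\<alpha> h a)) = w h \<otimes>\<^bsub>\<M>\<^esub> multiplier_incl D (\<kappa> a) \<otimes>\<^bsub>\<M>\<^esub> (w h)\<^sup>\<star>\<^bsub>\<M>\<^esub>) \<and>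
    (\<forall>g\<in>carrier H. \<forall>h\<in>carrier H.
      multiplier_extend D (\<sigma> h) (w g) = w (h \<otimes>\<^bsub>H\<^esub> g \<otimes>\<^bsub>H\<^esub> inv\<^bsub>H\<^esub> h))"

theorem multiplier_representation_if_implementing:
  assumes X: "implementing X" shows "multiplier_representation (\<lambda>h. mult_op (X h))"
  unfolding multiplier_representation_def
proof (intro conjI ballI)
  note [simp] = implementing_normalizes[OF X] implementingD(1)[OF X]
  show "(\<lambda>h. mult_op (X h)) \<in> hom H (unitary_group \<M>)"
  proof (rule homI)
    fix h assume h [simp]: "h \<in> carrier H"
    show "mult_op (X h) \<in> carrier (unitary_group \<M>)"
      by (simp add: unitary_group_def mult_op_in_carrier mult_op_adj mult_op_mult mult_op_one implementingD[OF X])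
    fix g assume g [simp]: "g \<in> carrier H"
    have "mult_op (X (h \<otimes>\<^bsub>H\<^esub> g)) = mult_op (X h \<otimes>\<^bsub>S\<^esub> X g)"
      by (rule mult_op_eqI) (simp_all add: implementingD[OF X])
    then show "mult_op (X (h \<otimes>\<^bsub>H\<^esub> g)) = mult_op (X h) \<otimes>\<^bsub>unitary_group \<M>\<^esub> mult_op (X g)"
      by (simp add: unitary_group_def mult_op_mult)
  qed
  fix h assume h [simp]: "h \<in> carrier H"
  show "multiplier_incl D (\<kappa> (\<alpha> h a)) = mult_op (X h) \<otimes>\<^bsub>\<M>\<^esub> multiplier_incl D (\<kappa> a) \<otimes>\<^bsub>\<M>\<^esub> (mult_op (X h))\<^sup>\<star>\<^bsub>\<M>\<^esub>"
    if "a \<in> carrier A" for a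
    using that by (simp add: multiplier_incl_mult_op mult_op_adj mult_op_mult implementingD(6)[OF X])
  fix g assume g [simp]: "g \<in> carrier H"
  show "multiplier_extend D (\<sigma> g) (mult_op (X h)) = mult_op (X (g \<otimes>\<^bsub>H\<^esub> h \<otimes>\<^bsub>H\<^esub> inv\<^bsub>H\<^esub> g))"
    by (simp add: multiplier_extend_mult_op, rule mult_op_eqI) (simp_all add: implementingD(9,10)[OF X])
qed

text \<open>
  Here \<open>snd (w h)\<close> is right multiplication by \<open>w\<^sub>h\<close>, so the family
  is \<open>a \<mapsto> a w\<^sub>h\<close>. The given relation
  \<open>\<alpha>\<^sub>h(a) = w\<^sub>h a w\<^sub>h*\<close> turns into
  \<open>x w\<^sub>h a = x \<alpha>\<^sub>h(a) w\<^sub>h\<close> for the right multiplications,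
  which gives the product formula. The adjoint of \<open>a w\<^sub>h\<close> is
  \<open>w\<^sub>h* a*\<close>, a left multiplication; it is brought into the form
  \<open>b w\<^sub>k\<close> by \<open>w\<^sub>k b = \<alpha>\<^sub>k(b) w\<^sub>k\<close>, an
  identity in \<open>D\<close> that holds after multiplication by elements of \<open>D\<close> and
  hence, by the C*-identity, without it.
\<close>

theorem covariant_family_if_multiplier_representation:
  assumes w: "multiplier_representation w"
  shows "covariant_family (\<lambda>h a. snd (w h) (\<kappa> a))"
proof -
  define L where "L h = fst (w h)" for h
  define R where "R h = snd (w h)" for h
  have wLR: "w h = (L h, R h)" for h by (simp add: L_def R_def)
  have wc: "w h \<in> carrier \<M>" and wu: "(w h)\<^sup>\<star>\<^bsub>\<M>\<^esub> \<otimes>\<^bsub>\<M>\<^esub> w h = \<one>\<^bsub>\<M>\<^esub>" "w h \<otimes>\<^bsub>\<M>\<^esub> (w h)\<^sup>\<star>\<^bsub>\<M>\<^esub> = \<one>\<^bsub>\<M>\<^esub>"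
    if "h \<in> carrier H" for h
    using w that by (auto simp: multiplier_representation_def hom_def unitary_group_def)
  have wm: "w (g \<otimes>\<^bsub>H\<^esub> h) = w g \<otimes>\<^bsub>\<M>\<^esub> w h" if "g \<in> carrier H" "h \<in> carrier H" for g h
    using w that by (auto simp: multiplier_representation_def hom_def unitary_group_def)
  have dc: "(L h, R h) \<in> double_centralizers D" if "h \<in> carrier H" for h
    using wc[OF that] by (simp add: wLR multiplier_algebra_def)
  have cl [simp]: "L h x \<in> carrier D" "R h x \<in> carrier D" if "h \<in> carrier H" "x \<in> carrier D" for h x
    using dc[OF that(1)] that(2) by (auto simp: double_centralizers_def bounded_op_def)
  have R_add: "R h (x \<oplus>\<^bsub>S\<^esub> y) = R h x \<oplus>\<^bsub>S\<^esub> R h y" and R_smult: "R h (c \<odot>\<^bsub>S\<^esub> x) = c \<odot>\<^bsub>S\<^esub> R h x"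
    and R_mult: "R h (x \<otimes>\<^bsub>S\<^esub> y) = x \<otimes>\<^bsub>S\<^esub> R h y" and L_mult: "L h (x \<otimes>\<^bsub>S\<^esub> y) = L h x \<otimes>\<^bsub>S\<^esub> y"
    and RL: "R h x \<otimes>\<^bsub>S\<^esub> y = x \<otimes>\<^bsub>S\<^esub> L h y"
    if "h \<in> carrier H" "x \<in> carrier D" "y \<in> carrier D" for h x y c
    using dc[OF that(1)] that(2,3) by (auto simp: double_centralizers_def bounded_op_def)
  \<comment> \<open>the left and right multiplications by \<open>w\<^sub>h*\<close>\<close>
  define L' where "L' h x = (R h (x\<^sup>\<star>\<^bsub>S\<^esub>))\<^sup>\<star>\<^bsub>S\<^esub>" for h x
  define R' where "R' h x = (L h (x\<^sup>\<star>\<^bsub>S\<^esub>))\<^sup>\<star>\<^bsub>S\<^esub>" for h x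
  have cl' [simp]: "L' h x \<in> carrier D" "R' h x \<in> carrier D" if "h \<in> carrier H" "x \<in> carrier D" for h x
    using that by (auto simp: L'_def R'_def)
  have inv: "L' h (L h x) = x" "R h (R' h x) = x" "L h (L' h x) = x" "R' h (R h x) = x"
    if "h \<in> carrier H" "x \<in> carrier D" for h x
    using arg_cong[OF wu(1)[OF that(1)], of "\<lambda>m. fst m x"] arg_cong[OF wu(1)[OF that(1)], of "\<lambda>m. snd m x"]
      arg_cong[OF wu(2)[OF that(1)], of "\<lambda>m. fst m x"] arg_cong[OF wu(2)[OF that(1)], of "\<lambda>m. snd m x"] that
    by (simp_all add: wLR multiplier_algebra_def compose_def L'_def R'_def)
  have LRm: "L (g \<otimes>\<^bsub>H\<^esub> h) x = L g (L h x)" "R (g \<otimes>\<^bsub>H\<^esub> h) x = R h (R g x)"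
    if "g \<in> carrier H" "h \<in> carrier H" "x \<in> carrier D" for g h x
    using wm[OF that(1,2)] that(3) by (auto simp: wLR multiplier_algebra_def compose_def)
  have one: "L \<one>\<^bsub>H\<^esub> x = x" "R \<one>\<^bsub>H\<^esub> x = x" if x: "x \<in> carrier D" for x
  proof -
    have o: "\<one>\<^bsub>H\<^esub> \<in> carrier H" by simp
    have "L \<one>\<^bsub>H\<^esub> (L \<one>\<^bsub>H\<^esub> x) = L \<one>\<^bsub>H\<^esub> x" "R \<one>\<^bsub>H\<^esub> (R \<one>\<^bsub>H\<^esub> x) = R \<one>\<^bsub>H\<^esub> x" using LRm[OF o o x] by simp_all
    then show "L \<one>\<^bsub>H\<^esub> x = x" "R \<one>\<^bsub>H\<^esub> x = x"
      using inv(1)[OF o, of "L \<one>\<^bsub>H\<^esub> x"] inv(1)[OF o x] inv(4)[OF o, of "R \<one>\<^bsub>H\<^esub> x"] inv(4)[OF o x] x o by simp_all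
  qed
  have cov: "\<kappa> (\<alpha> h a) \<otimes>\<^bsub>S\<^esub> x = L h (\<kappa> a \<otimes>\<^bsub>S\<^esub> L' h x)" "x \<otimes>\<^bsub>S\<^esub> \<kappa> (\<alpha> h a) = R' h (R h x \<otimes>\<^bsub>S\<^esub> \<kappa> a)"
    if "h \<in> carrier H" "a \<in> carrier A" "x \<in> carrier D" for h a x
  proof -
    have eq: "multiplier_incl D (\<kappa> (\<alpha> h a)) = w h \<otimes>\<^bsub>\<M>\<^esub> multiplier_incl D (\<kappa> a) \<otimes>\<^bsub>\<M>\<^esub> (w h)\<^sup>\<star>\<^bsub>\<M>\<^esub>"
      using w that by (simp add: multiplier_representation_def)
    show "\<kappa> (\<alpha> h a) \<otimes>\<^bsub>S\<^esub> x = L h (\<kappa> a \<otimes>\<^bsub>S\<^esub> L' h x)"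
      using arg_cong[OF eq, of "\<lambda>m. fst m x"] that
      by (simp add: wLR multiplier_algebra_def compose_def multiplier_incl_def L'_def[symmetric])
    show "x \<otimes>\<^bsub>S\<^esub> \<kappa> (\<alpha> h a) = R' h (R h x \<otimes>\<^bsub>S\<^esub> \<kappa> a)"
      using arg_cong[OF eq, of "\<lambda>m. snd m x"] that
      by (simp add: wLR multiplier_algebra_def compose_def multiplier_incl_def R'_def[symmetric])
  qed
  have star: "R h x \<otimes>\<^bsub>S\<^esub> \<kappa> a = R h (x \<otimes>\<^bsub>S\<^esub> \<kappa> (\<alpha> h a))" if "h \<in> carrier H" "a \<in> carrier A" "x \<in> carrier D" for h a x
    using cov(2)[OF that] that inv(2)[of h "R h x \<otimes>\<^bsub>S\<^esub> \<kappa> a"] by simp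
  have LR: "L k (\<kappa> b) = R k (\<kappa> (\<alpha> k b))" if k [simp]: "k \<in> carrier H" and b [simp]: "b \<in> carrier A" for k b
  proof -
    let ?u = "R k (\<kappa> (\<alpha> k b))" and ?v = "L k (\<kappa> b)"
    have uv: "?u \<in> carrier D" "?v \<in> carrier D" by simp_all
    have *: "?u \<otimes>\<^bsub>S\<^esub> y = ?v \<otimes>\<^bsub>S\<^esub> y" if y [simp]: "y \<in> carrier D" for y
      using cov(1)[OF k b, of "L k y"] inv(1)[OF k y] by (simp add: RL L_mult)
    have "(?u \<ominus>\<^bsub>S\<^esub> ?v) \<otimes>\<^bsub>S\<^esub> (?u \<ominus>\<^bsub>S\<^esub> ?v)\<^sup>\<star>\<^bsub>S\<^esub>
        = (?u \<otimes>\<^bsub>S\<^esub> ?u\<^sup>\<star>\<^bsub>S\<^esub> \<ominus>\<^bsub>S\<^esub> ?v \<otimes>\<^bsub>S\<^esub> ?u\<^sup>\<star>\<^bsub>S\<^esub>) \<ominus>\<^bsub>S\<^esub> (?u \<otimes>\<^bsub>S\<^esub> ?v\<^sup>\<star>\<^bsub>S\<^esub> \<ominus>\<^bsub>S\<^esub> ?v \<otimes>\<^bsub>S\<^esub> ?v\<^sup>\<star>\<^bsub>S\<^esub>)"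
      using uv by (simp add: S.mult_diff_left S.mult_diff_right S.minus_eq S.adj_add S.distrib_left S.distrib_right S.minus_add S.a_ac)
    also have "\<dots> = \<zero>\<^bsub>S\<^esub>" using uv by (simp add: *)
    finally have "\<parallel>?u \<ominus>\<^bsub>S\<^esub> ?v\<parallel>\<^bsub>S\<^esub> = 0" using S.nrm_cstar'[of "?u \<ominus>\<^bsub>S\<^esub> ?v"] uv by simp
    then have "?u = ?v" by (rule S.eq_if_diff_zero[OF D_in_carrier[OF uv(1)] D_in_carrier[OF uv(2)]])
    then show ?thesis ..
  qed
  have "covariant_family (\<lambda>h a. R h (\<kappa> a))"
    unfolding covariant_family_def
  proof (intro conjI ballI allI)
    fix h a assume h [simp]: "h \<in> carrier H" and a [simp]: "a \<in> carrier A"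
    show "R h (\<kappa> a) \<in> carrier S" by simp
    show "R h (\<kappa> (c \<odot> a)) = c \<odot>\<^bsub>S\<^esub> R h (\<kappa> a)" for c by (simp add: const_ops R_smult[OF h, of "\<kappa> a" "\<kappa> a"])
    show "R h (\<kappa> (a \<oplus> b)) = R h (\<kappa> a) \<oplus>\<^bsub>S\<^esub> R h (\<kappa> b)" if "b \<in> carrier A" for b
      using that by (simp add: const_ops R_add)
    have hi: "inv\<^bsub>H\<^esub> h \<in> carrier H" by simp
    have "(R h (\<kappa> a))\<^sup>\<star>\<^bsub>S\<^esub> = L' h (\<kappa> (a\<^sup>\<star>))" by (simp add: L'_def const_ops S.adj_adj)
    also have "\<dots> = L' h (L h (L (inv\<^bsub>H\<^esub> h) (\<kappa> (a\<^sup>\<star>))))" using LRm(1)[OF h hi, of "\<kappa> (a\<^sup>\<star>)"] by (simp add: one)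
    also have "\<dots> = L (inv\<^bsub>H\<^esub> h) (\<kappa> (a\<^sup>\<star>))" by (simp add: inv)
    also have "\<dots> = R (inv\<^bsub>H\<^esub> h) (\<kappa> (\<alpha> (inv\<^bsub>H\<^esub> h) (a\<^sup>\<star>)))" by (simp add: LR)
    finally show "(R h (\<kappa> a))\<^sup>\<star>\<^bsub>S\<^esub> = R (inv\<^bsub>H\<^esub> h) (\<kappa> (\<alpha> (inv\<^bsub>H\<^esub> h) (a\<^sup>\<star>)))" .
  next
    fix g h a assume g [simp]: "g \<in> carrier H" and h [simp]: "h \<in> carrier H" and a [simp]: "a \<in> carrier A"
    have "multiplier_extend D (\<sigma> g) (w h) = w (g \<otimes>\<^bsub>H\<^esub> h \<otimes>\<^bsub>H\<^esub> inv\<^bsub>H\<^esub> g)"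
      using w by (simp add: multiplier_representation_def)
    from arg_cong[OF this, of "\<lambda>m. snd m (\<kappa> (\<alpha> g a))"]
    show "\<sigma> g (R h (\<kappa> a)) = R (g \<otimes>\<^bsub>H\<^esub> h \<otimes>\<^bsub>H\<^esub> inv\<^bsub>H\<^esub> g) (\<kappa> (\<alpha> g a))"
      by (simp add: wLR multiplier_extend_def inv_into_seq_action)
    fix b assume b [simp]: "b \<in> carrier A"
    have "R g (\<kappa> a) \<otimes>\<^bsub>S\<^esub> R h (\<kappa> b) = R h (R g (\<kappa> a) \<otimes>\<^bsub>S\<^esub> \<kappa> b)" by (simp add: R_mult)
    also have "\<dots> = R (g \<otimes>\<^bsub>H\<^esub> h) (\<kappa> (a \<otimes> \<alpha> g b))" by (simp add: star LRm const_ops)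
    finally show "R g (\<kappa> a) \<otimes>\<^bsub>S\<^esub> R h (\<kappa> b) = R (g \<otimes>\<^bsub>H\<^esub> h) (\<kappa> (a \<otimes> \<alpha> g b))" .
  qed (simp add: one)
  then show ?thesis by (simp add: R_def)
qed

end

section \<open>The convolution algebra\<close>

context cstar_dynamical_system
begin

abbreviation C :: "('h \<Rightarrow> 'a) cstar_struct" where "C \<equiv> full_conv_algebra H A \<alpha>"

abbreviation supp :: "('h \<Rightarrow> 'a) \<Rightarrow> 'h set" where
  "supp f \<equiv> {t \<in> carrier H. f t \<noteq> \<zero>}"

text \<open>The element \<open>a \<delta>\<^sub>t\<close>.\<close>

definition single :: "'h \<Rightarrow> 'a \<Rightarrow> 'h \<Rightarrow> 'a" where
  "single t a = (\<lambda>s\<in>carrier H. if s = t then a else \<zero>)"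

lemma conv_simps:
  "f \<otimes>\<^bsub>C\<^esub> g = (\<lambda>s\<in>carrier H. \<Oplus>t\<in>supp f. f t \<otimes> \<alpha> t (g (inv\<^bsub>H\<^esub> t \<otimes>\<^bsub>H\<^esub> s)))"
  "f \<oplus>\<^bsub>C\<^esub> g = (\<lambda>s\<in>carrier H. f s \<oplus> g s)" "\<zero>\<^bsub>C\<^esub> = (\<lambda>s\<in>carrier H. \<zero>)"
  "c \<odot>\<^bsub>C\<^esub> f = (\<lambda>s\<in>carrier H. c \<odot> f s)"
  "f\<^sup>\<star>\<^bsub>C\<^esub> = (\<lambda>s\<in>carrier H. \<alpha> s ((f (inv\<^bsub>H\<^esub> s))\<^sup>\<star>))" "\<parallel>f\<parallel>\<^bsub>C\<^esub> = full_norm H A \<alpha> f"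
  by (simp_all add: full_conv_algebra_def conv_algebra_def)

lemma conv_carrier:
  "f \<in> carrier C \<longleftrightarrow> f \<in> carrier H \<rightarrow>\<^sub>E carrier A \<and> finite (supp f)"
  by (simp add: full_conv_algebra_def conv_algebra_def)

lemma conv_value [simp]: "\<lbrakk>f \<in> carrier C; t \<in> carrier H\<rbrakk> \<Longrightarrow> f t \<in> carrier A"
  by (auto simp: conv_carrier)

lemma conv_finite_supp: "f \<in> carrier C \<Longrightarrow> finite (supp f)"
  by (simp add: conv_carrier)

lemma conv_eqI:
  assumes "f \<in> carrier C" "g \<in> carrier C" "\<And>s. s \<in> carrier H \<Longrightarrow> f s = g s"
  shows "f = g"
  using assms by (auto simp: conv_carrier intro: PiE_ext)

lemma conv_apply [simp]:
  assumes "s \<in> carrier H"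
  shows "(f \<oplus>\<^bsub>C\<^esub> g) s = f s \<oplus> g s" "\<zero>\<^bsub>C\<^esub> s = \<zero>" "(c \<odot>\<^bsub>C\<^esub> f) s = c \<odot> f s"
    "(f\<^sup>\<star>\<^bsub>C\<^esub>) s = \<alpha> s ((f (inv\<^bsub>H\<^esub> s))\<^sup>\<star>)" "single t a s = (if s = t then a else \<zero>)"
  using assms by (simp_all add: conv_simps single_def)

lemma conv_restrict_in_carrier:
  assumes "\<And>s. s \<in> carrier H \<Longrightarrow> F s \<in> carrier A" "finite T" "\<And>s. \<lbrakk>s \<in> carrier H; s \<notin> T\<rbrakk> \<Longrightarrow> F s = \<zero>"
  shows "(\<lambda>s\<in>carrier H. F s) \<in> carrier C"
proof -
  have "supp (\<lambda>s\<in>carrier H. F s) \<subseteq> T" using assms(3) by auto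
  then have "finite (supp (\<lambda>s\<in>carrier H. F s))" using assms(2) by (rule finite_subset)
  then show ?thesis using assms(1) unfolding conv_carrier by simp
qed

lemma conv_zero_closed [simp]: "\<zero>\<^bsub>C\<^esub> \<in> carrier C"
  unfolding conv_simps by (rule conv_restrict_in_carrier[of _ "{}"]) auto

lemma single_closed [simp]: "a \<in> carrier A \<Longrightarrow> single t a \<in> carrier C"
  unfolding single_def by (rule conv_restrict_in_carrier[of _ "{t}"]) auto

lemma conv_add_closed [simp]:
  assumes "f \<in> carrier C" "g \<in> carrier C" shows "f \<oplus>\<^bsub>C\<^esub> g \<in> carrier C"
  unfolding conv_simps using assms conv_finite_supp[OF assms(1)] conv_finite_supp[OF assms(2)]
  by (intro conv_restrict_in_carrier[of _ "supp f \<union> supp g"]) auto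

lemma conv_smult_closed [simp]:
  assumes "f \<in> carrier C" shows "c \<odot>\<^bsub>C\<^esub> f \<in> carrier C"
  unfolding conv_simps using assms conv_finite_supp[OF assms]
  by (intro conv_restrict_in_carrier[of _ "supp f"]) auto

lemma conv_adj_closed [simp]:
  assumes f: "f \<in> carrier C" shows "f\<^sup>\<star>\<^bsub>C\<^esub> \<in> carrier C"
  unfolding conv_simps
proof (rule conv_restrict_in_carrier[of _ "(\<lambda>t. inv\<^bsub>H\<^esub> t) ` supp f"])
  fix s assume s: "s \<in> carrier H" "s \<notin> (\<lambda>t. inv\<^bsub>H\<^esub> t) ` supp f"
  have "f (inv\<^bsub>H\<^esub> s) = \<zero>"
  proof (rule ccontr)
    assume "f (inv\<^bsub>H\<^esub> s) \<noteq> \<zero>"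
    then have "inv\<^bsub>H\<^esub> (inv\<^bsub>H\<^esub> s) \<in> (\<lambda>t. inv\<^bsub>H\<^esub> t) ` supp f" using s by blast
    then show False using s by simp
  qed
  then show "\<alpha> s ((f (inv\<^bsub>H\<^esub> s))\<^sup>\<star>) = \<zero>" using s by simp
qed (use f conv_finite_supp[OF f] in auto)

lemma conv_term_closed [simp]:
  "\<lbrakk>f \<in> carrier C; g \<in> carrier C; t \<in> carrier H; s \<in> carrier H\<rbrakk>
    \<Longrightarrow> f t \<otimes> \<alpha> t (g (inv\<^bsub>H\<^esub> t \<otimes>\<^bsub>H\<^esub> s)) \<in> carrier A"
  by simp

lemma conv_mult_apply:
  assumes f: "f \<in> carrier C" and g: "g \<in> carrier C" and s: "s \<in> carrier H"
    and T: "finite T" "T \<subseteq> carrier H" "supp f \<subseteq> T"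
  shows "(f \<otimes>\<^bsub>C\<^esub> g) s = (\<Oplus>t\<in>T. f t \<otimes> \<alpha> t (g (inv\<^bsub>H\<^esub> t \<otimes>\<^bsub>H\<^esub> s)))"
proof -
  have "(\<Oplus>t\<in>supp f. f t \<otimes> \<alpha> t (g (inv\<^bsub>H\<^esub> t \<otimes>\<^bsub>H\<^esub> s))) = (\<Oplus>t\<in>T. f t \<otimes> \<alpha> t (g (inv\<^bsub>H\<^esub> t \<otimes>\<^bsub>H\<^esub> s)))"
  proof (rule M.add.finprod_mono_neutral_cong_left)
    fix t assume "t \<in> T - supp f"
    then show "f t \<otimes> \<alpha> t (g (inv\<^bsub>H\<^esub> t \<otimes>\<^bsub>H\<^esub> s)) = \<zero>" using T g s by auto
  qed (use T f g s in auto)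
  then show ?thesis using s by (simp add: conv_simps)
qed

lemma conv_mult_closed [simp]:
  assumes f: "f \<in> carrier C" and g: "g \<in> carrier C"
  shows "f \<otimes>\<^bsub>C\<^esub> g \<in> carrier C"
  unfolding conv_simps
proof (rule conv_restrict_in_carrier[of _ "(\<lambda>(t, u). t \<otimes>\<^bsub>H\<^esub> u) ` (supp f \<times> supp g)"])
  show "finite ((\<lambda>(t, u). t \<otimes>\<^bsub>H\<^esub> u) ` (supp f \<times> supp g))"
    using conv_finite_supp[OF f] conv_finite_supp[OF g] by simp
  fix s assume s: "s \<in> carrier H"
  show "(\<Oplus>t\<in>supp f. f t \<otimes> \<alpha> t (g (inv\<^bsub>H\<^esub> t \<otimes>\<^bsub>H\<^esub> s))) \<in> carrier A"
    using f g s by (intro M.finsum_closed) auto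
  assume ns: "s \<notin> (\<lambda>(t, u). t \<otimes>\<^bsub>H\<^esub> u) ` (supp f \<times> supp g)"
  show "(\<Oplus>t\<in>supp f. f t \<otimes> \<alpha> t (g (inv\<^bsub>H\<^esub> t \<otimes>\<^bsub>H\<^esub> s))) = \<zero>"
  proof (rule M.add.finprod_one_eqI)
    fix t assume t: "t \<in> supp f"
    have "g (inv\<^bsub>H\<^esub> t \<otimes>\<^bsub>H\<^esub> s) = \<zero>"
    proof (rule ccontr)
      assume "g (inv\<^bsub>H\<^esub> t \<otimes>\<^bsub>H\<^esub> s) \<noteq> \<zero>"
      then have "(t, inv\<^bsub>H\<^esub> t \<otimes>\<^bsub>H\<^esub> s) \<in> supp f \<times> supp g" using t s by simp
      moreover have "s = t \<otimes>\<^bsub>H\<^esub> (inv\<^bsub>H\<^esub> t \<otimes>\<^bsub>H\<^esub> s)" using t s by (simp add: H.m_assoc[symmetric])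
      ultimately show False using ns by force
    qed
    then show "f t \<otimes> \<alpha> t (g (inv\<^bsub>H\<^esub> t \<otimes>\<^bsub>H\<^esub> s)) = \<zero>" using t f by simp
  qed
qed

lemma conv_abelian_group: "abelian_group C"
proof (rule abelian_groupI)
  fix f g k assume f: "f \<in> carrier C" and g: "g \<in> carrier C" and k: "k \<in> carrier C"
  show "f \<oplus>\<^bsub>C\<^esub> g \<oplus>\<^bsub>C\<^esub> k = f \<oplus>\<^bsub>C\<^esub> (g \<oplus>\<^bsub>C\<^esub> k)"
    using f g k by (intro conv_eqI) (simp_all add: a_assoc)
next
  fix f g assume f: "f \<in> carrier C" and g: "g \<in> carrier C"
  show "f \<oplus>\<^bsub>C\<^esub> g = g \<oplus>\<^bsub>C\<^esub> f" using f g by (auto simp: conv_simps a_comm)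
next
  fix f assume f: "f \<in> carrier C"
  show "\<zero>\<^bsub>C\<^esub> \<oplus>\<^bsub>C\<^esub> f = f"
    using f by (intro conv_eqI) simp_all
  have "(-1) \<odot>\<^bsub>C\<^esub> f \<oplus>\<^bsub>C\<^esub> f = \<zero>\<^bsub>C\<^esub>"
    using f by (intro conv_eqI) (simp_all add: minus_smult[symmetric] l_neg)
  then show "\<exists>g\<in>carrier C. g \<oplus>\<^bsub>C\<^esub> f = \<zero>\<^bsub>C\<^esub>"
    using f conv_smult_closed[OF f] by blast
qed auto

lemma conv_module: "module complex_ring C"
proof (rule moduleI[OF R.is_cring conv_abelian_group])
  fix f assume f: "f \<in> carrier C"
  show "\<one>\<^bsub>complex_ring\<^esub> \<odot>\<^bsub>C\<^esub> f = f"
    using f by (intro conv_eqI) simp_all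
  fix c d
  show "(c \<oplus>\<^bsub>complex_ring\<^esub> d) \<odot>\<^bsub>C\<^esub> f = c \<odot>\<^bsub>C\<^esub> f \<oplus>\<^bsub>C\<^esub> d \<odot>\<^bsub>C\<^esub> f"
    using f by (intro conv_eqI) (simp_all add: smult_add_left)
  show "(c \<otimes>\<^bsub>complex_ring\<^esub> d) \<odot>\<^bsub>C\<^esub> f = c \<odot>\<^bsub>C\<^esub> (d \<odot>\<^bsub>C\<^esub> f)"
    using f by (intro conv_eqI) (simp_all add: smult_smult)
  fix g assume g: "g \<in> carrier C"
  show "c \<odot>\<^bsub>C\<^esub> (f \<oplus>\<^bsub>C\<^esub> g) = c \<odot>\<^bsub>C\<^esub> f \<oplus>\<^bsub>C\<^esub> c \<odot>\<^bsub>C\<^esub> g"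
    using f g by (intro conv_eqI) (simp_all add: smult_add_right)
qed auto

lemma conv_distrib:
  assumes f: "f \<in> carrier C" and g: "g \<in> carrier C" and k: "k \<in> carrier C"
  shows "(f \<oplus>\<^bsub>C\<^esub> g) \<otimes>\<^bsub>C\<^esub> k = f \<otimes>\<^bsub>C\<^esub> k \<oplus>\<^bsub>C\<^esub> g \<otimes>\<^bsub>C\<^esub> k"
    "k \<otimes>\<^bsub>C\<^esub> (f \<oplus>\<^bsub>C\<^esub> g) = k \<otimes>\<^bsub>C\<^esub> f \<oplus>\<^bsub>C\<^esub> k \<otimes>\<^bsub>C\<^esub> g"
proof -
  let ?T = "supp f \<union> supp g"
  have T: "finite ?T" "?T \<subseteq> carrier H" using conv_finite_supp[OF f] conv_finite_supp[OF g] by auto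
  have fg: "f \<oplus>\<^bsub>C\<^esub> g \<in> carrier C" using f g by simp
  show "(f \<oplus>\<^bsub>C\<^esub> g) \<otimes>\<^bsub>C\<^esub> k = f \<otimes>\<^bsub>C\<^esub> k \<oplus>\<^bsub>C\<^esub> g \<otimes>\<^bsub>C\<^esub> k"
  proof (rule conv_eqI)
    fix s assume s: "s \<in> carrier H"
    have sT: "supp (f \<oplus>\<^bsub>C\<^esub> g) \<subseteq> ?T" by (auto simp: conv_simps)
    have "((f \<oplus>\<^bsub>C\<^esub> g) \<otimes>\<^bsub>C\<^esub> k) s
        = (\<Oplus>t\<in>?T. (f \<oplus>\<^bsub>C\<^esub> g) t \<otimes> \<alpha> t (k (inv\<^bsub>H\<^esub> t \<otimes>\<^bsub>H\<^esub> s)))"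
      by (rule conv_mult_apply[OF fg k s T sT])
    also have "\<dots> = (\<Oplus>t\<in>?T. f t \<otimes> \<alpha> t (k (inv\<^bsub>H\<^esub> t \<otimes>\<^bsub>H\<^esub> s)) \<oplus> g t \<otimes> \<alpha> t (k (inv\<^bsub>H\<^esub> t \<otimes>\<^bsub>H\<^esub> s)))"
      using f g k s by (intro M.finsum_cong') (auto simp: distrib_right)
    also have "\<dots> = (\<Oplus>t\<in>?T. f t \<otimes> \<alpha> t (k (inv\<^bsub>H\<^esub> t \<otimes>\<^bsub>H\<^esub> s))) \<oplus> (\<Oplus>t\<in>?T. g t \<otimes> \<alpha> t (k (inv\<^bsub>H\<^esub> t \<otimes>\<^bsub>H\<^esub> s)))"
      using f g k s by (intro M.finsum_addf) auto
    also have "\<dots> = (f \<otimes>\<^bsub>C\<^esub> k) s \<oplus> (g \<otimes>\<^bsub>C\<^esub> k) s"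
      using conv_mult_apply[OF f k s T] conv_mult_apply[OF g k s T] by simp
    finally show "((f \<oplus>\<^bsub>C\<^esub> g) \<otimes>\<^bsub>C\<^esub> k) s = (f \<otimes>\<^bsub>C\<^esub> k \<oplus>\<^bsub>C\<^esub> g \<otimes>\<^bsub>C\<^esub> k) s"
      using s by simp
  qed (use f g k in simp_all)
  show "k \<otimes>\<^bsub>C\<^esub> (f \<oplus>\<^bsub>C\<^esub> g) = k \<otimes>\<^bsub>C\<^esub> f \<oplus>\<^bsub>C\<^esub> k \<otimes>\<^bsub>C\<^esub> g"
  proof (rule conv_eqI)
    fix s assume s: "s \<in> carrier H"
    let ?T = "supp k"
    have T: "finite ?T" "?T \<subseteq> carrier H" "?T \<subseteq> ?T" using conv_finite_supp[OF k] by auto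
    have "(k \<otimes>\<^bsub>C\<^esub> (f \<oplus>\<^bsub>C\<^esub> g)) s
        = (\<Oplus>t\<in>?T. k t \<otimes> \<alpha> t ((f \<oplus>\<^bsub>C\<^esub> g) (inv\<^bsub>H\<^esub> t \<otimes>\<^bsub>H\<^esub> s)))"
      by (rule conv_mult_apply[OF k fg s T])
    also have "\<dots> = (\<Oplus>t\<in>?T. k t \<otimes> \<alpha> t (f (inv\<^bsub>H\<^esub> t \<otimes>\<^bsub>H\<^esub> s)) \<oplus> k t \<otimes> \<alpha> t (g (inv\<^bsub>H\<^esub> t \<otimes>\<^bsub>H\<^esub> s)))"
      using f g k s by (intro M.finsum_cong') (auto simp: distrib_left act_add)
    also have "\<dots> = (\<Oplus>t\<in>?T. k t \<otimes> \<alpha> t (f (inv\<^bsub>H\<^esub> t \<otimes>\<^bsub>H\<^esub> s))) \<oplus> (\<Oplus>t\<in>?T. k t \<otimes> \<alpha> t (g (inv\<^bsub>H\<^esub> t \<otimes>\<^bsub>H\<^esub> s)))"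
      using f g k s by (intro M.finsum_addf) auto
    also have "\<dots> = (k \<otimes>\<^bsub>C\<^esub> f) s \<oplus> (k \<otimes>\<^bsub>C\<^esub> g) s"
      using conv_mult_apply[OF k f s T] conv_mult_apply[OF k g s T] by simp
    finally show "(k \<otimes>\<^bsub>C\<^esub> (f \<oplus>\<^bsub>C\<^esub> g)) s = (k \<otimes>\<^bsub>C\<^esub> f \<oplus>\<^bsub>C\<^esub> k \<otimes>\<^bsub>C\<^esub> g) s"
      using s by simp
  qed (use f g k in simp_all)
qed

lemma conv_mult_zero:
  assumes f: "f \<in> carrier C"
  shows "\<zero>\<^bsub>C\<^esub> \<otimes>\<^bsub>C\<^esub> f = \<zero>\<^bsub>C\<^esub>" "f \<otimes>\<^bsub>C\<^esub> \<zero>\<^bsub>C\<^esub> = \<zero>\<^bsub>C\<^esub>"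
proof -
  interpret C: abelian_group C by (rule conv_abelian_group)
  have z: "x = \<zero>\<^bsub>C\<^esub>" if "x \<in> carrier C" "x = x \<oplus>\<^bsub>C\<^esub> x" for x
    using that C.add.l_cancel_one'[of x x] by simp
  show "\<zero>\<^bsub>C\<^esub> \<otimes>\<^bsub>C\<^esub> f = \<zero>\<^bsub>C\<^esub>"
    using conv_distrib(1)[OF conv_zero_closed conv_zero_closed f] f by (intro z) simp_all
  show "f \<otimes>\<^bsub>C\<^esub> \<zero>\<^bsub>C\<^esub> = \<zero>\<^bsub>C\<^esub>"
    using conv_distrib(2)[OF conv_zero_closed conv_zero_closed f] f by (intro z) simp_all
qed

text \<open>
  The algebra is additively generated by the \<open>a \<delta>\<^sub>t\<close>. Multiadditive
  identities, such as associativity of the convolution, are therefore checked on these, where no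
  sums occur.
\<close>

lemma conv_induct [consumes 1, case_names zero step]:
  assumes f: "f \<in> carrier C" and zero: "P \<zero>\<^bsub>C\<^esub>"
    and step: "\<And>t a f. \<lbrakk>t \<in> carrier H; a \<in> carrier A; f \<in> carrier C; P f\<rbrakk> \<Longrightarrow> P (single t a \<oplus>\<^bsub>C\<^esub> f)"
  shows "P f"
proof -
  have "finite T \<Longrightarrow> f \<in> carrier C \<Longrightarrow> supp f \<subseteq> T \<Longrightarrow> T \<subseteq> carrier H \<Longrightarrow> P f" for T f
  proof (induction T arbitrary: f rule: finite_induct)
    case empty
    then have "f = \<zero>\<^bsub>C\<^esub>"
      by (intro conv_eqI) auto
    then show ?case using zero by simp
  next
    case (insert t T)
    define g where "g = (\<lambda>s\<in>carrier H. if s = t then \<zero> else f s)"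
    have g: "g \<in> carrier C"
      unfolding g_def using insert.prems insert.hyps by (intro conv_restrict_in_carrier[of _ T]) auto
    have "supp g \<subseteq> T" using insert.prems by (auto simp: g_def)
    then have "P g" using insert g by blast
    moreover have "f = single t (f t) \<oplus>\<^bsub>C\<^esub> g"
      using insert.prems g single_closed[of "f t" t] by (intro conv_eqI) (auto simp: g_def)
    ultimately show ?case
      using insert.prems g step[of t "f t" g] by auto
  qed
  then show ?thesis using f conv_finite_supp[OF f] by blast
qed

lemma single_ops:
  assumes [simp]: "t \<in> carrier H" "a \<in> carrier A"
  shows "b \<in> carrier A \<Longrightarrow> single t a \<oplus>\<^bsub>C\<^esub> single t b = single t (a \<oplus> b)"
    and "c \<odot>\<^bsub>C\<^esub> single t a = single t (c \<odot> a)"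
    and "\<lbrakk>u \<in> carrier H; b \<in> carrier A\<rbrakk> \<Longrightarrow> single t a \<otimes>\<^bsub>C\<^esub> single u b = single (t \<otimes>\<^bsub>H\<^esub> u) (a \<otimes> \<alpha> t b)"
    and "(single t a)\<^sup>\<star>\<^bsub>C\<^esub> = single (inv\<^bsub>H\<^esub> t) (\<alpha> (inv\<^bsub>H\<^esub> t) (a\<^sup>\<star>))"
proof -
  show "b \<in> carrier A \<Longrightarrow> single t a \<oplus>\<^bsub>C\<^esub> single t b = single t (a \<oplus> b)"
    "c \<odot>\<^bsub>C\<^esub> single t a = single t (c \<odot> a)"
    by (intro conv_eqI; simp)+
  have invs: "inv\<^bsub>H\<^esub> s = t \<longleftrightarrow> s = inv\<^bsub>H\<^esub> t" if "s \<in> carrier H" for s using that by auto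
  show "(single t a)\<^sup>\<star>\<^bsub>C\<^esub> = single (inv\<^bsub>H\<^esub> t) (\<alpha> (inv\<^bsub>H\<^esub> t) (a\<^sup>\<star>))"
    by (intro conv_eqI) (auto simp: invs)
  assume u [simp]: "u \<in> carrier H" and b [simp]: "b \<in> carrier A"
  show "single t a \<otimes>\<^bsub>C\<^esub> single u b = single (t \<otimes>\<^bsub>H\<^esub> u) (a \<otimes> \<alpha> t b)"
  proof (rule conv_eqI)
    fix s assume s [simp]: "s \<in> carrier H"
    have iff: "inv\<^bsub>H\<^esub> t \<otimes>\<^bsub>H\<^esub> s = u \<longleftrightarrow> s = t \<otimes>\<^bsub>H\<^esub> u" by (auto simp: H.m_assoc[symmetric])
    have "(single t a \<otimes>\<^bsub>C\<^esub> single u b) s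
        = (\<Oplus>r\<in>{t}. single t a r \<otimes> \<alpha> r (single u b (inv\<^bsub>H\<^esub> r \<otimes>\<^bsub>H\<^esub> s)))"
      by (rule conv_mult_apply) (auto split: if_splits)
    also have "\<dots> = a \<otimes> \<alpha> t (single u b (inv\<^bsub>H\<^esub> t \<otimes>\<^bsub>H\<^esub> s))"
      by (subst M.finsum_insert) auto
    finally show "(single t a \<otimes>\<^bsub>C\<^esub> single u b) s = single (t \<otimes>\<^bsub>H\<^esub> u) (a \<otimes> \<alpha> t b) s"
      by (auto simp: iff)
  qed simp_all
qed

lemma conv_adj_add:
  "\<lbrakk>f \<in> carrier C; g \<in> carrier C\<rbrakk> \<Longrightarrow> (f \<oplus>\<^bsub>C\<^esub> g)\<^sup>\<star>\<^bsub>C\<^esub> = f\<^sup>\<star>\<^bsub>C\<^esub> \<oplus>\<^bsub>C\<^esub> g\<^sup>\<star>\<^bsub>C\<^esub>"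
  by (intro conv_eqI) (simp_all add: adj_add act_add)

lemma conv_adj_zero [simp]: "(\<zero>\<^bsub>C\<^esub>)\<^sup>\<star>\<^bsub>C\<^esub> = \<zero>\<^bsub>C\<^esub>"
  by (intro conv_eqI) simp_all

lemma conv_smult_add:
  "\<lbrakk>f \<in> carrier C; g \<in> carrier C\<rbrakk> \<Longrightarrow> c \<odot>\<^bsub>C\<^esub> (f \<oplus>\<^bsub>C\<^esub> g) = c \<odot>\<^bsub>C\<^esub> f \<oplus>\<^bsub>C\<^esub> c \<odot>\<^bsub>C\<^esub> g"
  by (intro conv_eqI) (simp_all add: smult_add_right)

lemma conv_smult_zero [simp]: "c \<odot>\<^bsub>C\<^esub> \<zero>\<^bsub>C\<^esub> = \<zero>\<^bsub>C\<^esub>"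
  by (intro conv_eqI) simp_all

lemma conv_mult_assoc:
  assumes f: "f \<in> carrier C" and g: "g \<in> carrier C" and k: "k \<in> carrier C"
  shows "f \<otimes>\<^bsub>C\<^esub> g \<otimes>\<^bsub>C\<^esub> k = f \<otimes>\<^bsub>C\<^esub> (g \<otimes>\<^bsub>C\<^esub> k)"
proof -
  have 1: "single t a \<otimes>\<^bsub>C\<^esub> single u b \<otimes>\<^bsub>C\<^esub> k = single t a \<otimes>\<^bsub>C\<^esub> (single u b \<otimes>\<^bsub>C\<^esub> k)"
    if [simp]: "t \<in> carrier H" "a \<in> carrier A" "u \<in> carrier H" "b \<in> carrier A" for t a u b
    using k
  proof (induction rule: conv_induct)
    case (step v c k)
    then show ?case
      by (simp add: conv_distrib single_ops act_mult act_act mult_assoc H.m_assoc)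
  qed (simp add: conv_mult_zero)
  have 2: "single t a \<otimes>\<^bsub>C\<^esub> g \<otimes>\<^bsub>C\<^esub> k = single t a \<otimes>\<^bsub>C\<^esub> (g \<otimes>\<^bsub>C\<^esub> k)"
    if [simp]: "t \<in> carrier H" "a \<in> carrier A" for t a
    using g
  proof (induction rule: conv_induct)
    case (step v c g)
    then show ?case using k by (simp add: conv_distrib 1)
  qed (simp add: conv_mult_zero k)
  show ?thesis using f
  proof (induction rule: conv_induct)
    case (step v c f)
    then show ?case using g k by (simp add: conv_distrib 2)
  qed (simp add: conv_mult_zero g k)
qed

lemma conv_adj_mult:
  assumes f: "f \<in> carrier C" and g: "g \<in> carrier C"
  shows "(f \<otimes>\<^bsub>C\<^esub> g)\<^sup>\<star>\<^bsub>C\<^esub> = g\<^sup>\<star>\<^bsub>C\<^esub> \<otimes>\<^bsub>C\<^esub> f\<^sup>\<star>\<^bsub>C\<^esub>"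
proof -
  have 1: "(single t a \<otimes>\<^bsub>C\<^esub> g)\<^sup>\<star>\<^bsub>C\<^esub> = g\<^sup>\<star>\<^bsub>C\<^esub> \<otimes>\<^bsub>C\<^esub> (single t a)\<^sup>\<star>\<^bsub>C\<^esub>"
    if [simp]: "t \<in> carrier H" "a \<in> carrier A" for t a
    using g
  proof (induction rule: conv_induct)
    case (step v c g)
    then show ?case
      by (simp add: conv_distrib conv_adj_add single_ops adj_mult act_mult act_act act_adj[symmetric] H.inv_mult_group H.m_assoc)
  qed (simp add: conv_mult_zero)
  show ?thesis using f
  proof (induction rule: conv_induct)
    case (step v c f)
    then show ?case using g by (simp add: conv_distrib conv_adj_add 1)
  qed (simp add: conv_mult_zero g)
qed

lemma conv_smult_mult:
  assumes f: "f \<in> carrier C" and g: "g \<in> carrier C"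
  shows "(c \<odot>\<^bsub>C\<^esub> f) \<otimes>\<^bsub>C\<^esub> g = c \<odot>\<^bsub>C\<^esub> (f \<otimes>\<^bsub>C\<^esub> g)"
    "f \<otimes>\<^bsub>C\<^esub> (c \<odot>\<^bsub>C\<^esub> g) = c \<odot>\<^bsub>C\<^esub> (f \<otimes>\<^bsub>C\<^esub> g)"
proof -
  have 1: "(c \<odot>\<^bsub>C\<^esub> single t a) \<otimes>\<^bsub>C\<^esub> g = c \<odot>\<^bsub>C\<^esub> (single t a \<otimes>\<^bsub>C\<^esub> g)
      \<and> single t a \<otimes>\<^bsub>C\<^esub> (c \<odot>\<^bsub>C\<^esub> g) = c \<odot>\<^bsub>C\<^esub> (single t a \<otimes>\<^bsub>C\<^esub> g)"
    if [simp]: "t \<in> carrier H" "a \<in> carrier A" for t a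
    using g
  proof (induction rule: conv_induct)
    case (step v b g)
    then show ?case
      by (simp add: conv_distrib conv_smult_add single_ops smult_mult_left smult_mult_right act_smult)
  qed (simp add: conv_mult_zero)
  have "(c \<odot>\<^bsub>C\<^esub> f) \<otimes>\<^bsub>C\<^esub> g = c \<odot>\<^bsub>C\<^esub> (f \<otimes>\<^bsub>C\<^esub> g)
      \<and> f \<otimes>\<^bsub>C\<^esub> (c \<odot>\<^bsub>C\<^esub> g) = c \<odot>\<^bsub>C\<^esub> (f \<otimes>\<^bsub>C\<^esub> g)"
    using f
  proof (induction rule: conv_induct)
    case (step v b f)
    then show ?case using g by (simp add: conv_distrib conv_smult_add 1)
  qed (simp add: conv_mult_zero g)
  then show "(c \<odot>\<^bsub>C\<^esub> f) \<otimes>\<^bsub>C\<^esub> g = c \<odot>\<^bsub>C\<^esub> (f \<otimes>\<^bsub>C\<^esub> g)"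
    "f \<otimes>\<^bsub>C\<^esub> (c \<odot>\<^bsub>C\<^esub> g) = c \<odot>\<^bsub>C\<^esub> (f \<otimes>\<^bsub>C\<^esub> g)" by simp_all
qed

theorem conv_star_algebra: "star_algebra C"
proof (rule star_algebra.intro[OF conv_module], unfold_locales)
  fix f assume f: "f \<in> carrier C"
  show "(f\<^sup>\<star>\<^bsub>C\<^esub>)\<^sup>\<star>\<^bsub>C\<^esub> = f"
    using f by (intro conv_eqI) (simp_all add: adj_adj act_adj[symmetric] act_act)
  show "(c \<odot>\<^bsub>C\<^esub> f)\<^sup>\<star>\<^bsub>C\<^esub> = cnj c \<odot>\<^bsub>C\<^esub> f\<^sup>\<star>\<^bsub>C\<^esub>" for c
    using f by (intro conv_eqI) (simp_all add: adj_smult act_smult)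
qed (simp_all add: conv_mult_assoc conv_distrib conv_smult_mult conv_adj_add conv_adj_mult)

end

section \<open>The full crossed product\<close>

context cstar_dynamical_system
begin

abbreviation l1 :: "('h \<Rightarrow> 'a) \<Rightarrow> real" where "l1 \<equiv> l1_norm H A"
abbreviation P :: "(nat \<Rightarrow> 'h \<Rightarrow> 'a) set cstar_struct" where "P \<equiv> crossed_product H A \<alpha>"

text \<open>The seminorms whose supremum is the full norm.\<close>

definition admissible :: "(('h \<Rightarrow> 'a) \<Rightarrow> real) \<Rightarrow> bool" where
  "admissible p \<longleftrightarrow> cstar_seminorm C p \<and> (\<forall>g\<in>carrier C. p g \<le> l1 g)"

lemma full_norm_Sup: "full_norm H A \<alpha> f = Sup {p f | p. admissible p}"
proof -
  have "cstar_seminorm (conv_algebra H A \<alpha> l1) p = cstar_seminorm C p" for p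
    by (simp add: cstar_seminorm_def full_conv_algebra_def conv_algebra_def)
  moreover have "carrier (conv_algebra H A \<alpha> l1) = carrier C"
    by (simp add: full_conv_algebra_def conv_algebra_def)
  ultimately show ?thesis by (simp add: full_norm_def admissible_def)
qed

lemma nrm_C: "\<parallel>f\<parallel>\<^bsub>C\<^esub> = Sup {p f | p. admissible p}"
  by (simp add: conv_simps full_norm_Sup)

lemma l1_nonneg: "f \<in> carrier C \<Longrightarrow> 0 \<le> l1 f"
  unfolding l1_norm_def by (intro sum_nonneg) auto

lemma admissible_zero: "admissible (\<lambda>_. 0)"
  unfolding admissible_def cstar_seminorm_def by (auto simp: l1_nonneg)

lemma admissible_le: "\<lbrakk>admissible p; f \<in> carrier C\<rbrakk> \<Longrightarrow> p f \<le> \<parallel>f\<parallel>\<^bsub>C\<^esub>"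
  unfolding nrm_C by (rule cSup_upper) (auto simp: admissible_def bdd_above_def)

lemma nrm_C_le: "\<lbrakk>\<And>p. admissible p \<Longrightarrow> p f \<le> c\<rbrakk> \<Longrightarrow> \<parallel>f\<parallel>\<^bsub>C\<^esub> \<le> c"
  unfolding nrm_C using admissible_zero by (intro cSup_least) auto

lemma cstar_seminorm_C: "cstar_seminorm C (nrm C)"
proof -
  interpret C: star_algebra C by (rule conv_star_algebra)
  have adm: "0 \<le> p x" "p (c \<odot>\<^bsub>C\<^esub> x) = cmod c * p x" "p (x \<oplus>\<^bsub>C\<^esub> y) \<le> p x + p y"
    "p (x \<otimes>\<^bsub>C\<^esub> y) \<le> p x * p y" "p (x\<^sup>\<star>\<^bsub>C\<^esub> \<otimes>\<^bsub>C\<^esub> x) = (p x)\<^sup>2"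
    if "admissible p" "x \<in> carrier C" "y \<in> carrier C" for p x y c
    using that unfolding admissible_def cstar_seminorm_def by auto
  have ge0: "0 \<le> \<parallel>x\<parallel>\<^bsub>C\<^esub>" if "x \<in> carrier C" for x using admissible_le[OF admissible_zero that] by simp
  show ?thesis
    unfolding cstar_seminorm_def
  proof (intro conjI allI ballI)
    fix x assume x: "x \<in> carrier C"
    show "0 \<le> \<parallel>x\<parallel>\<^bsub>C\<^esub>" by (rule ge0[OF x])
    show "\<parallel>c \<odot>\<^bsub>C\<^esub> x\<parallel>\<^bsub>C\<^esub> = cmod c * \<parallel>x\<parallel>\<^bsub>C\<^esub>" for c
    proof (rule antisym)
      show "\<parallel>c \<odot>\<^bsub>C\<^esub> x\<parallel>\<^bsub>C\<^esub> \<le> cmod c * \<parallel>x\<parallel>\<^bsub>C\<^esub>"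
        using x by (intro nrm_C_le) (simp add: adm(2)[OF _ x x] mult_left_mono admissible_le)
      show "cmod c * \<parallel>x\<parallel>\<^bsub>C\<^esub> \<le> \<parallel>c \<odot>\<^bsub>C\<^esub> x\<parallel>\<^bsub>C\<^esub>"
      proof (cases "c = 0")
        case True
        then show ?thesis using ge0[of "c \<odot>\<^bsub>C\<^esub> x"] x by simp
      next
        case False
        have "\<parallel>x\<parallel>\<^bsub>C\<^esub> \<le> \<parallel>c \<odot>\<^bsub>C\<^esub> x\<parallel>\<^bsub>C\<^esub> / cmod c"
        proof (rule nrm_C_le)
          fix p assume p: "admissible p"
          have "cmod c * p x \<le> \<parallel>c \<odot>\<^bsub>C\<^esub> x\<parallel>\<^bsub>C\<^esub>" using admissible_le[OF p, of "c \<odot>\<^bsub>C\<^esub> x"] x by (simp add: adm(2)[OF p x x])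
          then show "p x \<le> \<parallel>c \<odot>\<^bsub>C\<^esub> x\<parallel>\<^bsub>C\<^esub> / cmod c" using False by (simp add: le_divide_eq mult.commute)
        qed
        then show ?thesis using False by (simp add: le_divide_eq mult.commute)
      qed
    qed
    show "\<parallel>x\<^sup>\<star>\<^bsub>C\<^esub> \<otimes>\<^bsub>C\<^esub> x\<parallel>\<^bsub>C\<^esub> = \<parallel>x\<parallel>\<^bsub>C\<^esub>\<^sup>2"
    proof (rule antisym)
      show "\<parallel>x\<^sup>\<star>\<^bsub>C\<^esub> \<otimes>\<^bsub>C\<^esub> x\<parallel>\<^bsub>C\<^esub> \<le> \<parallel>x\<parallel>\<^bsub>C\<^esub>\<^sup>2"
        using x by (intro nrm_C_le) (simp add: adm(5)[OF _ x x] power_mono admissible_le adm(1)[OF _ x x])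
      have "\<parallel>x\<parallel>\<^bsub>C\<^esub> \<le> sqrt \<parallel>x\<^sup>\<star>\<^bsub>C\<^esub> \<otimes>\<^bsub>C\<^esub> x\<parallel>\<^bsub>C\<^esub>"
      proof (rule nrm_C_le)
        fix p assume p: "admissible p"
        have "(p x)\<^sup>2 \<le> \<parallel>x\<^sup>\<star>\<^bsub>C\<^esub> \<otimes>\<^bsub>C\<^esub> x\<parallel>\<^bsub>C\<^esub>" using admissible_le[OF p, of "x\<^sup>\<star>\<^bsub>C\<^esub> \<otimes>\<^bsub>C\<^esub> x"] x by (simp add: adm(5)[OF p x x])
        then show "p x \<le> sqrt \<parallel>x\<^sup>\<star>\<^bsub>C\<^esub> \<otimes>\<^bsub>C\<^esub> x\<parallel>\<^bsub>C\<^esub>" by (rule real_le_rsqrt)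
      qed
      then have "\<parallel>x\<parallel>\<^bsub>C\<^esub>\<^sup>2 \<le> (sqrt \<parallel>x\<^sup>\<star>\<^bsub>C\<^esub> \<otimes>\<^bsub>C\<^esub> x\<parallel>\<^bsub>C\<^esub>)\<^sup>2" using ge0[OF x] by (intro power_mono) auto
      then show "\<parallel>x\<parallel>\<^bsub>C\<^esub>\<^sup>2 \<le> \<parallel>x\<^sup>\<star>\<^bsub>C\<^esub> \<otimes>\<^bsub>C\<^esub> x\<parallel>\<^bsub>C\<^esub>" using ge0[of "x\<^sup>\<star>\<^bsub>C\<^esub> \<otimes>\<^bsub>C\<^esub> x"] x by simp
    qed
    fix y assume y: "y \<in> carrier C"
    show "\<parallel>x \<oplus>\<^bsub>C\<^esub> y\<parallel>\<^bsub>C\<^esub> \<le> \<parallel>x\<parallel>\<^bsub>C\<^esub> + \<parallel>y\<parallel>\<^bsub>C\<^esub>"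
    proof (rule nrm_C_le)
      fix p assume p: "admissible p"
      show "p (x \<oplus>\<^bsub>C\<^esub> y) \<le> \<parallel>x\<parallel>\<^bsub>C\<^esub> + \<parallel>y\<parallel>\<^bsub>C\<^esub>"
        using adm(3)[OF p x y] admissible_le[OF p x] admissible_le[OF p y] by linarith
    qed
    show "\<parallel>x \<otimes>\<^bsub>C\<^esub> y\<parallel>\<^bsub>C\<^esub> \<le> \<parallel>x\<parallel>\<^bsub>C\<^esub> * \<parallel>y\<parallel>\<^bsub>C\<^esub>"
    proof (rule nrm_C_le)
      fix p assume p: "admissible p"
      have "p x * p y \<le> \<parallel>x\<parallel>\<^bsub>C\<^esub> * \<parallel>y\<parallel>\<^bsub>C\<^esub>"
        by (rule mult_mono[OF admissible_le[OF p x] admissible_le[OF p y] ge0[OF x] adm(1)[OF p y y]])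
      then show "p (x \<otimes>\<^bsub>C\<^esub> y) \<le> \<parallel>x\<parallel>\<^bsub>C\<^esub> * \<parallel>y\<parallel>\<^bsub>C\<^esub>" using adm(4)[OF p x y] by linarith
    qed
  qed
qed

sublocale C: cstar_seminormed_algebra C
  by (intro cstar_seminormed_algebra.intro conv_star_algebra cstar_seminormed_algebra_axioms.intro cstar_seminorm_C)

text \<open>Left multiplication by \<open>\<delta>\<^sub>h\<close>.\<close>

definition shift :: "'h \<Rightarrow> ('h \<Rightarrow> 'a) \<Rightarrow> 'h \<Rightarrow> 'a" where
  "shift h f = (\<lambda>s\<in>carrier H. \<alpha> h (f (inv\<^bsub>H\<^esub> h \<otimes>\<^bsub>H\<^esub> s)))"

lemma shift_single:
  "\<lbrakk>h \<in> carrier H; t \<in> carrier H; a \<in> carrier A\<rbrakk> \<Longrightarrow> shift h (single t a) = single (h \<otimes>\<^bsub>H\<^esub> t) (\<alpha> h a)"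
proof -
  assume [simp]: "h \<in> carrier H" "t \<in> carrier H" "a \<in> carrier A"
  have "inv\<^bsub>H\<^esub> h \<otimes>\<^bsub>H\<^esub> s = t \<longleftrightarrow> s = h \<otimes>\<^bsub>H\<^esub> t" if "s \<in> carrier H" for s
    using that by (auto simp: H.m_assoc[symmetric])
  then show ?thesis by (auto simp: shift_def single_def fun_eq_iff)
qed

lemma shift_add:
  "\<lbrakk>h \<in> carrier H; f \<in> carrier C; g \<in> carrier C\<rbrakk> \<Longrightarrow> shift h (f \<oplus>\<^bsub>C\<^esub> g) = shift h f \<oplus>\<^bsub>C\<^esub> shift h g"
  by (auto simp: shift_def conv_simps(2) act_add)

lemma shift_zero [simp]: "h \<in> carrier H \<Longrightarrow> shift h \<zero>\<^bsub>C\<^esub> = \<zero>\<^bsub>C\<^esub>"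
  by (auto simp: shift_def conv_simps(3))

lemma shift_closed [simp]:
  assumes h: "h \<in> carrier H" and f: "f \<in> carrier C" shows "shift h f \<in> carrier C"
  using f by (induction rule: conv_induct) (simp_all add: h shift_add shift_single)

lemma shift_minus:
  assumes [simp]: "h \<in> carrier H" "f \<in> carrier C" "g \<in> carrier C"
  shows "shift h (f \<ominus>\<^bsub>C\<^esub> g) = shift h f \<ominus>\<^bsub>C\<^esub> shift h g"
proof -
  have "shift h (c \<odot>\<^bsub>C\<^esub> f) = c \<odot>\<^bsub>C\<^esub> shift h f" if "f \<in> carrier C" for c f
    using that by (auto simp: shift_def conv_simps(4) act_smult)
  then show ?thesis by (simp add: C.minus_eq C.minus_smult shift_add)
qed

text \<open>
  This says \<open>\<delta>\<^sub>h* \<delta>\<^sub>h = 1\<close>; it makes the shift isometric for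
  the full norm.
\<close>

lemma shift_gram:
  assumes h [simp]: "h \<in> carrier H" and f: "f \<in> carrier C" and g: "g \<in> carrier C"
  shows "(shift h f)\<^sup>\<star>\<^bsub>C\<^esub> \<otimes>\<^bsub>C\<^esub> shift h g = f\<^sup>\<star>\<^bsub>C\<^esub> \<otimes>\<^bsub>C\<^esub> g"
proof -
  have 2: "(shift h (single t a))\<^sup>\<star>\<^bsub>C\<^esub> \<otimes>\<^bsub>C\<^esub> shift h g = (single t a)\<^sup>\<star>\<^bsub>C\<^esub> \<otimes>\<^bsub>C\<^esub> g"
    if ta [simp]: "t \<in> carrier H" "a \<in> carrier A" for t a
    using g
  proof (induction rule: conv_induct)
    case (step u b g)
    have "(shift h (single t a))\<^sup>\<star>\<^bsub>C\<^esub> \<otimes>\<^bsub>C\<^esub> shift h (single u b) = (single t a)\<^sup>\<star>\<^bsub>C\<^esub> \<otimes>\<^bsub>C\<^esub> single u b"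
      using step by (simp add: shift_single single_ops act_adj[symmetric] act_act H.inv_mult_group H.m_assoc)
       (simp add: H.m_assoc[symmetric])
    then show ?case using step by (simp add: shift_add C.distrib_left)
  qed simp
  show ?thesis using f
  proof (induction rule: conv_induct)
    case (step u b f)
    then show ?case using g by (simp add: shift_add C.adj_add C.distrib_right 2)
  qed (use g in simp)
qed

lemma nrm_shift [simp]: "\<lbrakk>h \<in> carrier H; f \<in> carrier C\<rbrakk> \<Longrightarrow> \<parallel>shift h f\<parallel>\<^bsub>C\<^esub> = \<parallel>f\<parallel>\<^bsub>C\<^esub>"
  by (rule C.nrm_eq_if_same_square) (simp_all add: shift_gram)

lemma coset_update [simp]: "a_r_coset (R\<lparr>carrier := c\<rparr>) = a_r_coset R" for R :: "'b cstar_struct"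
  by (simp add: fun_eq_iff a_r_coset_def')

text \<open>
  The completion is cut out of the sequence algebra of \<open>C\<close> by restricting the carrier
  to classes of Cauchy sequences, so the calculus of classes carries over.
\<close>

lemma P_simps:
  "mult P = mult (seq_algebra C)" "add P = add (seq_algebra C)" "smult P = smult (seq_algebra C)"
  "adj P = adj (seq_algebra C)"
  by (simp_all add: fun_eq_iff crossed_product_def cstar_completion_def seq_algebra_def cstar_quotient_def FactRing_def
    rcoset_mult_def coset_map_def set_add_def')

lemma P_carrier: "carrier P = seq_class C ` cauchy_seqs C"
  by (auto simp: crossed_product_def cstar_completion_def cstar_quotient_def FactRing_def A_RCOSETS_def')

lemma cauchy_linf [simp]: "x \<in> cauchy_seqs C \<Longrightarrow> x \<in> carrier (linf C)"
  by (simp add: cauchy_seqs_def)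

lemma cauchy_map:
  assumes x: "x \<in> cauchy_seqs C" and F: "\<And>f. f \<in> carrier C \<Longrightarrow> F f \<in> carrier C"
    and nF: "\<And>f. f \<in> carrier C \<Longrightarrow> \<parallel>F f\<parallel>\<^bsub>C\<^esub> = \<parallel>f\<parallel>\<^bsub>C\<^esub>"
    and dF: "\<And>f g. \<lbrakk>f \<in> carrier C; g \<in> carrier C\<rbrakk> \<Longrightarrow> F (f \<ominus>\<^bsub>C\<^esub> g) = F f \<ominus>\<^bsub>C\<^esub> F g"
  shows "(\<lambda>n. F (x n)) \<in> cauchy_seqs C"
proof -
  have xc: "x n \<in> carrier C" for n using x by (simp add: linfD)
  have "\<parallel>F (x m) \<ominus>\<^bsub>C\<^esub> F (x n)\<parallel>\<^bsub>C\<^esub> = \<parallel>x m \<ominus>\<^bsub>C\<^esub> x n\<parallel>\<^bsub>C\<^esub>" for m n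
    using xc by (simp add: dF[symmetric] nF)
  then show ?thesis using x xc F nF by (simp add: cauchy_seqs_def mem_linf)
qed

lemma cauchy_const [simp]: "f \<in> carrier C \<Longrightarrow> (\<lambda>_. f) \<in> cauchy_seqs C"
  unfolding cauchy_seqs_def by (simp add: C.linf_const)

lemma cauchy_shift [simp]: "\<lbrakk>h \<in> carrier H; x \<in> cauchy_seqs C\<rbrakk> \<Longrightarrow> (\<lambda>n. shift h (x n)) \<in> cauchy_seqs C"
  by (rule cauchy_map[of x "shift h"]) (simp_all add: shift_minus)

lemma cauchy_adj [simp]: "x \<in> cauchy_seqs C \<Longrightarrow> (\<lambda>n. (x n)\<^sup>\<star>\<^bsub>C\<^esub>) \<in> cauchy_seqs C"
  by (rule cauchy_map[of x "adj C"]) (simp_all add: C.minus_eq C.adj_add)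

lemma in_P [simp]: "x \<in> cauchy_seqs C \<Longrightarrow> seq_class C x \<in> carrier P"
  by (simp add: P_carrier)

text \<open>
  The map \<open>f \<mapsto> \<delta>\<^sub>h f \<delta>\<^sub>h*\<close>, where right
  multiplication by \<open>\<delta>\<^sub>h*\<close> is expressed by the left shift and adjoints, as
  in the adjoint of a double centralizer.
\<close>

definition conjugate :: "'h \<Rightarrow> ('h \<Rightarrow> 'a) \<Rightarrow> 'h \<Rightarrow> 'a" where
  "conjugate h f = shift h ((shift h (f\<^sup>\<star>\<^bsub>C\<^esub>))\<^sup>\<star>\<^bsub>C\<^esub>)"

lemma crossed_unitary_left:
  assumes h [simp]: "h \<in> carrier H" and x [simp]: "x \<in> cauchy_seqs C"
  shows "fst (crossed_unitary H A \<alpha> h) (seq_class C x) = seq_class C (\<lambda>n. shift h (x n))"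
proof -
  have "coset_map (linf C) (null_seqs C) (\<lambda>f n. shift h (f n)) (seq_class C x) = seq_class C (\<lambda>n. shift h (x n))"
  proof (rule C.coset_map_seq_class)
    fix y assume y: "y \<in> carrier (linf C)" "C.null_diff y x"
    have xl: "x \<in> carrier (linf C)" by simp
    have xy: "x n \<in> carrier C" "y n \<in> carrier C" for n using y(1) xl by (simp_all add: linfD)
    show "(\<lambda>n. shift h (y n)) \<in> carrier (linf C) \<and> C.null_diff (\<lambda>n. shift h (y n)) (\<lambda>n. shift h (x n))"
      using y xy by (simp add: mem_linf C.null_diff_def shift_minus[symmetric])
  qed simp
  then show ?thesis by (simp add: crossed_unitary_def Let_def shift_def)
qed

abbreviation Ad_crossed :: "'h \<Rightarrow> (nat \<Rightarrow> 'h \<Rightarrow> 'a) set \<Rightarrow> (nat \<Rightarrow> 'h \<Rightarrow> 'a) set" where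
  "Ad_crossed h \<equiv> multiplier_Ad P (crossed_unitary H A \<alpha> h)"

lemma Ad_class:
  assumes h [simp]: "h \<in> carrier H" and x [simp]: "x \<in> cauchy_seqs C"
  shows "Ad_crossed h (seq_class C x) = seq_class C (\<lambda>n. conjugate h (x n))"
proof -
  obtain L R where LR: "crossed_unitary H A \<alpha> h = (L, R)" by (cases "crossed_unitary H A \<alpha> h")
  have L: "L (seq_class C y) = seq_class C (\<lambda>n. shift h (y n))" if "y \<in> cauchy_seqs C" for y
    using crossed_unitary_left[OF h that] by (simp add: LR)
  have "Ad_crossed h (seq_class C x) = L ((L ((seq_class C x)\<^sup>\<star>\<^bsub>P\<^esub>))\<^sup>\<star>\<^bsub>P\<^esub>)"
    by (simp add: multiplier_Ad_def LR multiplier_algebra_def)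
  also have "\<dots> = seq_class C (\<lambda>n. conjugate h (x n))"
    by (simp add: P_simps C.seq_class_adj L conjugate_def)
  finally show ?thesis .
qed

lemma conjugate_single:
  assumes [simp]: "h \<in> carrier H" "t \<in> carrier H" "a \<in> carrier A"
  shows "conjugate h (single t a) = single (h \<otimes>\<^bsub>H\<^esub> t \<otimes>\<^bsub>H\<^esub> inv\<^bsub>H\<^esub> h) (\<alpha> h a)"
proof -
  have "inv\<^bsub>H\<^esub> h \<otimes>\<^bsub>H\<^esub> (h \<otimes>\<^bsub>H\<^esub> inv\<^bsub>H\<^esub> t) = inv\<^bsub>H\<^esub> t" by (simp add: H.m_assoc[symmetric])
  then show ?thesis
    by (simp add: conjugate_def single_ops shift_single act_adj[symmetric] adj_adj act_act H.inv_mult_group H.m_assoc)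
qed

lemma conjugate_add:
  "\<lbrakk>h \<in> carrier H; f \<in> carrier C; g \<in> carrier C\<rbrakk> \<Longrightarrow> conjugate h (f \<oplus>\<^bsub>C\<^esub> g) = conjugate h f \<oplus>\<^bsub>C\<^esub> conjugate h g"
  by (simp add: conjugate_def C.adj_add shift_add)

lemma conjugate_closed [simp]: "\<lbrakk>h \<in> carrier H; f \<in> carrier C\<rbrakk> \<Longrightarrow> conjugate h f \<in> carrier C"
  by (simp add: conjugate_def)

lemma conjugate_zero [simp]: "h \<in> carrier H \<Longrightarrow> conjugate h \<zero>\<^bsub>C\<^esub> = \<zero>\<^bsub>C\<^esub>"
  by (simp add: conjugate_def)

abbreviation \<iota>\<^sub>P :: "('h \<Rightarrow> 'a) \<Rightarrow> (nat \<Rightarrow> 'h \<Rightarrow> 'a) set" where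
  "\<iota>\<^sub>P f \<equiv> seq_class C (\<lambda>_. f)"

lemma crossed_incl_eq: "crossed_incl H A \<alpha> a = \<iota>\<^sub>P (single \<one>\<^bsub>H\<^esub> a)"
  by (simp add: crossed_incl_def const_seq_def delta_one_def single_def)

text \<open>
  On the copy \<open>a \<delta>\<^sub>1\<close> of \<open>A\<close>, conjugation by
  \<open>\<delta>\<^sub>h\<close> is \<open>\<alpha>\<^sub>h\<close>.
\<close>

lemma crossed_incl_equivariant:
  "equivariant_star_hom H A \<alpha> P Ad_crossed (crossed_incl H A \<alpha>)"
  unfolding equivariant_star_hom_def star_hom_def
  by (simp add: crossed_incl_eq P_simps C.seq_class_ops single_ops Ad_class conjugate_single)

theorem covariant_family_if_split:
  assumes \<psi>: "equivariant_star_hom H P Ad_crossed S \<sigma> \<psi>"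
    and split: "\<And>a. a \<in> carrier A \<Longrightarrow> \<psi> (crossed_incl H A \<alpha> a) = \<kappa> a"
  shows "covariant_family (\<lambda>h a. \<psi> (\<iota>\<^sub>P (single h a)))"
proof -
  have hom: "star_hom P S \<psi>" and eq: "\<And>h x. \<lbrakk>h \<in> carrier H; x \<in> carrier P\<rbrakk> \<Longrightarrow> \<psi> (Ad_crossed h x) = \<sigma> h (\<psi> x)"
    using \<psi> by (auto simp: equivariant_star_hom_def)
  note h = star_homD(2-5)[OF hom, unfolded P_simps, symmetric]
  show ?thesis
    unfolding covariant_family_def
  proof (intro conjI ballI allI)
    fix g h a assume [simp]: "g \<in> carrier H" "h \<in> carrier H" "a \<in> carrier A"
    show "\<sigma> g (\<psi> (\<iota>\<^sub>P (single h a))) = \<psi> (\<iota>\<^sub>P (single (g \<otimes>\<^bsub>H\<^esub> h \<otimes>\<^bsub>H\<^esub> inv\<^bsub>H\<^esub> g) (\<alpha> g a)))"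
      by (simp add: eq[symmetric] Ad_class conjugate_single)
  qed (simp_all add: star_homD(1)[OF hom] h C.seq_class_ops single_ops split[symmetric] crossed_incl_eq)
qed

end

section \<open>The integrated form of a covariant family\<close>

context cstar_dynamical_system
begin

text \<open>
  The sum of the \<open>f(t) w\<^sub>t\<close> over the support of \<open>f\<close>.
\<close>

definition integrated :: "('h \<Rightarrow> 'a \<Rightarrow> (nat \<Rightarrow> 'a) set) \<Rightarrow> ('h \<Rightarrow> 'a) \<Rightarrow> (nat \<Rightarrow> 'a) set" where
  "integrated Y f = (\<Oplus>\<^bsub>S\<^esub>t\<in>supp f. Y t (f t))"

context
  fixes Y assumes Y: "covariant_family Y"
begin

lemma family_closed [simp]: "\<lbrakk>h \<in> carrier H; a \<in> carrier A\<rbrakk> \<Longrightarrow> Y h a \<in> carrier S"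
  by (rule covariant_familyD(1)[OF Y])

lemma family_zero [simp]: "h \<in> carrier H \<Longrightarrow> Y h \<zero> = \<zero>\<^bsub>S\<^esub>"
  using covariant_familyD(3)[OF Y, of h \<zero> 0] by simp

lemma integrated_superset:
  assumes f: "f \<in> carrier C" and T: "finite T" "T \<subseteq> carrier H" "supp f \<subseteq> T"
  shows "integrated Y f = (\<Oplus>\<^bsub>S\<^esub>t\<in>T. Y t (f t))"
  unfolding integrated_def
  by (rule S.M.add.finprod_mono_neutral_cong_left) (use T f in auto)

lemma integrated_closed [simp]: "f \<in> carrier C \<Longrightarrow> integrated Y f \<in> carrier S"
  unfolding integrated_def by (intro S.M.finsum_closed) auto

lemma integrated_add:
  assumes f: "f \<in> carrier C" and g: "g \<in> carrier C"
  shows "integrated Y (f \<oplus>\<^bsub>C\<^esub> g) = integrated Y f \<oplus>\<^bsub>S\<^esub> integrated Y g"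
proof -
  let ?T = "supp f \<union> supp g"
  have T: "finite ?T" "?T \<subseteq> carrier H" using conv_finite_supp[OF f] conv_finite_supp[OF g] by auto
  have sT: "supp (f \<oplus>\<^bsub>C\<^esub> g) \<subseteq> ?T" by auto
  have "integrated Y (f \<oplus>\<^bsub>C\<^esub> g) = (\<Oplus>\<^bsub>S\<^esub>t\<in>?T. Y t ((f \<oplus>\<^bsub>C\<^esub> g) t))"
    using f g by (intro integrated_superset T sT) auto
  also have "\<dots> = (\<Oplus>\<^bsub>S\<^esub>t\<in>?T. Y t (f t) \<oplus>\<^bsub>S\<^esub> Y t (g t))"
    using f g by (intro S.M.finsum_cong') (auto simp: covariant_familyD(2)[OF Y])
  also have "\<dots> = (\<Oplus>\<^bsub>S\<^esub>t\<in>?T. Y t (f t)) \<oplus>\<^bsub>S\<^esub> (\<Oplus>\<^bsub>S\<^esub>t\<in>?T. Y t (g t))"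
    using f g by (intro S.M.finsum_addf) auto
  also have "\<dots> = integrated Y f \<oplus>\<^bsub>S\<^esub> integrated Y g"
    using integrated_superset[OF f T] integrated_superset[OF g T] by simp
  finally show ?thesis .
qed

lemma integrated_zero [simp]: "integrated Y \<zero>\<^bsub>C\<^esub> = \<zero>\<^bsub>S\<^esub>"
  using integrated_superset[of "\<zero>\<^bsub>C\<^esub>" "{}"] by simp

lemma integrated_single:
  assumes "t \<in> carrier H" "a \<in> carrier A" shows "integrated Y (single t a) = Y t a"
proof -
  have "integrated Y (single t a) = (\<Oplus>\<^bsub>S\<^esub>s\<in>{t}. Y s (single t a s))"
    using assms by (intro integrated_superset) (auto split: if_splits)
  also have "\<dots> = Y t a" using assms by (subst S.M.finsum_insert) auto
  finally show ?thesis .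
qed

lemma integrated_smult: "f \<in> carrier C \<Longrightarrow> integrated Y (c \<odot>\<^bsub>C\<^esub> f) = c \<odot>\<^bsub>S\<^esub> integrated Y f"
proof (induction rule: conv_induct)
  case (step t a f)
  then show ?case
    by (simp add: C.smult_add_right integrated_add S.smult_add_right single_ops integrated_single covariant_familyD(3)[OF Y])
qed simp

lemma integrated_adj: "f \<in> carrier C \<Longrightarrow> integrated Y (f\<^sup>\<star>\<^bsub>C\<^esub>) = (integrated Y f)\<^sup>\<star>\<^bsub>S\<^esub>"
proof (induction rule: conv_induct)
  case (step t a f)
  then show ?case
    by (simp add: C.adj_add integrated_add S.adj_add single_ops integrated_single covariant_familyD(5)[OF Y])
qed simp

lemma integrated_conjugate:
  assumes h: "h \<in> carrier H" shows "f \<in> carrier C \<Longrightarrow> integrated Y (conjugate h f) = \<sigma> h (integrated Y f)"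
proof (induction rule: conv_induct)
  case (step t a f)
  then show ?case using h
    by (simp add: conjugate_add integrated_add seq_action_ops conjugate_single integrated_single covariant_familyD(6)[OF Y])
qed (simp add: h)

lemma integrated_mult:
  assumes f: "f \<in> carrier C" and g: "g \<in> carrier C"
  shows "integrated Y (f \<otimes>\<^bsub>C\<^esub> g) = integrated Y f \<otimes>\<^bsub>S\<^esub> integrated Y g"
proof -
  have 1: "integrated Y (single t a \<otimes>\<^bsub>C\<^esub> g) = integrated Y (single t a) \<otimes>\<^bsub>S\<^esub> integrated Y g"
    if [simp]: "t \<in> carrier H" "a \<in> carrier A" for t a
    using g
  proof (induction rule: conv_induct)
    case (step u b g)
    then show ?case
      by (simp add: C.distrib_left S.distrib_left integrated_add single_ops integrated_single covariant_familyD(4)[OF Y])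
  qed (simp add: integrated_single)
  show ?thesis using f
  proof (induction rule: conv_induct)
    case (step u b f)
    then show ?case using g by (simp add: C.distrib_right S.distrib_right integrated_add 1)
  qed (use g in simp)
qed

lemma integrated_minus:
  "\<lbrakk>f \<in> carrier C; g \<in> carrier C\<rbrakk> \<Longrightarrow> integrated Y (f \<ominus>\<^bsub>C\<^esub> g) = integrated Y f \<ominus>\<^bsub>S\<^esub> integrated Y g"
  by (simp add: C.minus_eq C.minus_smult S.minus_eq S.minus_smult integrated_add integrated_smult)

lemma integrated_le_l1:
  assumes f: "f \<in> carrier C" shows "\<parallel>integrated Y f\<parallel>\<^bsub>S\<^esub> \<le> l1 f"
proof -
  have "\<parallel>\<Oplus>\<^bsub>S\<^esub>t\<in>T. Y t (f t)\<parallel>\<^bsub>S\<^esub> \<le> (\<Sum>t\<in>T. \<parallel>f t\<parallel>)" if "finite T" "T \<subseteq> carrier H" for T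
    using that
  proof (induction T rule: finite_induct)
    case (insert t T)
    have "(\<Oplus>\<^bsub>S\<^esub>s\<in>insert t T. Y s (f s)) = Y t (f t) \<oplus>\<^bsub>S\<^esub> (\<Oplus>\<^bsub>S\<^esub>s\<in>T. Y s (f s))"
      using insert f by (intro S.M.finsum_insert) auto
    moreover have "(\<Oplus>\<^bsub>S\<^esub>s\<in>T. Y s (f s)) \<in> carrier S" using insert f by (intro S.M.finsum_closed) auto
    ultimately show ?case
      using insert f S.nrm_triangle[of "Y t (f t)" "\<Oplus>\<^bsub>S\<^esub>s\<in>T. Y s (f s)"] covariant_family_nrm[OF Y, of t "f t"] by simp
  qed simp
  then show ?thesis using conv_finite_supp[OF f] by (simp add: integrated_def l1_norm_def)
qed

text \<open>
  The norm of the integrated form is one of the seminorms that define the full norm.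
\<close>

lemma integrated_le: "f \<in> carrier C \<Longrightarrow> \<parallel>integrated Y f\<parallel>\<^bsub>S\<^esub> \<le> \<parallel>f\<parallel>\<^bsub>C\<^esub>"
proof (rule admissible_le)
  show "admissible (\<lambda>f. \<parallel>integrated Y f\<parallel>\<^bsub>S\<^esub>)"
    unfolding admissible_def cstar_seminorm_def
    by (auto simp: integrated_smult integrated_add integrated_mult integrated_adj S.nrm_smult S.nrm_triangle S.nrm_mult
      S.nrm_cstar integrated_le_l1)
qed

text \<open>
  The continuous extension of the integrated form to classes of Cauchy sequences. The limit exists
  by completeness of the sequence algebra and depends only on the class, by
  \<open>integrated_le\<close>.
\<close>

definition extension :: "(nat \<Rightarrow> 'h \<Rightarrow> 'a) set \<Rightarrow> (nat \<Rightarrow> 'a) set" where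
  "extension Z = (THE z. \<exists>x\<in>carrier (linf C). Z = seq_class C x \<and> S.tends (\<lambda>n. integrated Y (x n)) z)"

lemma extension_eq:
  assumes x: "x \<in> carrier (linf C)" and z: "S.tends (\<lambda>n. integrated Y (x n)) z"
  shows "extension (seq_class C x) = z"
  unfolding extension_def
proof (rule the_equality)
  show "\<exists>x'\<in>carrier (linf C). seq_class C x = seq_class C x' \<and> S.tends (\<lambda>n. integrated Y (x' n)) z"
    using x z by blast
  fix z' assume "\<exists>x'\<in>carrier (linf C). seq_class C x = seq_class C x' \<and> S.tends (\<lambda>n. integrated Y (x' n)) z'"
  then obtain x' where x': "x' \<in> carrier (linf C)" "seq_class C x = seq_class C x'"
    and z': "S.tends (\<lambda>n. integrated Y (x' n)) z'" by blast
  have null: "C.null_diff x' x" using C.seq_class_eq_iff[OF x'(1) x] x'(2) by simp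
  have xc: "x n \<in> carrier C" "x' n \<in> carrier C" for n using x x' by (simp_all add: linfD)
  have "S.tends (\<lambda>n. integrated Y (x' n) \<ominus>\<^bsub>S\<^esub> integrated Y (x n)) \<zero>\<^bsub>S\<^esub>"
  proof (rule S.tendsI[where f = "\<lambda>n. \<parallel>x' n \<ominus>\<^bsub>C\<^esub> x n\<parallel>\<^bsub>C\<^esub>"])
    fix n
    show "\<parallel>integrated Y (x' n) \<ominus>\<^bsub>S\<^esub> integrated Y (x n) \<ominus>\<^bsub>S\<^esub> \<zero>\<^bsub>S\<^esub>\<parallel>\<^bsub>S\<^esub> \<le> \<parallel>x' n \<ominus>\<^bsub>C\<^esub> x n\<parallel>\<^bsub>C\<^esub>"
      using integrated_le[of "x' n \<ominus>\<^bsub>C\<^esub> x n"] xc by (simp add: integrated_minus S.minus_eq)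
  qed (use null xc in \<open>simp_all add: C.null_diff_def\<close>)
  then have "z' \<ominus>\<^bsub>S\<^esub> z = \<zero>\<^bsub>S\<^esub>" using S.tends_diff[OF z' z] S.tends_unique by blast
  then show "z' = z" by (rule S.eq_if_minus_zero[OF S.tendsD(2)[OF z'] S.tendsD(2)[OF z]])
qed

lemma integrated_converges:
  assumes x: "x \<in> cauchy_seqs C"
  obtains z where "S.tends (\<lambda>n. integrated Y (x n)) z" "extension (seq_class C x) = z"
proof -
  have xl: "x \<in> carrier (linf C)" using x by simp
  have xc: "x n \<in> carrier C" for n using xl by (rule linfD)
  obtain z where z: "S.tends (\<lambda>n. integrated Y (x n)) z"
  proof (rule S.cauchy_converges[of "\<lambda>n. integrated Y (x n)"])
    fix \<epsilon> :: real assume "\<epsilon> > 0"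
    then obtain N where N: "\<forall>m\<ge>N. \<forall>n\<ge>N. \<parallel>x m \<ominus>\<^bsub>C\<^esub> x n\<parallel>\<^bsub>C\<^esub> < \<epsilon>" using x unfolding cauchy_seqs_def by blast
    have "\<parallel>integrated Y (x m) \<ominus>\<^bsub>S\<^esub> integrated Y (x n)\<parallel>\<^bsub>S\<^esub> < \<epsilon>" if "m \<ge> N" "n \<ge> N" for m n
      using integrated_le[of "x m \<ominus>\<^bsub>C\<^esub> x n"] xc N[rule_format, OF that] by (simp add: integrated_minus)
    then show "\<exists>N. \<forall>m\<ge>N. \<forall>n\<ge>N. \<parallel>integrated Y (x m) \<ominus>\<^bsub>S\<^esub> integrated Y (x n)\<parallel>\<^bsub>S\<^esub> < \<epsilon>" by blast
  qed (use xc in simp_all)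
  then show ?thesis using that extension_eq[OF xl z] by blast
qed

lemma extension_equivariant_star_hom: "equivariant_star_hom H P Ad_crossed S \<sigma> extension"
  unfolding equivariant_star_hom_def star_hom_def
proof (intro conjI ballI allI Pi_I)
  fix X assume "X \<in> carrier P"
  then obtain x where x: "x \<in> cauchy_seqs C" and X: "X = seq_class C x" by (auto simp: P_carrier)
  have xl: "x \<in> carrier (linf C)" using x by simp
  have xc [simp]: "x n \<in> carrier C" for n using xl by (rule linfD)
  obtain z where z: "S.tends (\<lambda>n. integrated Y (x n)) z" and eX: "extension X = z"
    using integrated_converges[OF x] X by blast
  show "extension X \<in> carrier S" using S.tendsD(2)[OF z] by (simp add: eX)
  show "extension (c \<odot>\<^bsub>P\<^esub> X) = c \<odot>\<^bsub>S\<^esub> extension X" for c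
    unfolding X P_simps C.seq_class_smult[OF xl] eX[unfolded X]
    by (rule extension_eq[OF C.linf_smult[OF xl]]) (simp add: integrated_smult S.tends_smult[OF z])
  show "extension (X\<^sup>\<star>\<^bsub>P\<^esub>) = (extension X)\<^sup>\<star>\<^bsub>S\<^esub>"
    unfolding X P_simps C.seq_class_adj[OF xl] eX[unfolded X]
    by (rule extension_eq[OF C.linf_adj[OF xl]]) (simp add: integrated_adj S.tends_adj[OF z])
  fix Y' assume "Y' \<in> carrier P"
  then obtain y where y: "y \<in> cauchy_seqs C" and Y': "Y' = seq_class C y" by (auto simp: P_carrier)
  have yl: "y \<in> carrier (linf C)" using y by simp
  have yc [simp]: "y n \<in> carrier C" for n using yl by (rule linfD)
  obtain u where u: "S.tends (\<lambda>n. integrated Y (y n)) u" and eY: "extension Y' = u"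
    using integrated_converges[OF y] Y' by blast
  show "extension (X \<oplus>\<^bsub>P\<^esub> Y') = extension X \<oplus>\<^bsub>S\<^esub> extension Y'"
    unfolding X Y' P_simps C.seq_class_add[OF xl yl] eX[unfolded X] eY[unfolded Y']
    by (rule extension_eq[OF C.linf_add[OF xl yl]]) (simp add: integrated_add S.tends_add[OF z u])
  show "extension (X \<otimes>\<^bsub>P\<^esub> Y') = extension X \<otimes>\<^bsub>S\<^esub> extension Y'"
    unfolding X Y' P_simps C.seq_class_mult[OF xl yl] eX[unfolded X] eY[unfolded Y']
    by (rule extension_eq[OF C.linf_mult[OF xl yl]]) (simp add: integrated_mult S.tends_mult[OF z u])
next
  fix h X assume h [simp]: "h \<in> carrier H" and "X \<in> carrier P"
  then obtain x where x: "x \<in> cauchy_seqs C" and X: "X = seq_class C x" by (auto simp: P_carrier)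
  have xl: "x \<in> carrier (linf C)" using x by simp
  have xc [simp]: "x n \<in> carrier C" for n using xl by (rule linfD)
  obtain z where z: "S.tends (\<lambda>n. integrated Y (x n)) z" and eX: "extension X = z"
    using integrated_converges[OF x] X by blast
  note zS = S.tendsD(2)[OF z]
  have cl: "(\<lambda>n. conjugate h (x n)) \<in> carrier (linf C)"
    unfolding conjugate_def using x by (intro cauchy_linf cauchy_shift cauchy_adj h)
  have "S.tends (\<lambda>n. \<sigma> h (integrated Y (x n))) (\<sigma> h z)"
  proof (rule S.tendsI[OF _ _ _ S.tendsD(3)[OF z]])
    show "\<parallel>\<sigma> h (integrated Y (x n)) \<ominus>\<^bsub>S\<^esub> \<sigma> h z\<parallel>\<^bsub>S\<^esub> \<le> \<parallel>integrated Y (x n) \<ominus>\<^bsub>S\<^esub> z\<parallel>\<^bsub>S\<^esub>" for n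
      using zS by (simp add: seq_action_ops(3)[symmetric] seq_action_nrm_le)
  qed (use zS in simp_all)
  then have "extension (seq_class C (\<lambda>n. conjugate h (x n))) = \<sigma> h z"
    by (intro extension_eq[OF cl]) (simp add: integrated_conjugate)
  then show "extension (Ad_crossed h X) = \<sigma> h (extension X)"
    by (simp add: X Ad_class x eX[unfolded X])
qed

lemma extension_crossed_incl: "a \<in> carrier A \<Longrightarrow> extension (crossed_incl H A \<alpha> a) = \<kappa> a"
  unfolding crossed_incl_eq
  by (intro extension_eq) (simp_all add: integrated_single covariant_familyD(7)[OF Y] S.tends_const)

theorem split_if_covariant_family:
  "equivariantly_sequentially_split H A \<alpha> P Ad_crossed (crossed_incl H A \<alpha>)"
  unfolding equivariantly_sequentially_split_def
  using crossed_incl_equivariant extension_equivariant_star_hom extension_crossed_incl by blast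

end

end

section \<open>The equivalence\<close>

theorem proposition4p23:
  fixes A :: "'a cstar_struct"
    and H :: "('h, 'm) monoid_scheme"
    and \<alpha> :: "'h \<Rightarrow> 'a \<Rightarrow> 'a"
  defines "D \<equiv> seq_hereditary A"
  assumes "cstar_algebra A"
    and "separable_space (cstar_topology A)"
    and "group H"
    and "countable (carrier H)"
    and "cstar_action H A \<alpha>"
  shows "(approximately_representable H A \<alpha> \<longleftrightarrow>
      (\<exists>w \<in> hom H (unitary_group (multiplier_algebra D)).
        (\<forall>h\<in>carrier H. \<forall>a\<in>carrier A.
          multiplier_incl D (const_seq A (\<alpha> h a)) =
            w h \<otimes>\<^bsub>multiplier_algebra D\<^esub> multiplier_incl D (const_seq A a)
              \<otimes>\<^bsub>multiplier_algebra D\<^esub> (w h)\<^sup>\<star>\<^bsub>multiplier_algebra D\<^esub>) \<and>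
        (\<forall>g\<in>carrier H. \<forall>h\<in>carrier H.
          multiplier_extend D (seq_action A \<alpha> h) (w g) = w (h \<otimes>\<^bsub>H\<^esub> g \<otimes>\<^bsub>H\<^esub> inv\<^bsub>H\<^esub> h))))
    \<and> (approximately_representable H A \<alpha> \<longleftrightarrow>
      equivariantly_sequentially_split H A \<alpha> (crossed_product H A \<alpha>)
        (\<lambda>h. multiplier_Ad (crossed_product H A \<alpha>) (crossed_unitary H A \<alpha> h))
        (crossed_incl H A \<alpha>))"
proof -
  interpret sys: cstar_dynamical_system A H \<alpha>
    using assms(2,4,6) by (intro cstar_dynamical_system.intro cstar_dynamical_system_axioms.intro)
  have impl: "approximately_representable H A \<alpha> \<Longrightarrow> \<exists>X. sys.implementing X"
    by (erule sys.implementing_if_approximately_representable) (erule exI)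
  have repr: "approximately_representable H A \<alpha>" if "sys.covariant_family Y" for Y
    by (rule sys.approximately_representable_if_covariant_family[OF assms(3,5) that])
  have ii: "approximately_representable H A \<alpha> \<longleftrightarrow> (\<exists>w. sys.multiplier_representation w)"
  proof
    assume "approximately_representable H A \<alpha>"
    then obtain X where "sys.implementing X" using impl by (meson)
    from sys.multiplier_representation_if_implementing[OF this]
    show "\<exists>w. sys.multiplier_representation w" by - (rule exI)
  next
    assume "\<exists>w. sys.multiplier_representation w"
    then obtain w where "sys.multiplier_representation w" ..
    then show "approximately_representable H A \<alpha>"
      by (rule repr[OF sys.covariant_family_if_multiplier_representation])
  qed
  have iii: "approximately_representable H A \<alpha> \<longleftrightarrow>
      equivariantly_sequentially_split H A \<alpha> (crossed_product H A \<alpha>)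
        (\<lambda>h. multiplier_Ad (crossed_product H A \<alpha>) (crossed_unitary H A \<alpha> h)) (crossed_incl H A \<alpha>)"
    (is "_ \<longleftrightarrow> ?split")
  proof
    assume "approximately_representable H A \<alpha>"
    then obtain X where "sys.implementing X" using impl by (meson)
    then show ?split
      by (rule sys.split_if_covariant_family[OF sys.covariant_family_if_implementing])
  next
    assume ?split
    then obtain \<psi> where \<psi>: "equivariant_star_hom H (crossed_product H A \<alpha>)
        (\<lambda>h. multiplier_Ad (crossed_product H A \<alpha>) (crossed_unitary H A \<alpha> h)) (seq_algebra A) (seq_action A \<alpha>) \<psi>"
      and split: "\<forall>a\<in>carrier A. \<psi> (crossed_incl H A \<alpha> a) = const_seq A a"
      unfolding equivariantly_sequentially_split_def by (elim conjE exE)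
    show "approximately_representable H A \<alpha>"
      by (rule repr[OF sys.covariant_family_if_split[OF \<psi> bspec[OF split]]])
  qed
  show ?thesis
  proof
    show "approximately_representable H A \<alpha> \<longleftrightarrow>
      (\<exists>w \<in> hom H (unitary_group (multiplier_algebra D)).
        (\<forall>h\<in>carrier H. \<forall>a\<in>carrier A.
          multiplier_incl D (const_seq A (\<alpha> h a)) =
            w h \<otimes>\<^bsub>multiplier_algebra D\<^esub> multiplier_incl D (const_seq A a)
              \<otimes>\<^bsub>multiplier_algebra D\<^esub> (w h)\<^sup>\<star>\<^bsub>multiplier_algebra D\<^esub>) \<and>
        (\<forall>g\<in>carrier H. \<forall>h\<in>carrier H.
          multiplier_extend D (seq_action A \<alpha> h) (w g) = w (h \<otimes>\<^bsub>H\<^esub> g \<otimes>\<^bsub>H\<^esub> inv\<^bsub>H\<^esub> h)))"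
      unfolding ii sys.multiplier_representation_def D_def Bex_def ..
  qed (rule iii)
qed

end
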